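(* Let $N$ be a positive integer, $\mathcal{A}\subset\mathbb{N}\cap[1,N]$, and for each prime $p$ let $\Omega_p\subset\mathbb{Z}/p\mathbb{Z}$ be a set of residue classes with $\omega(p)=|\Omega_p|$. Let $\kappa\geq 3$ be an integer and suppose there is a finite set of primes $\mathcal{P}_0$ such that (C1) $\omega(p)<\kappa$ for all $p\in\mathcal{P}_0$ and $\omega(p)=\kappa$ for all primes $p\notin\mathcal{P}_0$, and (C2) $\omega(p)<p$ for all primes $p$. Put $z=\sqrt{\tfrac23 N}$. Then: (i) if $\kappa=3$ and $N\geq 437400$, \[S(\mathcal{A},\Omega,z) < 48\prod_p\left(1-\frac{\omega(p)}{p}\right)\left(1-\frac{1}{p}\right)^{-3}\frac{N}{P(\log N)},\] with $P(t) = t^3 - 34.549t^2 + 379.423t -553.222$; (ii) for every integer $\kappa\geq 3$ and $N>\exp(r_\kappa)$, where $r_\kappa = 5.961\cdot 10^{14}\kappa^2\log\kappa$, \[S(\mathcal{A},\Omega,z) <2^{\kappa}\kappa!\prod_p\left(1-\frac{\omega(p)}{p}\right)\left(1-\frac{1}{p}\right)^{-\kappa}\frac{N}{\log^\kappa N}\left(1-\frac{r_\kappa}{\log N}\right)^{-1}.\]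
   Context: The sifting function is $S(\mathcal{A},\Omega,z) = \#\{a\in\mathcal{A}: a \bmod p\notin\Omega_p \text{ for all primes } p\leq z\}$. Products $\prod_p$ run over all primes. *)

theory Defs
  imports "HOL-Analysis.Analysis"
begin

text \<open>Residue classes mod p are represented by their least nonnegative representatives,
  so \<open>Omega p \<subseteq> {0..<p}\<close> models a subset of Z/pZ, and omega p = card (Omega p).\<close>

definition sifting_fun :: "nat set \<Rightarrow> (nat \<Rightarrow> nat set) \<Rightarrow> real \<Rightarrow> nat" where
  "sifting_fun A Omega z =
     card {a \<in> A. \<forall>p. prime p \<and> real p \<le> z \<longrightarrow> a mod p \<notin> Omega p}"

definition sieve_prod :: "(nat \<Rightarrow> nat set) \<Rightarrow> nat \<Rightarrow> real" where
  "sieve_prod Omega kappa =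
     (\<Prod>p. if prime p
            then (1 - real (card (Omega p)) / real p) * (1 - 1 / real p) powi (- int kappa)
            else 1)"

end

theory Submission
  imports Defs "HOL-Computational_Algebra.Squarefree" "HOL-Library.Discrete_Functions"
begin

text \<open>Let \<open>M = \<lfloor>sqrt (N / 2)\<rfloor>\<close> and \<open>h(p) = \<omega>(p) / (p - \<omega>(p))\<close>. A large sieve inequality for the fractions \<open>a/q\<close>
  with \<open>q \<le> M\<close> and weights \<open>N + 2 q M\<close> (weaker than Montgomery and Vaughan's \<open>N + 3/2 q M\<close>, but provable
  by Schur's test) bounds the number of sifted elements by \<open>N / L\<close>, where
  \<open>L = \<Sum> h(q) / (1 + 2 q M / N)\<close> over squarefree \<open>q \<le> M\<close>.

  Up to the factor \<open>\<Prod> (1 - \<omega>(p)/p)\<close>, the sum \<open>L\<close> is the mean of a decreasing function of a random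
  product \<open>\<Prod> p ^ X\<^sub>p\<close> with independent Bernoulli variables \<open>X\<^sub>p\<close> of mean \<open>\<omega>(p)/p\<close>. Each \<open>X\<^sub>p\<close> is
  stochastically smaller than a sum of \<open>\<kappa>\<close> geometric variables of ratio \<open>1/p\<close> and a Bernoulli
  variable \<open>Y\<^sub>p\<close> of mean \<open>O(1/p\<^sup>2)\<close>. By unique factorisation, each of the \<open>\<kappa>\<close> geometric layers turns
  into a harmonic sum over all integers, hence integrates once with respect to \<open>log\<close>; this produces
  \<open>(log M - log 2)^\<kappa> / \<kappa>!\<close>. Jensen's inequality replaces the \<open>Y\<^sub>p\<close> by the shift \<open>\<Sum> E Y\<^sub>p log p\<close>, which is
  at most \<open>0.92\<close> for \<open>\<kappa> = 3\<close> and at most \<open>3 \<kappa> log \<kappa>\<close> in general, uniformly in the exceptional set.\<close>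

section \<open>The weighted large sieve for Farey fractions\<close>

text \<open>Montgomery and Vaughan's constant 3/2 would pair with \<open>z = sqrt (2 N / 3)\<close>;
  the constant 2 pairs with the smaller \<open>M\<close>, and \<open>M <= z\<close> keeps the
  sifting condition available. In both cases the point is to have the weight of \<open>q\<close> at
  least \<open>1 / (1 + q / M)\<close> (with \<open>z\<close> for \<open>M\<close> in the first
  case), a function of the ratio only. The obstacle is a lower bound for \<open>L\<close> that is
  explicit and uniform in the exceptional primes. The functions to be averaged increase with their
  argument, so only the probabilities of exponent 0 need to be compared, and no estimate for the
  distribution of primes enters. The primes may run up to any \<open>n >= M\<close>; letting
  \<open>n\<close> grow at the very end produces the infinite product without an error term. Up to
  rounding, \<open>2 (log M - log 2)\<close> is \<open>log N - 3 log 2\<close>. For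
  \<open>kappa = 3\<close> there is little room: \<open>3 log 2 + 2 * 0.92\<close> plus the rounding
  loss stays just below 3.924, and \<open>(t - 3.924)^3\<close> exceeds \<open>P(t)\<close> by less
  than 2.4 at \<open>t = 12.97\<close>. Hence the careful computation of the shift in that
  case.\<close>

definition ee :: "real \<Rightarrow> complex" where
  "ee x = cis (2 * pi * x)"

lemma ee_add: "ee (x + y) = ee x * ee y"
  by (simp add: ee_def cis_mult distrib_left)

lemma ee_minus: "ee (- x) = cnj (ee x)"
  by (simp add: ee_def cis_cnj)

lemma ee_diff: "ee (x - y) = ee x * cnj (ee y)"
  using ee_add[of x "-y"] by (simp add: ee_minus)

lemma ee_int [simp]: "ee (of_int k) = 1" "ee (real n) = 1"
  by (simp_all add: ee_def)

lemma ee_0 [simp]: "ee 0 = 1"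
  by (simp add: ee_def)

lemma norm_ee [simp]: "norm (ee x) = 1"
  by (simp add: ee_def)

lemma ee_mult_nat: "ee (real n * x) = ee x ^ n"
  unfolding ee_def Complex.DeMoivre by (simp only: mult.left_commute mult.assoc)

lemma norm_one_minus_ee: "(norm (1 - ee x))\<^sup>2 = 4 * (sin (pi * x))\<^sup>2"
proof -
  have c: "cos (2 * pi * x) = 1 - 2 * (sin (pi * x))\<^sup>2"
    using cos_double_sin[of "pi * x"] by (simp add: mult_ac)
  have "(norm (1 - ee x))\<^sup>2 = (1 - cos (2 * pi * x))\<^sup>2 + (sin (2 * pi * x))\<^sup>2"
    by (simp add: ee_def cmod_power2)
  also have "\<dots> = 2 - 2 * cos (2 * pi * x)"
    using sin_cos_squared_add[of "2 * pi * x"] by (simp add: power2_eq_square algebra_simps)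
  finally show ?thesis using c by simp
qed

lemma ee_eq_1_iff: "ee x = 1 \<longleftrightarrow> sin (pi * x) = 0"
  using norm_one_minus_ee[of x] by (metis eq_iff_diff_eq_0 mult_eq_0_iff norm_eq_zero power_eq_0_iff zero_neq_numeral zero_power2 right_minus_eq)

lemma sin_pi_eq_0_iff: "sin (pi * x) = 0 \<longleftrightarrow> x \<in> \<int>"
  by (auto simp: sin_zero_iff_int2 Ints_def mult.commute)

lemma sum_ee_multiples:
  "(\<Sum>n<q. ee (real n * x)) = (if ee x = 1 then of_nat q else (1 - ee (real q * x)) / (1 - ee x))"
  by (simp add: ee_mult_nat sum_gp_strict)

lemma sum_ee_root:
  fixes t :: int
  assumes "q > 0"
  shows "(\<Sum>n<q. ee (real n * (of_int t / real q))) = (if int q dvd t then of_nat q else 0)"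
proof -
  have "ee (of_int t / real q) = 1 \<longleftrightarrow> int q dvd t"
  proof -
    have "of_int t / real q \<in> \<int> \<longleftrightarrow> int q dvd t"
    proof
      assume "of_int t / real q \<in> \<int>"
      then obtain s :: int where "of_int t / real q = of_int s" by (auto elim: Ints_cases)
      then have "(of_int t :: real) = of_int (s * int q)" using assms by (simp add: field_simps)
      then show "int q dvd t" by (simp only: of_int_eq_iff) simp
    next
      assume "int q dvd t"
      then obtain s where "t = int q * s" by auto
      then show "of_int t / real q \<in> \<int>" using assms by simp
    qed
    then show ?thesis by (simp only: ee_eq_1_iff sin_pi_eq_0_iff)
  qed
  moreover have "ee (real q * (of_int t / real q)) = 1" using assms by simp
  ultimately show ?thesis by (simp only: sum_ee_multiples) simp
qed

section \<open>The discrete Fourier transform modulo q\<close>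

definition dft :: "nat \<Rightarrow> (nat \<Rightarrow> complex) \<Rightarrow> nat \<Rightarrow> complex" where
  "dft q f k = (\<Sum>n<q. f n * cnj (ee (real n * real k / real q)))"

lemma sum_ee_orth:
  assumes "m < q" "n < q"
  shows "(\<Sum>k<q. ee (real m * real k / real q) * cnj (ee (real n * real k / real q)))
    = (if m = n then of_nat q else 0)"
proof -
  have "(\<Sum>k<q. ee (real m * real k / real q) * cnj (ee (real n * real k / real q)))
     = (\<Sum>k<q. ee (real k * (of_int (int m - int n) / real q)))"
    unfolding ee_diff[symmetric] by (intro sum.cong arg_cong[of _ _ ee]) (auto simp: field_simps)
  also have "\<dots> = (if int q dvd int m - int n then of_nat q else 0)"
    using assms by (intro sum_ee_root) auto
  also have "int q dvd int m - int n \<longleftrightarrow> m = n"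
  proof
    assume "int q dvd int m - int n"
    then have "int m mod int q = int n mod int q" by (simp add: mod_eq_dvd_iff)
    then show "m = n" using assms by simp
  qed simp
  finally show ?thesis .
qed

lemma dft_inversion:
  assumes "n < q"
  shows "(\<Sum>k<q. dft q f k * ee (real n * real k / real q)) = of_nat q * f n"
proof -
  have "(\<Sum>k<q. dft q f k * ee (real n * real k / real q))
     = (\<Sum>m<q. f m * (\<Sum>k<q. ee (real n * real k / real q) * cnj (ee (real m * real k / real q))))"
    unfolding dft_def sum_distrib_left sum_distrib_right
    by (subst sum.swap) (simp add: mult_ac)
  also have "\<dots> = (\<Sum>m<q. if m = n then of_nat q * f m else 0)"
    using assms by (intro sum.cong) (auto simp: sum_ee_orth)
  finally show ?thesis using assms by simp
qed

lemma dft_Parseval: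
  "(\<Sum>k<q. (norm (dft q f k))\<^sup>2) = real q * (\<Sum>n<q. (norm (f n))\<^sup>2)"
proof -
  have "complex_of_real (\<Sum>k<q. (norm (dft q f k))\<^sup>2) = (\<Sum>k<q. dft q f k * cnj (dft q f k))"
    by (simp add: complex_norm_square[symmetric])
  also have "\<dots> = (\<Sum>k<q. \<Sum>n<q. dft q f k * ee (real n * real k / real q) * cnj (f n))"
    by (subst (2) dft_def) (simp add: sum_distrib_left mult_ac)
  also have "\<dots> = (\<Sum>n<q. (\<Sum>k<q. dft q f k * ee (real n * real k / real q)) * cnj (f n))"
    by (subst sum.swap) (simp add: sum_distrib_right)
  also have "\<dots> = (\<Sum>n<q. of_nat q * (f n * cnj (f n)))"
    by (simp add: dft_inversion mult_ac)
  also have "\<dots> = complex_of_real (real q * (\<Sum>n<q. (norm (f n))\<^sup>2))"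
    by (simp add: complex_norm_square[symmetric] sum_distrib_left)
  finally show ?thesis by (simp only: of_real_eq_iff)
qed

text \<open>In both evaluations of \<open>\<Sum> 1 / sin\<^sup>2\<close> below, the convention \<open>1 / 0 = 0\<close> drops the pole, if any.
  They are Parseval's identity for \<open>j \<mapsto> ee (j * x)\<close> and for \<open>j \<mapsto> j\<close>.\<close>

lemma sum_inverse_sin_squared:
  assumes "q > 0" "sin (pi * (real q * x)) \<noteq> 0"
  shows "(\<Sum>k<q. 1 / (sin (pi * (x - real k / real q)))\<^sup>2) = (real q)\<^sup>2 / (sin (pi * (real q * x)))\<^sup>2"
proof -
  have nz: "sin (pi * (x - real k / real q)) \<noteq> 0" for k
  proof
    assume "sin (pi * (x - real k / real q)) = 0"
    then have "x - real k / real q \<in> \<int>" by (simp add: sin_pi_eq_0_iff)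
    then have "real q * (x - real k / real q) + real k \<in> \<int>"
      by (intro Ints_add Ints_mult) auto
    then have "real q * x \<in> \<int>" using assms(1) by (simp add: algebra_simps)
    then show False using assms(2) by (simp add: sin_pi_eq_0_iff)
  qed
  have d: "(norm (dft q (\<lambda>j. ee (real j * x)) k))\<^sup>2
     = (sin (pi * (real q * x)))\<^sup>2 * (1 / (sin (pi * (x - real k / real q)))\<^sup>2)" for k
  proof -
    have "dft q (\<lambda>j. ee (real j * x)) k = (\<Sum>j<q. ee (real j * (x - real k / real q)))"
      unfolding dft_def by (simp add: ee_diff[symmetric] algebra_simps)
    also have "\<dots> = (1 - ee (real q * x)) / (1 - ee (x - real k / real q))"
    proof -
      have "ee (real q * (x - real k / real q)) = ee (real q * x - real k)"
        using assms(1) by (simp add: algebra_simps)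
      also have "\<dots> = ee (real q * x)" by (simp add: ee_diff)
      finally show ?thesis using nz by (simp add: sum_ee_multiples ee_eq_1_iff)
    qed
    finally show ?thesis
      by (simp add: norm_divide power_divide norm_one_minus_ee)
  qed
  have "(sin (pi * (real q * x)))\<^sup>2 * (\<Sum>k<q. 1 / (sin (pi * (x - real k / real q)))\<^sup>2) = (real q)\<^sup>2"
    using dft_Parseval[of q "\<lambda>j. ee (real j * x)"] unfolding d sum_distrib_left[symmetric]
    by (simp add: power2_eq_square)
  then show ?thesis using assms(2) by (simp add: field_simps)
qed

lemma sum_inverse_sin_squared_root:
  assumes "q > 0"
  shows "(\<Sum>k<q. 1 / (sin (pi * (real k / real q)))\<^sup>2) = ((real q)\<^sup>2 - 1) / 3"
proof -
  have d0: "(norm (dft q (\<lambda>j. of_nat j) 0))\<^sup>2 = (real q)\<^sup>2 * (real q - 1)\<^sup>2 / 4"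
  proof -
    have "(\<Sum>j<q. complex_of_nat j) = complex_of_real (real q * (real q - 1) / 2)"
      by (induction q) (auto simp: field_simps)
    moreover have "dft q (\<lambda>j. of_nat j) 0 = (\<Sum>j<q. complex_of_nat j)"
      by (simp add: dft_def)
    ultimately have "norm (dft q (\<lambda>j. of_nat j) 0) = \<bar>real q * (real q - 1) / 2\<bar>"
      by (simp only: norm_of_real)
    then show ?thesis by (simp only: power2_abs power_mult_distrib power_divide) simp
  qed
  have d: "(norm (dft q (\<lambda>j. of_nat j) k))\<^sup>2 = (real q)\<^sup>2 / 4 * (1 / (sin (pi * (real k / real q)))\<^sup>2)"
    if "k < q" "k \<noteq> 0" for k
  proof -
    define w where "w = cnj (ee (real k / real q))"
    have w1: "w \<noteq> 1"
    proof -
      have "real k / real q \<notin> \<int>"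
      proof
        assume "real k / real q \<in> \<int>"
        then obtain s :: int where s: "real k / real q = of_int s" by (auto elim: Ints_cases)
        have "0 < real k / real q" "real k / real q < 1" using that by auto
        then show False using s by simp
      qed
      then have "ee (real k / real q) \<noteq> 1" by (simp only: ee_eq_1_iff sin_pi_eq_0_iff not_False_eq_True)
      then show ?thesis by (simp add: w_def complex_eq_iff)
    qed
    have wq: "w ^ q = 1" unfolding w_def complex_cnj_power[symmetric] ee_mult_nat[symmetric]
      using assms by simp
    \<comment> \<open>The closed form of the sum of \<open>j * w^j\<close>, cleared of its
      denominator so that induction on \<open>m\<close> applies. At \<open>m = q\<close> the
      relation \<open>w^q = 1\<close> leaves only \<open>- q * (1 - w)\<close>.\<close>
    have "(\<Sum>j<m. of_nat j * w ^ j) * (1 - w)\<^sup>2 = w - of_nat m * w ^ m * (1 - w) - w * w ^ m" for m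
      by (induction m) (auto simp: algebra_simps power2_eq_square)
    from this[of q] have "(\<Sum>j<q. of_nat j * w ^ j) * (1 - w)\<^sup>2 = - of_nat q * (1 - w)"
      using wq by simp
    then have "((\<Sum>j<q. of_nat j * w ^ j) * (1 - w) + of_nat q) * (1 - w) = 0"
      by (simp add: power2_eq_square algebra_simps)
    then have "(\<Sum>j<q. of_nat j * w ^ j) * (1 - w) = - of_nat q"
      using w1 by (simp add: eq_neg_iff_add_eq_0)
    then have "(\<Sum>j<q. of_nat j * w ^ j) = - of_nat q / (1 - w)"
      using w1 by (metis nonzero_eq_divide_eq right_minus_eq)
    moreover have "dft q (\<lambda>j. of_nat j) k = (\<Sum>j<q. of_nat j * w ^ j)"
      unfolding dft_def w_def by (simp add: ee_mult_nat flip: times_divide_eq_right)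
    moreover have "(norm (1 - w))\<^sup>2 = 4 * (sin (pi * (real k / real q)))\<^sup>2"
      using norm_one_minus_ee[of "real k / real q"] unfolding w_def
      by (metis complex_cnj_diff complex_cnj_one complex_mod_cnj)
    ultimately show ?thesis by (simp add: norm_divide power_divide)
  qed
  have "(\<Sum>k<q. (norm (dft q (\<lambda>j. of_nat j) k))\<^sup>2) = (norm (dft q (\<lambda>j. of_nat j) 0))\<^sup>2
     + (\<Sum>k\<in>{..<q} - {0}. (norm (dft q (\<lambda>j. of_nat j) k))\<^sup>2)"
    using assms by (subst sum.remove[of _ 0]) auto
  also have "(\<Sum>k\<in>{..<q} - {0}. (norm (dft q (\<lambda>j. of_nat j) k))\<^sup>2)
     = (\<Sum>k\<in>{..<q} - {0}. (real q)\<^sup>2 / 4 * (1 / (sin (pi * (real k / real q)))\<^sup>2))"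
    by (intro sum.cong) (auto simp: d)
  \<comment> \<open>Index 0 can be put back, since its summand \<open>1 / sin^2 0\<close> is
    0.\<close>
  also have "\<dots> = (real q)\<^sup>2 / 4 * (\<Sum>k<q. 1 / (sin (pi * (real k / real q)))\<^sup>2)"
    using assms by (subst sum.remove[of "{..<q}" 0]) (auto simp: sum_distrib_left)
  finally have "(real q)\<^sup>2 * (real q - 1)\<^sup>2 / 4 + (real q)\<^sup>2 / 4 * (\<Sum>k<q. 1 / (sin (pi * (real k / real q)))\<^sup>2)
     = real q * (\<Sum>n<q. (real n)\<^sup>2)"
    by (simp add: d0 dft_Parseval)
  also have "(\<Sum>n<q. (real n)\<^sup>2) = (real q - 1) * real q * (2 * real q - 1) / 6"
    by (induction q) (auto simp: field_simps power2_eq_square)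
  finally have "(real q)\<^sup>2 * ((real q - 1)\<^sup>2 / 4 + (\<Sum>k<q. 1 / (sin (pi * (real k / real q)))\<^sup>2) / 4)
     = (real q)\<^sup>2 * ((real q - 1) * (2 * real q - 1) / 6)"
    by (simp add: algebra_simps power2_eq_square)
  then have "(real q - 1)\<^sup>2 / 4 + (\<Sum>k<q. 1 / (sin (pi * (real k / real q)))\<^sup>2) / 4
     = (real q - 1) * (2 * real q - 1) / 6"
    using assms by simp
  then show ?thesis by (simp add: field_simps power2_eq_square)
qed

section \<open>Sums of 1/sin^2 over complete residue systems\<close>

lemma sum_residues:
  fixes G :: "int \<Rightarrow> 'a::comm_monoid_add"
  assumes q: "q > 0" and per: "\<And>x. G (x mod int q) = G x"
    and inj: "inj_on (\<lambda>k. \<phi> k mod int q) {..<q}"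
  shows "(\<Sum>k<q. G (\<phi> k)) = (\<Sum>k<q. G (int k))"
proof -
  define \<psi> where "\<psi> = (\<lambda>k. nat (\<phi> k mod int q))"
  have lt: "\<psi> k < q" for k
  proof -
    have "\<phi> k mod int q < int q" using q by simp
    moreover have "0 \<le> \<phi> k mod int q" using q by simp
    ultimately show ?thesis by (simp add: \<psi>_def nat_less_iff)
  qed
  have "inj_on \<psi> {..<q}"
    using inj q by (auto simp: \<psi>_def inj_on_def nat_eq_iff)
  moreover have "\<psi> ` {..<q} \<subseteq> {..<q}" using lt by auto
  ultimately have "bij_betw \<psi> {..<q} {..<q}"
    by (simp add: bij_betw_def endo_inj_surj)
  then have "(\<Sum>k<q. G (int (\<psi> k))) = (\<Sum>k<q. G (int k))"
    by (rule sum.reindex_bij_betw)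
  moreover have "G (int (\<psi> k)) = G (\<phi> k)" for k
    using q per by (simp add: \<psi>_def)
  ultimately show ?thesis by simp
qed

text \<open>Integer numerators make the dependence on the residue of \<open>t\<close> visible.
  Multiples of \<open>q\<close> get the value 0, so a sum over a complete residue system omits its
  pole.\<close>

definition csc2 :: "nat \<Rightarrow> int \<Rightarrow> real" where
  "csc2 q t = 1 / (sin (pi * (of_int t / real q)))\<^sup>2"

lemma csc2_periodic:
  assumes "q > 0"
  shows "csc2 q (t mod int q) = csc2 q t"
proof -
  have t: "t = t mod int q + int q * (t div int q)" by simp
  have "of_int t / real q = of_int (t mod int q) / real q + of_int (t div int q)"
    using assms by (subst (1) t) (simp only: of_int_add of_int_mult, simp add: field_simps)
  then have "sin (pi * (of_int t / real q))
      = sin (pi * (of_int (t mod int q) / real q)) * cos (pi * of_int (t div int q))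
       + cos (pi * (of_int (t mod int q) / real q)) * sin (pi * of_int (t div int q))"
    by (simp add: distrib_left sin_add)
  moreover have "sin (pi * of_int (t div int q)) = 0" by (simp add: sin_pi_eq_0_iff)
  moreover have "(cos (pi * of_int (t div int q)))\<^sup>2 = 1"
    using sin_cos_squared_add[of "pi * of_int (t div int q)"] \<open>sin _ = 0\<close> by simp
  ultimately show ?thesis by (simp add: csc2_def power_mult_distrib)
qed

lemma sum_csc2:
  assumes "q > 0" "inj_on (\<lambda>k. \<phi> k mod int q) {..<q}"
  shows "(\<Sum>k<q. csc2 q (\<phi> k)) = ((real q)\<^sup>2 - 1) / 3"
proof -
  have "(\<Sum>k<q. csc2 q (\<phi> k)) = (\<Sum>k<q. csc2 q (int k))"
    by (rule sum_residues) (use assms csc2_periodic in auto)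
  also have "\<dots> = ((real q)\<^sup>2 - 1) / 3"
    using sum_inverse_sin_squared_root[OF assms(1)] by (simp add: csc2_def)
  finally show ?thesis .
qed

section \<open>Summation by parts and trapezoidal weights\<close>

lemma sum_int_telescope:
  fixes f :: "int \<Rightarrow> real"
  assumes "a \<le> b + 1"
  shows "(\<Sum>n=a..b. f (n + 1) - f n) = f (b + 1) - f a"
proof -
  have "(\<Sum>n=a..a + int k - 1. f (n + 1) - f n) = f (a + int k) - f a" for k
  proof (induction k)
    case (Suc k)
    have "{a..a + int (Suc k) - 1} = insert (a + int k) {a..a + int k - 1}" by auto
    then show ?case using Suc by (simp add: add.assoc add.commute[of 1])
  qed auto
  from this[of "nat (b + 1 - a)"] show ?thesis using assms by (simp add: algebra_simps)
qed

text \<open>The second differences sum to 0 because \<open>f\<close> has bounded support. So the sum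
  of their absolute values is minus twice the sum over the block where they are nonpositive, and
  that block telescopes to the slopes at its two ends.\<close>

lemma sum_second_difference_le:
  fixes f :: "int \<Rightarrow> real"
  assumes zero: "\<And>n. \<bar>n\<bar> \<ge> B \<Longrightarrow> f n = 0"
    and N: "0 \<le> N" "N < B"
    and out: "\<And>n. n \<notin> {1..N} \<Longrightarrow> 0 \<le> f (n + 1) - 2 * f n + f (n - 1)"
    and ins: "\<And>n. n \<in> {1..N} \<Longrightarrow> f (n + 1) - 2 * f n + f (n - 1) \<le> 0"
  shows "(\<Sum>n=-B..B. \<bar>f (n + 1) - 2 * f n + f (n - 1)\<bar>)
     = 2 * ((f N - f (N + 1)) + (f 1 - f 0))"
proof -
  define D where "D = (\<lambda>n. f (n + 1) - 2 * f n + f (n - 1))"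
  define d where "d = (\<lambda>n. f n - f (n - 1))"
  have D: "D n = d (n + 1) - d n" for n by (simp add: D_def d_def)
  have tot: "(\<Sum>n=-B..B. D n) = 0"
    unfolding D using N zero by (subst sum_int_telescope) (auto simp: d_def)
  have "{1..N} \<subseteq> {-B..B}" using N by auto
  then have split: "(\<Sum>n=-B..B. g n) = (\<Sum>n\<in>{-B..B} - {1..N}. g n) + (\<Sum>n=1..N. g n)" for g :: "int \<Rightarrow> real"
    by (intro sum.subset_diff) auto
  have "(\<Sum>n=-B..B. \<bar>D n\<bar>) = (\<Sum>n\<in>{-B..B} - {1..N}. D n) - (\<Sum>n=1..N. D n)"
  proof -
    have "(\<Sum>n\<in>{-B..B} - {1..N}. \<bar>D n\<bar>) = (\<Sum>n\<in>{-B..B} - {1..N}. D n)"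
      using out by (intro sum.cong) (auto simp: D_def)
    moreover have "(\<Sum>n=1..N. \<bar>D n\<bar>) = - (\<Sum>n=1..N. D n)"
      unfolding sum_negf[symmetric] using ins by (intro sum.cong) (auto simp: D_def)
    ultimately show ?thesis by (simp add: split)
  qed
  also have "\<dots> = - 2 * (\<Sum>n=1..N. D n)" using tot split[of D] by simp
  also have "(\<Sum>n=1..N. D n) = d (N + 1) - d 1"
    unfolding D using N by (subst sum_int_telescope) auto
  finally show ?thesis by (simp add: D_def d_def)
qed

text \<open>Summation by parts twice: multiplying by \<open>ee (- x) + ee x - 2\<close>, of modulus
  \<open>4 * sin^2 (pi x)\<close>, moves a second difference onto \<open>f\<close>. What remains is
  estimated trivially.\<close>

lemma sum_ee_second_difference:
  fixes f :: "int \<Rightarrow> real"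
  assumes zero: "\<And>n. \<bar>n\<bar> \<ge> B \<Longrightarrow> f n = 0" and B: "0 \<le> B"
  shows "norm (\<Sum>n=-B..B. of_real (f n) * ee (of_int n * x)) * (4 * (sin (pi * x))\<^sup>2)
     \<le> (\<Sum>n=-B..B. \<bar>f (n + 1) - 2 * f n + f (n - 1)\<bar>)"
proof -
  define S where "S = (\<Sum>n=-B..B. of_real (f n) * ee (of_int n * x))"
  have sh: "(\<Sum>n=-B..B. of_real (f (n + s)) * ee (of_int (n + s) * x)) = S" if "s = 1 \<or> s = -1" for s
  proof -
    have "(\<Sum>n=-B..B. of_real (f (n + s)) * ee (of_int (n + s) * x))
       = (\<Sum>n=-B+s..B+s. of_real (f n) * ee (of_int n * x))"
      by (rule sum.reindex_bij_witness[of _ "\<lambda>n. n - s" "\<lambda>n. n + s"]) auto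
    also have "\<dots> = S"
      unfolding S_def using that zero
      by (intro sum.mono_neutral_cong) auto
    finally show ?thesis .
  qed
  have "S * (ee (- x) + ee x - 2) = (\<Sum>n=-B..B. of_real (f (n + 1) - 2 * f n + f (n - 1)) * ee (of_int n * x))"
  proof -
    have 1: "S * ee (- x) = (\<Sum>n=-B..B. of_real (f (n + 1)) * ee (of_int n * x))"
      unfolding sh[of 1, symmetric, simplified] sum_distrib_right
      by (intro sum.cong) (auto simp: mult.assoc ee_add[symmetric] algebra_simps)
    have 2: "S * ee x = (\<Sum>n=-B..B. of_real (f (n - 1)) * ee (of_int n * x))"
      unfolding sh[of "-1", symmetric, simplified] sum_distrib_right
      by (intro sum.cong) (auto simp: mult.assoc ee_add[symmetric] algebra_simps)
    have "S * (ee (- x) + ee x - 2) = S * ee (- x) + S * ee x - 2 * S" by (simp add: algebra_simps)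
    also have "2 * S = (\<Sum>n=-B..B. of_real (2 * f n) * ee (of_int n * x))"
      by (simp add: S_def sum_distrib_left mult.assoc)
    finally show ?thesis unfolding 1 2
      by (simp add: sum_subtractf[symmetric] sum.distrib[symmetric] algebra_simps)
  qed
  moreover have "norm (ee (- x) + ee x - 2) = 4 * (sin (pi * x))\<^sup>2"
  proof -
    have 1: "ee (- x) * ee x = 1" using ee_add[of "-x" x] by simp
    have "ee (- x) * (1 - ee x)\<^sup>2 = ee (- x) - 2 * (ee (- x) * ee x) + ee (- x) * ee x * ee x"
      by (simp add: power2_eq_square algebra_simps)
    then have "ee (- x) + ee x - 2 = ee (- x) * (1 - ee x)\<^sup>2"
      by (simp add: 1)
    then show ?thesis by (simp add: norm_mult norm_power norm_one_minus_ee)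
  qed
  ultimately have "norm S * (4 * (sin (pi * x))\<^sup>2)
     = norm (\<Sum>n=-B..B. of_real (f (n + 1) - 2 * f n + f (n - 1)) * ee (of_int n * x))"
    by (metis norm_mult)
  also have "\<dots> \<le> (\<Sum>n=-B..B. norm (of_real (f (n + 1) - 2 * f n + f (n - 1)) * ee (of_int n * x)))"
    by (rule norm_sum)
  also have "\<dots> = (\<Sum>n=-B..B. \<bar>f (n + 1) - 2 * f n + f (n - 1)\<bar>)"
    by (simp only: norm_mult norm_of_real norm_ee mult_1_right)
  finally show ?thesis by (simp add: S_def)
qed

text \<open>\<open>max 0 (max (1 - n) (n - N))\<close> is the distance from \<open>n\<close> to
  \<open>{1..N}\<close>: the weight is 1 on that interval and falls linearly to 0 within
  \<open>H\<close> steps on both sides. The finite slopes make the exponential sums decay like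
  \<open>1 / sin^2\<close>.\<close>

definition trapezoid :: "int \<Rightarrow> nat \<Rightarrow> int \<Rightarrow> real" where
  "trapezoid N H n = max 0 (1 - of_int (max 0 (max (1 - n) (n - N))) / real H)"

lemma trapezoid_eq_1: "n \<in> {1..N} \<Longrightarrow> trapezoid N H n = 1"
proof -
  assume "n \<in> {1..N}"
  then have "max 0 (max (1 - n) (n - N)) = 0" by auto
  then show ?thesis by (simp add: trapezoid_def)
qed

lemma trapezoid_range: "0 \<le> trapezoid N H n" "trapezoid N H n \<le> 1"
  by (auto simp: trapezoid_def)

lemma trapezoid_eq_0:
  assumes "H > 0" "N \<ge> 0" "\<bar>n\<bar> \<ge> N + int H"
  shows "trapezoid N H n = 0"
proof -
  have "max 0 (max (1 - n) (n - N)) \<ge> int H" using assms by (auto simp: max_def)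
  then have "real_of_int (max 0 (max (1 - n) (n - N))) \<ge> real H" by linarith
  then show ?thesis using assms by (simp add: trapezoid_def)
qed

lemma trapezoid_left:
  assumes "N \<ge> 1" "n \<le> 1"
  shows "trapezoid N H n = max 0 (1 - of_int (1 - n) / real H)"
proof -
  have "max 0 (max (1 - n) (n - N)) = 1 - n" using assms by auto
  then show ?thesis by (simp only: trapezoid_def)
qed

lemma trapezoid_right:
  assumes "N \<ge> 1" "n \<ge> N"
  shows "trapezoid N H n = max 0 (1 - of_int (n - N) / real H)"
proof -
  have "max 0 (max (1 - n) (n - N)) = n - N" using assms by auto
  then show ?thesis by (simp only: trapezoid_def)
qed

text \<open>A product of two nonnegative decreasing convex functions is convex. Multiplying the two
  midpoint inequalities leaves mixed products, which Chebyshev's inequality for equally ordered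
  pairs bounds by the unmixed ones.\<close>

lemma ramp_product_convex:
  fixes a b j :: real
  assumes "a \<ge> 0" "b \<ge> 0"
  shows "2 * (max 0 (1 - j * a) * max 0 (1 - j * b)) \<le>
    max 0 (1 - (j - 1) * a) * max 0 (1 - (j - 1) * b) + max 0 (1 - (j + 1) * a) * max 0 (1 - (j + 1) * b)"
proof -
  define u where "u = (\<lambda>j. max 0 (1 - j * a))"
  define v where "v = (\<lambda>j. max 0 (1 - j * b))"
  have u: "2 * u j \<le> u (j - 1) + u (j + 1)" "u (j + 1) \<le> u (j - 1)" "0 \<le> u j"
    using assms by (auto simp: u_def max_def algebra_simps)
  have v: "2 * v j \<le> v (j - 1) + v (j + 1)" "v (j + 1) \<le> v (j - 1)" "0 \<le> v j"
    using assms by (auto simp: v_def max_def algebra_simps)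
  have "(2 * u j) * (2 * v j) \<le> (u (j - 1) + u (j + 1)) * (v (j - 1) + v (j + 1))"
    using u v by (intro mult_mono) auto
  moreover have "0 \<le> (u (j - 1) - u (j + 1)) * (v (j - 1) - v (j + 1))"
    using u v by (intro mult_nonneg_nonneg) auto
  ultimately have "2 * (u j * v j) \<le> u (j - 1) * v (j - 1) + u (j + 1) * v (j + 1)"
    by (simp add: algebra_simps)
  then show ?thesis by (simp add: u_def v_def)
qed

text \<open>The product of the two weights is convex on each side of \<open>{1..N}\<close> and has
  its maximum 1 on it, so \<open>sum_second_difference_le\<close> and
  \<open>sum_ee_second_difference\<close> apply. Each end contributes a slope
  \<open>1 - (1 - a) * (1 - b) <= a + b\<close>.\<close>

lemma trapezoid_kernel_le:
  fixes N B :: int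
  assumes N: "N \<ge> 1" and H: "H > 0" "H' > 0" and B: "N + int H \<le> B" "N + int H' \<le> B"
    and x: "sin (pi * x) \<noteq> 0"
  shows "norm (\<Sum>n=-B..B. of_real (trapezoid N H n * trapezoid N H' n) * ee (of_int n * x))
     \<le> (1 / real H + 1 / real H') * (1 / (sin (pi * x))\<^sup>2)"
proof -
  define f where "f = (\<lambda>n. trapezoid N H n * trapezoid N H' n)"
  define a b where "a = 1 / real H" and "b = 1 / real H'"
  have ab: "0 \<le> a" "a \<le> 1" "0 \<le> b" "b \<le> 1" using H by (auto simp: a_def b_def)
  have f1: "f n = 1" if "n \<in> {1..N}" for n using that by (simp add: f_def trapezoid_eq_1)
  have fle: "f n \<le> 1" for n unfolding f_def using trapezoid_range by (intro mult_le_one) auto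
  have left: "f n = max 0 (1 - of_int (1 - n) * a) * max 0 (1 - of_int (1 - n) * b)" if "n \<le> 1" for n
    using that N by (simp add: f_def trapezoid_left a_def b_def)
  have right: "f n = max 0 (1 - of_int (n - N) * a) * max 0 (1 - of_int (n - N) * b)" if "n \<ge> N" for n
    using that N by (simp add: f_def trapezoid_right a_def b_def)
  have zero: "f n = 0" if "\<bar>n\<bar> \<ge> B" for n
    using that B N H by (simp add: f_def trapezoid_eq_0)
  have "(\<Sum>n=-B..B. \<bar>f (n + 1) - 2 * f n + f (n - 1)\<bar>) = 2 * ((f N - f (N + 1)) + (f 1 - f 0))"
  proof (rule sum_second_difference_le)
    fix n assume "n \<notin> {1..N}"
    then consider "n \<le> 0" | "n \<ge> N + 1" by fastforce
    then show "0 \<le> f (n + 1) - 2 * f n + f (n - 1)"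
    proof cases
      case 1
      then show ?thesis using ramp_product_convex[of a b "of_int (1 - n)"] ab by (simp add: left algebra_simps)
    next
      case 2
      then show ?thesis using ramp_product_convex[of a b "of_int (n - N)"] ab by (simp add: right algebra_simps)
    qed
  next
    fix n assume "n \<in> {1..N}"
    then show "f (n + 1) - 2 * f n + f (n - 1) \<le> 0" using f1[of n] fle[of "n + 1"] fle[of "n - 1"] by simp
  qed (use zero N B H in auto)
  also have "\<dots> \<le> 4 * (a + b)"
  proof -
    have "f 0 = (1 - a) * (1 - b)" "f (N + 1) = (1 - a) * (1 - b)"
      using left[of 0] right[of "N + 1"] ab by auto
    moreover have "(1 - a) * (1 - b) \<ge> 1 - (a + b)"
      using ab mult_nonneg_nonneg[of a b] by (simp add: algebra_simps)
    ultimately have "f 0 \<ge> 1 - (a + b)" "f (N + 1) \<ge> 1 - (a + b)" by simp_all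
    moreover have "f 1 = 1" "f N = 1" using f1 N by auto
    ultimately have "f N - f (N + 1) \<le> a + b" "f 1 - f 0 \<le> a + b" by simp_all
    then show ?thesis by argo
  qed
  finally have "(\<Sum>n=-B..B. \<bar>f (n + 1) - 2 * f n + f (n - 1)\<bar>) \<le> 4 * (a + b)" .
  moreover have "norm (\<Sum>n=-B..B. of_real (f n) * ee (of_int n * x)) * (4 * (sin (pi * x))\<^sup>2)
     \<le> (\<Sum>n=-B..B. \<bar>f (n + 1) - 2 * f n + f (n - 1)\<bar>)"
    by (rule sum_ee_second_difference) (use zero N B in auto)
  ultimately have "norm (\<Sum>n=-B..B. of_real (f n) * ee (of_int n * x)) * (4 * (sin (pi * x))\<^sup>2) \<le> 4 * (a + b)"
    by linarith
  moreover have "0 < (sin (pi * x))\<^sup>2" using x by simp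
  ultimately show ?thesis unfolding f_def a_def b_def
    by (simp add: pos_le_divide_eq mult_ac)
qed

text \<open>The diagonal counterpart of \<open>trapezoid_kernel_le\<close>: \<open>N\<close> comes
  from the plateau, and at most \<open>H / 3\<close> from each slope.\<close>

lemma trapezoid_square_sum_le:
  fixes N B :: int
  assumes N: "N \<ge> 1" and H: "H > 0" and B: "N + int H \<le> B"
  shows "(\<Sum>n=-B..B. (trapezoid N H n)\<^sup>2) \<le> of_int N + 2 * real H / 3"
proof -
  define t where "t = (\<Sum>j<H. (real j / real H)\<^sup>2)"
  have t: "t \<le> real H / 3"
  proof -
    have "(\<Sum>j<m. (real j)\<^sup>2) \<le> real m ^ 3 / 3" for m
      by (induction m) (auto simp: power2_eq_square power3_eq_cube algebra_simps)
    from this[of H] have "(\<Sum>j<H. (real j)\<^sup>2) / (real H)\<^sup>2 \<le> (real H ^ 3 / 3) / (real H)\<^sup>2"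
      by (rule divide_right_mono) auto
    then show ?thesis using H by (simp add: t_def power_divide sum_divide_distrib power2_eq_square power3_eq_cube)
  qed
  have "(\<Sum>n=-B..B. (trapezoid N H n)\<^sup>2)
     = (\<Sum>n\<in>{1 - int H<..0} \<union> {1..N} \<union> {N + 1..<N + int H}. (trapezoid N H n)\<^sup>2)"
  proof (rule sum.mono_neutral_right)
    show "\<forall>n\<in>{- B..B} - ({1 - int H<..0} \<union> {1..N} \<union> {N + 1..<N + int H}). (trapezoid N H n)\<^sup>2 = 0"
    proof
      fix n assume "n \<in> {- B..B} - ({1 - int H<..0} \<union> {1..N} \<union> {N + 1..<N + int H})"
      then have "n \<le> 1 - int H \<or> n \<ge> N + int H" by auto
      then have "max 0 (max (1 - n) (n - N)) \<ge> int H" by auto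
      then have "real_of_int (max 0 (max (1 - n) (n - N))) \<ge> real H" by linarith
      then show "(trapezoid N H n)\<^sup>2 = 0" using H by (simp add: trapezoid_def)
    qed
  qed (use B N H in auto)
  also have "\<dots> = (\<Sum>n\<in>{1 - int H<..0}. (trapezoid N H n)\<^sup>2) + (\<Sum>n=1..N. (trapezoid N H n)\<^sup>2)
      + (\<Sum>n\<in>{N + 1..<N + int H}. (trapezoid N H n)\<^sup>2)"
    using N by (subst sum.union_disjoint sum.union_disjoint; auto)+
  also have "(\<Sum>n=1..N. (trapezoid N H n)\<^sup>2) = of_int N"
    using N by (simp add: trapezoid_eq_1)
  also have "(\<Sum>n\<in>{1 - int H<..0}. (trapezoid N H n)\<^sup>2) = (\<Sum>j\<in>{1..<H}. (real j / real H)\<^sup>2)"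
  proof (rule sum.reindex_bij_witness[of _ "\<lambda>j. 1 - int H + int j" "\<lambda>n. nat (n - 1 + int H)"])
    fix n assume n: "n \<in> {1 - int H<..0}"
    have "trapezoid N H n = max 0 (1 - of_int (1 - n) / real H)"
      using N n by (intro trapezoid_left) auto
    also have "\<dots> = real (nat (n - 1 + int H)) / real H"
      using n H by (simp add: field_simps max_def)
    finally show "(real (nat (n - 1 + int H)) / real H)\<^sup>2 = (trapezoid N H n)\<^sup>2" by simp
  qed auto
  also have "(\<Sum>n\<in>{N + 1..<N + int H}. (trapezoid N H n)\<^sup>2) = (\<Sum>j\<in>{1..<H}. (real j / real H)\<^sup>2)"
  proof (rule sum.reindex_bij_witness[of _ "\<lambda>j. N + int H - int j" "\<lambda>n. nat (N + int H - n)"])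
    fix n assume n: "n \<in> {N + 1..<N + int H}"
    have "trapezoid N H n = max 0 (1 - of_int (n - N) / real H)"
      using N n by (intro trapezoid_right) auto
    also have "\<dots> = real (nat (N + int H - n)) / real H"
      using n H by (simp add: field_simps max_def)
    finally show "(real (nat (N + int H - n)) / real H)\<^sup>2 = (trapezoid N H n)\<^sup>2" by simp
  qed auto
  also have "(\<Sum>j\<in>{1..<H}. (real j / real H)\<^sup>2) = t"
    unfolding t_def by (rule sum.mono_neutral_left) auto
  finally show ?thesis using t by simp
qed

section \<open>Schur's test over the Farey fractions\<close>

lemma weighted_Schur_bound:
  fixes K :: "'r \<Rightarrow> 'r \<Rightarrow> real" and b c :: "'r \<Rightarrow> real"
  assumes "\<And>r s. K r s = K s r" "\<And>r s. 0 \<le> K r s" "\<And>r. r \<in> R \<Longrightarrow> c r > 0"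
  shows "(\<Sum>r\<in>R. \<Sum>s\<in>R. b r * b s * K r s) \<le> (\<Sum>r\<in>R. (b r)\<^sup>2 * (\<Sum>s\<in>R. K r s * (c r / c s)))"
proof -
  \<comment> \<open>The weights \<open>c\<close> split the product \<open>b r * b s\<close> by the
    inequality of arithmetic and geometric means. Symmetry of \<open>K\<close> makes both halves
    equal, so only the row sums weighted by \<open>c r / c s\<close> are left.\<close>
  have amgm: "2 * (b r * b s) \<le> (b r)\<^sup>2 * (c r / c s) + (b s)\<^sup>2 * (c s / c r)" if "r \<in> R" "s \<in> R" for r s
  proof -
    have c: "c r > 0" "c s > 0" using assms(3) that by auto
    have "0 \<le> (b r * c r - b s * c s)\<^sup>2 / (c r * c s)" using c by simp
    also have "\<dots> = (b r)\<^sup>2 * (c r / c s) + (b s)\<^sup>2 * (c s / c r) - 2 * (b r * b s)"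
      using c by (simp add: power2_eq_square field_simps)
    finally show ?thesis by simp
  qed
  define T where "T = (\<Sum>r\<in>R. \<Sum>s\<in>R. (b r)\<^sup>2 * (c r / c s) * K r s)"
  have "2 * (\<Sum>r\<in>R. \<Sum>s\<in>R. b r * b s * K r s) = (\<Sum>r\<in>R. \<Sum>s\<in>R. 2 * (b r * b s) * K r s)"
    by (simp add: sum_distrib_left mult_ac)
  also have "\<dots> \<le> (\<Sum>r\<in>R. \<Sum>s\<in>R. ((b r)\<^sup>2 * (c r / c s) + (b s)\<^sup>2 * (c s / c r)) * K r s)"
    using amgm assms(2) by (intro sum_mono mult_right_mono) auto
  also have "\<dots> = T + (\<Sum>r\<in>R. \<Sum>s\<in>R. (b s)\<^sup>2 * (c s / c r) * K r s)"
    by (simp add: T_def distrib_right sum.distrib)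
  also have "(\<Sum>r\<in>R. \<Sum>s\<in>R. (b s)\<^sup>2 * (c s / c r) * K r s) = T"
    unfolding T_def by (subst sum.swap) (simp add: assms(1))
  finally have "(\<Sum>r\<in>R. \<Sum>s\<in>R. b r * b s * K r s) \<le> T" by simp
  then show ?thesis unfolding T_def by (simp add: sum_distrib_left mult_ac)
qed

text \<open>Pairs and not reals, since the denominator determines the weight of a fraction. Each
  reduced fraction modulo 1 occurs once; 0 occurs only as \<open>(0, 1)\<close>.\<close>

definition farey :: "nat \<Rightarrow> (nat \<times> nat) set" where
  "farey M = {(a, q). 1 \<le> q \<and> q \<le> M \<and> a < q \<and> coprime a q}"

definition frac_of :: "nat \<times> nat \<Rightarrow> real" where
  "frac_of r = real (fst r) / real (snd r)"

lemma farey_subset: "farey M \<subseteq> {..<M} \<times> {1..M}"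
  by (auto simp: farey_def)

lemma finite_farey [simp]: "finite (farey M)"
  by (rule finite_subset[OF farey_subset]) auto

lemma csc2_nonneg: "0 \<le> csc2 q t"
  by (simp add: csc2_def)

lemma sum_periodic:
  fixes w :: "nat \<Rightarrow> real"
  assumes "\<And>k. w (k + q) = w k"
  shows "(\<Sum>k<B * q. w k) = real B * (\<Sum>k<q. w k)"
proof (induction B)
  case (Suc B)
  have p: "w (k + m * q) = w k" for k m
    by (induction m) (use assms in \<open>auto simp: add.assoc[symmetric] add.commute[of q]\<close>)
  have "(\<Sum>k<Suc B * q. w k) = (\<Sum>k<B * q. w k) + (\<Sum>k=B*q..<B * q + q. w k)"
    by (simp add: add.commute[of q] lessThan_atLeast0 sum.atLeastLessThan_concat)
  also have "(\<Sum>k=B*q..<B * q + q. w k) = (\<Sum>k<q. w k)"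
    using sum.shift_bounds_nat_ivl[of w 0 "B * q" q] p by (simp add: lessThan_atLeast0 add.commute)
  finally show ?case using Suc by (simp add: algebra_simps)
qed simp

lemma frac_of_dist:
  assumes "r \<in> farey M" "s \<in> farey M" "r \<noteq> s"
  shows "sin (pi * (frac_of r - frac_of s)) \<noteq> 0"
proof
  obtain a q a' q' where rs: "r = (a, q)" "s = (a', q')" by fastforce
  have q: "a < q" "coprime a q" "a' < q'" "coprime a' q'" using assms by (auto simp: farey_def rs)
  assume "sin (pi * (frac_of r - frac_of s)) = 0"
  then obtain t :: int where t: "frac_of r - frac_of s = of_int t"
    by (auto simp: sin_pi_eq_0_iff elim: Ints_cases)
  have "0 \<le> frac_of r" "frac_of r < 1" "0 \<le> frac_of s" "frac_of s < 1"
    using q by (auto simp: frac_of_def rs)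
  then have "\<bar>real_of_int t\<bar> < 1" using t by linarith
  then have "t = 0" by linarith
  then have "real a / real q = real a' / real q'" using t by (simp add: frac_of_def rs)
  then have "real (a * q') = real (a' * q)" using q by (simp add: field_simps)
  then have "a * q' = a' * q" by (simp only: of_nat_eq_iff)
  then have "a = a' \<and> q = q'" using coprime_crossproduct_nat[of a q a' q'] q by (simp add: mult.commute)
  then show False using assms(3) rs by simp
qed

text \<open>Summing over all \<open>a'\<close>, and not only the reduced ones, makes the sum
  computable. If \<open>q\<close> does not divide \<open>q'\<close>,
  \<open>sum_inverse_sin_squared\<close> gives equality. Otherwise \<open>a / q\<close> is one of
  the \<open>a' / q'\<close>: its pole counts 0, the \<open>csc2\<close> term is 0 as well, and the
  other terms give \<open>(q'^2 - 1) / 3\<close>.\<close>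

lemma sum_csc2_fractions_le:
  assumes q: "q > 0" "coprime a q" and q': "q' > 0"
  shows "(\<Sum>a'<q'. 1 / (sin (pi * (real a / real q - real a' / real q')))\<^sup>2)
     \<le> (real q')\<^sup>2 * (csc2 q (int (a * q')) + (if q dvd q' then 1 / 3 else 0))"
proof (cases "q dvd q'")
  case False
  have "sin (pi * (real q' * (real a / real q))) \<noteq> 0"
  proof
    assume "sin (pi * (real q' * (real a / real q))) = 0"
    then obtain t :: int where "real q' * (real a / real q) = of_int t"
      by (auto simp only: sin_pi_eq_0_iff elim: Ints_cases)
    then have "real_of_int (int (q' * a)) = real_of_int (t * int q)" using q by (simp add: field_simps)
    then have "int (q' * a) = t * int q" by (simp only: of_int_eq_iff)
    then have "int q dvd int (q' * a)" by simp
    then have "q dvd q' * a" by (simp only: of_nat_dvd_iff)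
    then have "q dvd q'" using q by (simp add: coprime_dvd_mult_left_iff coprime_commute)
    then show False using False by simp
  qed
  from sum_inverse_sin_squared[OF q' this] show ?thesis
    using False by (simp add: csc2_def mult_ac)
next
  case True
  then obtain t where t: "q' = q * t" by auto
  have eq: "1 / (sin (pi * (real a / real q - real a' / real q')))\<^sup>2 = csc2 q' (int (a * t) - int a')" for a'
  proof -
    have "real a / real q = real (a * t) / real q'" using t q q' by simp
    then have "real a / real q - real a' / real q' = of_int (int (a * t) - int a') / real q'"
      by (simp add: diff_divide_distrib)
    then show ?thesis by (simp only: csc2_def)
  qed
  have "inj_on (\<lambda>k. (int (a * t) - int k) mod int q') {..<q'}"
  proof (rule inj_onI)
    fix x y assume xy: "x \<in> {..<q'}" "y \<in> {..<q'}"
      "(int (a * t) - int x) mod int q' = (int (a * t) - int y) mod int q'"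
    then have "int x mod int q' = int y mod int q'"
      unfolding mod_eq_dvd_iff by (simp add: dvd_diff_commute)
    then show "x = y" using xy by simp
  qed
  then have "(\<Sum>a'<q'. csc2 q' (int (a * t) - int a')) = ((real q')\<^sup>2 - 1) / 3"
    by (rule sum_csc2[OF q'])
  also have "\<dots> \<le> (real q')\<^sup>2 * (1 / 3)" by simp
  also have "\<dots> \<le> (real q')\<^sup>2 * (csc2 q (int (a * q')) + 1 / 3)"
    using csc2_nonneg[of q "int (a * q')"] by (intro mult_left_mono) auto
  finally show ?thesis using True by (simp add: eq)
qed

lemma farey_row_sum_le:
  assumes r: "(a, q) \<in> farey M"
  shows "(\<Sum>(a', q')\<in>farey M. (1 / real (q * M) + 1 / real (q' * M))
      * (1 / (sin (pi * (real a / real q - real a' / real q')))\<^sup>2) * (real q / real q')) \<le> 4 / 3 * real q * real M"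
proof -
  have q: "q > 0" "q \<le> M" "coprime a q" "M > 0" using r by (auto simp: farey_def)
  \<comment> \<open>The bound of \<open>sum_csc2_fractions_le\<close> without its factor
    \<open>q'^2\<close>. As a function of \<open>q'\<close> it has period \<open>q\<close>, so the
    sum over denominators becomes a sum over residues.\<close>
  define w where "w = (\<lambda>k. csc2 q (int (a * k)) + (if q dvd k then 1 / 3 else 0 :: real))"
  have w0: "0 \<le> w k" for k by (simp add: w_def csc2_nonneg)
  have "(\<Sum>(a', q')\<in>farey M. (1 / real (q * M) + 1 / real (q' * M))
      * (1 / (sin (pi * (real a / real q - real a' / real q')))\<^sup>2) * (real q / real q'))
     \<le> (\<Sum>(a', q')\<in>(\<lambda>(x, y). (y, x)) ` (SIGMA q':{1..M}. {..<q'}). (1 / real (q * M) + 1 / real (q' * M))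
      * (1 / (sin (pi * (real a / real q - real a' / real q')))\<^sup>2) * (real q / real q'))"
    by (rule sum_mono2) (auto simp: farey_def image_iff)
  also have "\<dots> = (\<Sum>q'=1..M. \<Sum>a'<q'. (1 / real (q * M) + 1 / real (q' * M))
      * (1 / (sin (pi * (real a / real q - real a' / real q')))\<^sup>2) * (real q / real q'))"
    by (subst sum.reindex) (auto simp: inj_on_def sum.Sigma case_prod_unfold)
  also have "\<dots> = (\<Sum>q'=1..M. (1 / real (q * M) + 1 / real (q' * M)) * (real q / real q')
      * (\<Sum>a'<q'. 1 / (sin (pi * (real a / real q - real a' / real q')))\<^sup>2))"
    by (simp add: sum_distrib_left mult_ac)
  also have "\<dots> \<le> (\<Sum>q'=1..M. (1 / real (q * M) + 1 / real (q' * M)) * (real q / real q') * ((real q')\<^sup>2 * w q'))"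
    unfolding w_def using q by (intro sum_mono mult_left_mono sum_csc2_fractions_le) auto
  also have "\<dots> = (\<Sum>q'=1..M. ((real q + real q') / real M) * w q')"
    using q by (intro sum.cong) (auto simp: field_simps power2_eq_square)
  \<comment> \<open>Both \<open>q\<close> and \<open>q'\<close> are at most
    \<open>M\<close>.\<close>
  also have "\<dots> \<le> (\<Sum>q'=1..M. 2 * w q')"
    using q w0 by (intro sum_mono mult_right_mono) (auto simp: field_simps)
  also have "\<dots> = 2 * (\<Sum>k=1..M. w k)" by (simp add: sum_distrib_left)
  also have "(\<Sum>k=1..M. w k) \<le> (\<Sum>k<(M div q + 1) * q. w k)"
  proof (rule sum_mono2)
    have "M < (M div q + 1) * q" using q
      by (metis Suc_eq_plus1 dividend_less_div_times mult.commute mult_Suc_right add.commute)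
    then show "{1..M} \<subseteq> {..<(M div q + 1) * q}" by auto
  qed (use w0 in auto)
  also have "\<dots> = real (M div q + 1) * (\<Sum>k<q. w k)"
  proof (rule sum_periodic)
    fix k
    have "csc2 q (int (a * (k + q)) mod int q) = csc2 q (int (a * k) mod int q)"
      by (simp add: distrib_left)
    then have "csc2 q (int (a * (k + q))) = csc2 q (int (a * k))"
      by (simp only: csc2_periodic[OF q(1)])
    then show "w (k + q) = w k" by (simp add: w_def)
  qed
  also have "(\<Sum>k<q. w k) = (real q)\<^sup>2 / 3"
  proof -
    have "inj_on (\<lambda>k. int (a * k) mod int q) {..<q}"
    proof (rule inj_onI)
      fix x y assume xy: "x \<in> {..<q}" "y \<in> {..<q}" "int (a * x) mod int q = int (a * y) mod int q"
      then have "int q dvd int a * (int x - int y)"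
        by (simp add: mod_eq_dvd_iff right_diff_distrib)
      then have "int q dvd int x - int y"
        using q by (simp add: coprime_dvd_mult_right_iff coprime_commute)
      then have "int x mod int q = int y mod int q" by (simp add: mod_eq_dvd_iff)
      then show "x = y" using xy by simp
    qed
    then have "(\<Sum>k<q. csc2 q (int (a * k))) = ((real q)\<^sup>2 - 1) / 3" by (rule sum_csc2[OF q(1)])
    moreover have "(\<Sum>k<q. (if q dvd k then 1 / 3 else 0 :: real)) = (\<Sum>k<q. if k = 0 then 1 / 3 else 0)"
      by (intro sum.cong) (auto dest: dvd_imp_le)
    then have "(\<Sum>k<q. (if q dvd k then 1 / 3 else 0 :: real)) = 1 / 3"
      using q by simp
    ultimately show ?thesis by (simp add: w_def sum.distrib field_simps)
  qed
  \<comment> \<open>The periods that cover \<open>1..M\<close> have total length at most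
    \<open>M + q\<close>, hence at most \<open>2 * M\<close>.\<close>
  also have "real (M div q + 1) * ((real q)\<^sup>2 / 3) \<le> 2 * real M * real q / 3"
  proof -
    have "(M div q + 1) * q \<le> 2 * M" using q by (simp add: algebra_simps) (metis add_mono div_times_less_eq_dividend mult.commute mult_2)
    then have "real (M div q + 1) * real q \<le> 2 * real M" by (metis of_nat_le_iff of_nat_mult of_nat_numeral)
    then have "real (M div q + 1) * real q * real q \<le> 2 * real M * real q" by (intro mult_right_mono) auto
    then show ?thesis by (simp add: power2_eq_square mult.assoc)
  qed
  also have "2 * (2 * real M * real q / 3) = 4 / 3 * real q * real M" by simp
  finally show ?thesis by simp
qed

text \<open>The sum over \<open>n\<close> is majorised by inserting for each fraction with denominator \<open>q\<close> its own
  trapezoidal weight, with slopes of length \<open>q * M\<close>; the weight of Schur's test is the denominator.\<close>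

lemma weighted_large_sieve:
  fixes b :: "nat \<times> nat \<Rightarrow> complex"
  assumes N: "N \<ge> 1" and M: "M \<ge> 1"
  shows "(\<Sum>n=1..N. (norm (\<Sum>r\<in>farey M. b r * ee (real n * frac_of r)))\<^sup>2)
     \<le> (\<Sum>r\<in>farey M. (norm (b r))\<^sup>2 * (real N + 2 * real (snd r) * real M))"
proof -
  define B where "B = int N + int M * int M"
  define g where "g = (\<lambda>r n. trapezoid (int N) (snd (r :: nat \<times> nat) * M) n)"
  define R where "R = farey M"
  have fin: "finite R" by (simp add: R_def)
  have snd: "1 \<le> snd r" "snd r \<le> M" if "r \<in> R" for r using that by (auto simp: R_def farey_def)
  have H: "snd r * M > 0" "int N + int (snd r * M) \<le> B" if "r \<in> R" for r
    using snd[OF that] M by (auto simp: B_def simp flip: of_nat_mult)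
  define T where "T = (\<lambda>n::int. \<Sum>r\<in>R. b r * of_real (g r n) * ee (of_int n * frac_of r))"
  define Kc where "Kc = (\<lambda>r s. \<Sum>n=-B..B. of_real (g r n * g s n) * ee (of_int n * (frac_of r - frac_of s)))"
  define K where "K = (\<lambda>r s. norm (Kc r s))"
  \<comment> \<open>All weights are 1 on \<open>{1..N}\<close>, so each fraction may receive its own
    without changing the sum there; the range of \<open>n\<close> is enlarged afterwards, by
    positivity.\<close>
  have "(\<Sum>n=1..N. (norm (\<Sum>r\<in>R. b r * ee (real n * frac_of r)))\<^sup>2) = (\<Sum>n=1..N. (norm (T (int n)))\<^sup>2)"
    unfolding T_def g_def by (intro sum.cong) (auto simp: trapezoid_eq_1)
  also have "\<dots> = (\<Sum>n\<in>int ` {1..N}. (norm (T n))\<^sup>2)"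
    by (subst sum.reindex) auto
  also have "\<dots> \<le> (\<Sum>n=-B..B. (norm (T n))\<^sup>2)"
  proof (rule sum_mono2)
    have "0 \<le> int M * int M" by simp
    then have "int N \<le> B" by (simp add: B_def)
    then show "int ` {1..N} \<subseteq> {-B..B}" by auto
  qed auto
  also have "\<dots> \<le> (\<Sum>r\<in>R. \<Sum>s\<in>R. norm (b r) * norm (b s) * K r s)"
  proof -
    have "complex_of_real (\<Sum>n=-B..B. (norm (T n))\<^sup>2) = (\<Sum>n=-B..B. T n * cnj (T n))"
      by (simp add: complex_norm_square[symmetric])
    also have "\<dots> = (\<Sum>n=-B..B. \<Sum>r\<in>R. \<Sum>s\<in>R. b r * cnj (b s) * (of_real (g r n * g s n) * ee (of_int n * (frac_of r - frac_of s))))"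
      unfolding T_def cnj_sum sum_product
      by (intro sum.cong) (simp_all add: ee_diff right_diff_distrib mult_ac)
    also have "\<dots> = (\<Sum>r\<in>R. \<Sum>s\<in>R. b r * cnj (b s) * Kc r s)"
      unfolding Kc_def sum_distrib_left
      by (subst sum.swap, intro sum.cong refl, subst sum.swap) auto
    finally have "norm (complex_of_real (\<Sum>n=-B..B. (norm (T n))\<^sup>2)) = norm (\<Sum>r\<in>R. \<Sum>s\<in>R. b r * cnj (b s) * Kc r s)"
      by simp
    also have "\<dots> \<le> (\<Sum>r\<in>R. \<Sum>s\<in>R. norm (b r) * norm (b s) * K r s)"
      unfolding K_def by (intro order_trans[OF norm_sum] sum_mono) (auto simp: norm_mult intro!: order_trans[OF norm_sum] sum_mono)
    finally show ?thesis by (simp only: norm_of_real)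
  qed
  also have "\<dots> \<le> (\<Sum>r\<in>R. (norm (b r))\<^sup>2 * (\<Sum>s\<in>R. K r s * (real (snd r) / real (snd s))))"
  proof (rule weighted_Schur_bound)
    fix r s
    have "Kc s r = cnj (Kc r s)"
      unfolding Kc_def cnj_sum by (intro sum.cong) (simp_all add: ee_minus[symmetric] algebra_simps)
    then show "K r s = K s r" by (simp add: K_def)
  qed (use snd in \<open>auto simp: K_def Suc_le_eq\<close>)
  also have "\<dots> \<le> (\<Sum>r\<in>R. (norm (b r))\<^sup>2 * (real N + 2 * real (snd r) * real M))"
  proof (intro sum_mono mult_left_mono)
    fix r assume r: "r \<in> R"
    obtain a q where aq: "r = (a, q)" by fastforce
    have q: "q \<ge> 1" using snd[OF r] aq by simp
    \<comment> \<open>The diagonal entry contributes \<open>N + 2/3 * q * M\<close> and the rest of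
      the row \<open>4/3 * q * M\<close>. This is the origin of the constant 2.\<close>
    have "(\<Sum>s\<in>R. K r s * (real (snd r) / real (snd s)))
       = K r r + (\<Sum>s\<in>R - {r}. K r s * (real (snd r) / real (snd s)))"
      using fin r q aq by (subst sum.remove[of _ r]) auto
    also have "K r r \<le> real N + 2 * real (q * M) / 3"
    proof -
      have "Kc r r = of_real (\<Sum>n=-B..B. (g r n)\<^sup>2)"
        by (simp add: Kc_def power2_eq_square)
      then have "K r r = (\<Sum>n=-B..B. (g r n)\<^sup>2)"
        by (simp only: K_def norm_of_real) (simp add: sum_nonneg)
      then show ?thesis
        using trapezoid_square_sum_le[of "int N" "q * M" B] N H[OF r] aq by (simp add: g_def)
    qed
    also have "(\<Sum>s\<in>R - {r}. K r s * (real (snd r) / real (snd s)))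
       \<le> (\<Sum>s\<in>R - {r}. (1 / real (q * M) + 1 / real (snd s * M))
      * (1 / (sin (pi * (frac_of r - frac_of s)))\<^sup>2) * (real (snd r) / real (snd s)))"
    proof (intro sum_mono mult_right_mono)
      fix s assume s: "s \<in> R - {r}"
      then have "r \<noteq> s" by auto
      with s show "K r s \<le> (1 / real (q * M) + 1 / real (snd s * M)) * (1 / (sin (pi * (frac_of r - frac_of s)))\<^sup>2)"
        unfolding K_def Kc_def g_def
        using trapezoid_kernel_le[of "int N" "snd r * M" "snd s * M" B "frac_of r - frac_of s"]
          N H[OF r] H[of s] frac_of_dist[of r M s] r aq by (simp add: R_def)
    qed auto
    also have "\<dots> \<le> (\<Sum>s\<in>R. (1 / real (q * M) + 1 / real (snd s * M))
      * (1 / (sin (pi * (frac_of r - frac_of s)))\<^sup>2) * (real (snd r) / real (snd s)))"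
      using fin by (intro sum_mono2) auto
    also have "\<dots> \<le> 4 / 3 * real q * real M"
      using farey_row_sum_le[of a q M] r by (simp add: R_def aq frac_of_def case_prod_unfold)
    finally show "(\<Sum>s\<in>R. K r s * (real (snd r) / real (snd s))) \<le> real N + 2 * real (snd r) * real M"
      by (simp add: aq mult_ac add.commute)
  qed auto
  finally show ?thesis by (simp add: R_def)
qed

section \<open>The sieve\<close>

text \<open>Write \<open>n = t * m + i\<close> with \<open>i < m\<close>. The factor
  \<open>f\<close> sees only \<open>i\<close>, and for fixed \<open>i\<close> the numbers
  \<open>t * m + i\<close> run through all residues modulo \<open>p\<close>, because
  \<open>m\<close> is invertible there.\<close>

lemma sum_lessThan_times_CRT:
  fixes f u :: "nat \<Rightarrow> 'a::comm_ring_1"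
  assumes m: "m > 0" and p: "p > 0" and cop: "coprime m p"
    and f: "\<And>n. f (n mod m) = f n" and u: "\<And>n. u (n mod p) = u n"
  shows "(\<Sum>n<p * m. f n * u n) = (\<Sum>n<m. f n) * (\<Sum>n<p. u n)"
proof -
  have fp: "f (t * m + i) = f i" for t i using f[of "t * m + i"] f[of i] by simp
  have up: "(\<Sum>t<p. u (t * m + i)) = (\<Sum>n<p. u n)" for i
  proof -
    define G where "G = (\<lambda>x. u (nat (x mod int p)))"
    have G: "G (int n) = u n" for n using u p by (simp add: G_def nat_mod_as_int[symmetric] zmod_int[symmetric])
    have "(\<Sum>t<p. G (int (t * m + i))) = (\<Sum>t<p. G (int t))"
    proof (rule sum_residues)
      show "inj_on (\<lambda>t. int (t * m + i) mod int p) {..<p}"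
      proof (rule inj_onI)
        fix x y assume xy: "x \<in> {..<p}" "y \<in> {..<p}" "int (x * m + i) mod int p = int (y * m + i) mod int p"
        then have "int p dvd int m * (int x - int y)"
          by (simp add: mod_eq_dvd_iff right_diff_distrib mult.commute)
        then have "int p dvd int x - int y"
          using cop by (simp add: coprime_dvd_mult_right_iff coprime_commute)
        then have "int x mod int p = int y mod int p" by (simp add: mod_eq_dvd_iff)
        then show "x = y" using xy by simp
      qed
    qed (use p in \<open>auto simp: G_def\<close>)
    then show ?thesis by (simp only: G)
  qed
  have "(\<Sum>n<p * m. f n * u n) = (\<Sum>t<p. \<Sum>n\<in>{t * m..<t * m + m}. f n * u n)"
    by (simp add: sum.nat_group)
  also have "\<dots> = (\<Sum>t<p. \<Sum>i<m. f i * u (t * m + i))"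
  proof (rule sum.cong[OF refl])
    fix t
    have "(\<Sum>n\<in>{t * m..<t * m + m}. f n * u n) = (\<Sum>i<m. f (t * m + i) * u (t * m + i))"
      using sum.shift_bounds_nat_ivl[of "\<lambda>n. f n * u n" 0 "t * m" m]
      by (simp add: lessThan_atLeast0 add.commute)
    then show "(\<Sum>n\<in>{t * m..<t * m + m}. f n * u n) = (\<Sum>i<m. f i * u (t * m + i))" by (simp add: fp)
  qed
  also have "\<dots> = (\<Sum>i<m. f i * (\<Sum>t<p. u (t * m + i)))"
    by (subst sum.swap) (simp add: sum_distrib_left)
  finally show ?thesis by (simp add: up sum_distrib_right)
qed

definition local_density :: "(nat \<Rightarrow> nat set) \<Rightarrow> nat \<Rightarrow> real" where
  "local_density Omega p = real (card (Omega p)) / (real p - real (card (Omega p)))"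

text \<open>The values are chosen such that the mean over all residues vanishes.\<close>

definition local_wave :: "(nat \<Rightarrow> nat set) \<Rightarrow> nat \<Rightarrow> nat \<Rightarrow> real" where
  "local_wave Omega p n = (if n mod p \<in> Omega p then - 1 else local_density Omega p)"

lemma sum_local_wave:
  assumes "Omega p \<subseteq> {0..<p}" "card (Omega p) < p"
  shows "(\<Sum>n<p. local_wave Omega p n) = 0"
    and "(\<Sum>n<p. (local_wave Omega p n)\<^sup>2) = real p * local_density Omega p"
proof -
  define w where "w = card (Omega p)"
  have split: "(\<Sum>n<p. F (n mod p \<in> Omega p)) = real w * F True + (real p - real w) * F False" for F :: "bool \<Rightarrow> real"
  proof -
    have fin: "finite (Omega p)" using assms(1) finite_subset by blast
    have sub: "Omega p \<subseteq> {..<p}" using assms(1) by auto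
    have "(\<Sum>n<p. F (n mod p \<in> Omega p)) = (\<Sum>n\<in>{..<p} - Omega p. F False) + (\<Sum>n\<in>Omega p. F True)"
    proof -
      have "(\<Sum>n\<in>Omega p. F (n mod p \<in> Omega p)) = (\<Sum>n\<in>Omega p. F True)"
        using sub by (intro sum.cong) auto
      moreover have "(\<Sum>n\<in>{..<p} - Omega p. F (n mod p \<in> Omega p)) = (\<Sum>n\<in>{..<p} - Omega p. F False)"
        by (intro sum.cong) auto
      ultimately show ?thesis by (simp add: sum.subset_diff[OF sub])
    qed
    then show ?thesis using sub fin assms(2)
      by (simp add: card_Diff_subset w_def of_nat_diff algebra_simps)
  qed
  define h where "h = local_density Omega p"
  have h: "(real p - real w) * h = real w"
    using assms(2) by (simp add: h_def local_density_def w_def)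
  show "(\<Sum>n<p. local_wave Omega p n) = 0"
    using split[of "\<lambda>b. if b then - 1 else h"] h unfolding local_wave_def h_def[symmetric] by simp
  have "(\<Sum>n<p. (local_wave Omega p n)\<^sup>2) = real w + (real p - real w) * h * h"
    using split[of "\<lambda>b. (if b then - 1 else h)\<^sup>2"]
    unfolding local_wave_def h_def[symmetric] by (simp add: power2_eq_square)
  also have "\<dots> = (real p - real w) * h + real w * h" using h by simp
  finally show "(\<Sum>n<p. (local_wave Omega p n)\<^sup>2) = real p * local_density Omega p"
    by (simp add: h_def algebra_simps)
qed

lemma local_wave_mod: "p dvd q \<Longrightarrow> local_wave Omega p (n mod q) = local_wave Omega p n"
  by (simp add: local_wave_def mod_mod_cancel)

text \<open>A test function attached to \<open>q\<close>. At every \<open>n\<close> that avoids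
  \<open>Omega p\<close> for all primes \<open>p\<close> dividing \<open>q\<close> it equals
  \<open>sieve_density\<close>, and for squarefree \<open>q\<close> its mean square over a period is
  \<open>sieve_density\<close> again.\<close>

definition sieve_wave :: "(nat \<Rightarrow> nat set) \<Rightarrow> nat \<Rightarrow> nat \<Rightarrow> real" where
  "sieve_wave Omega q n = (\<Prod>p\<in>prime_factors q. local_wave Omega p n)"

definition sieve_density :: "(nat \<Rightarrow> nat set) \<Rightarrow> nat \<Rightarrow> real" where
  "sieve_density Omega q = (\<Prod>p\<in>prime_factors q. local_density Omega p)"

lemma sieve_wave_mod: "sieve_wave Omega q (n mod q) = sieve_wave Omega q n"
  unfolding sieve_wave_def by (intro prod.cong local_wave_mod) auto

lemma prime_factors_prime_times:
  fixes p m :: nat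
  assumes "prime p" "m > 0"
  shows "prime_factors (p * m) = insert p (prime_factors m)"
  using assms by (simp add: prime_factors_product prime_prime_factors)

lemma squarefree_cases:
  fixes p q :: nat
  assumes "squarefree q" "p \<in> prime_factors q"
  obtains m where "q = p * m" "coprime m p" "m > 0" "squarefree m" "p \<notin> prime_factors m"
proof -
  have p: "prime p" "p dvd q" using assms(2) by auto
  then obtain m where m: "q = p * m" by auto
  have "\<not> p\<^sup>2 dvd q" using assms(1) p by (auto simp: squarefree_def not_prime_unit)
  then have pm: "\<not> p dvd m" using m by (auto simp: power2_eq_square)
  then have "coprime m p" using p by (metis coprime_commute prime_imp_coprime)
  moreover have "m > 0" using pm by (cases m) auto
  moreover have "squarefree m" using assms(1) m squarefree_mono by (metis dvd_triv_right)
  moreover have "p \<notin> prime_factors m" using pm by auto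
  ultimately show ?thesis using m that by blast
qed

lemma sum_sieve_wave_squared:
  assumes Om: "\<And>p. prime p \<Longrightarrow> Omega p \<subseteq> {0..<p}" "\<And>p. prime p \<Longrightarrow> card (Omega p) < p"
    and "squarefree q" "q > 0"
  shows "(\<Sum>n<q. (sieve_wave Omega q n)\<^sup>2) = real q * sieve_density Omega q"
  using assms(3,4)
proof (induction q rule: less_induct)
  case (less q)
  show ?case
  proof (cases "prime_factors q = {}")
    case True
    then have "q = 1" using less.prems by (simp add: prime_factorization_empty_iff)
    then show ?thesis by (simp add: sieve_wave_def sieve_density_def)
  next
    case False
    then obtain p where p: "p \<in> prime_factors q" by auto
    obtain m where m: "q = p * m" "coprime m p" "m > 0" "squarefree m" "p \<notin> prime_factors m"
      using squarefree_cases[OF less.prems(1) p] by metis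
    have pp: "prime p" using p by auto
    then have p0: "p > 1" by (rule prime_gt_1_nat)
    have pf: "prime_factors q = insert p (prime_factors m)"
      using pp m by (simp add: prime_factors_prime_times)
    have sw: "(sieve_wave Omega q n)\<^sup>2 = (sieve_wave Omega m n)\<^sup>2 * (local_wave Omega p n)\<^sup>2" for n
      using m(5) by (simp add: sieve_wave_def pf power_mult_distrib mult.commute)
    have "(\<Sum>n<q. (sieve_wave Omega q n)\<^sup>2) = (\<Sum>n<m. (sieve_wave Omega m n)\<^sup>2) * (\<Sum>n<p. (local_wave Omega p n)\<^sup>2)"
      unfolding sw unfolding m(1)
      by (rule sum_lessThan_times_CRT) (use m p0 in \<open>auto simp: sieve_wave_mod local_wave_mod\<close>)
    also have "\<dots> = real q * sieve_density Omega q"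
      using less.IH[of m] m p0 sum_local_wave(2)[of Omega p] Om[OF pp]
      by (simp add: sieve_density_def pf[unfolded m(1)])
    finally show ?thesis .
  qed
qed

text \<open>If a prime \<open>p\<close> divides both \<open>a\<close> and \<open>q\<close>, the
  phase \<open>a * n / q\<close> depends only on \<open>n\<close> modulo \<open>q / p\<close>. The
  sum then splits off the factor at \<open>p\<close>, the mean of \<open>local_wave\<close>, which
  is 0. Hence only reduced fractions occur in the expansion of \<open>sieve_wave\<close>.\<close>

lemma dft_sieve_wave_eq_0:
  assumes Om: "\<And>p. prime p \<Longrightarrow> Omega p \<subseteq> {0..<p}" "\<And>p. prime p \<Longrightarrow> card (Omega p) < p"
    and q: "squarefree q" "q > 0" and a: "\<not> coprime a q"
  shows "dft q (\<lambda>n. of_real (sieve_wave Omega q n)) a = 0"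
proof -
  have "gcd a q \<noteq> 1" using a by (simp add: coprime_iff_gcd_eq_1)
  then obtain p where pp: "prime p" "p dvd a" "p dvd q"
    using prime_factor_nat by (metis gcd_nat.boundedE)
  then have "p \<in> prime_factors q" using q by (simp add: in_prime_factors_iff)
  then obtain m where m: "q = p * m" "coprime m p" "m > 0" "squarefree m" "p \<notin> prime_factors m"
    using squarefree_cases[OF q(1)] by metis
  have p0: "p > 1" using pp(1) by (rule prime_gt_1_nat)
  obtain c where c: "a = p * c" using pp by auto
  have pf: "prime_factors q = insert p (prime_factors m)"
    using pp m by (simp add: prime_factors_prime_times)
  have frac: "real n * real a / real q = real n * real c / real m" for n
    using c m p0 by simp
  define f where "f = (\<lambda>n. complex_of_real (sieve_wave Omega m n) * cnj (ee (real n * real c / real m)))"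
  have "ee (real (n mod m) * real c / real m) = ee (real n * real c / real m)" for n
  proof -
    have "real n = real (n mod m) + real m * real (n div m)"
      by (metis mod_mult_div_eq of_nat_add of_nat_mult)
    then have "real n * real c / real m = real (n mod m) * real c / real m + real (n div m * c)"
      using m by (simp add: field_simps)
    then show ?thesis by (simp only: ee_add ee_int mult_1_right)
  qed
  then have fm: "f (n mod m) = f n" for n by (simp add: f_def sieve_wave_mod)
  have "dft q (\<lambda>n. of_real (sieve_wave Omega q n)) a = (\<Sum>n<p * m. f n * of_real (local_wave Omega p n))"
    unfolding dft_def frac using m(5)
    by (intro sum.cong) (auto simp: m(1)[symmetric] sieve_wave_def pf f_def)
  also have "\<dots> = (\<Sum>n<m. f n) * (\<Sum>n<p. of_real (local_wave Omega p n))"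
    by (rule sum_lessThan_times_CRT) (use m p0 fm in \<open>auto simp: local_wave_mod\<close>)
  also have "(\<Sum>n<p. complex_of_real (local_wave Omega p n)) = 0"
    using sum_local_wave(1)[of Omega p] Om[OF pp(1)] by (simp flip: of_real_sum)
  finally show ?thesis by simp
qed

section \<open>The large sieve applied to the sifted numbers\<close>

lemma sum_farey: "(\<Sum>r\<in>farey M. f r) = (\<Sum>q=1..M. \<Sum>a | a < q \<and> coprime a q. f (a, q))"
proof -
  have "farey M = (\<lambda>(x, y). (y, x)) ` (SIGMA q:{1..M}. {a. a < q \<and> coprime a q})"
    by (auto simp: farey_def image_iff)
  then show ?thesis
    by (simp add: sum.reindex inj_on_def sum.Sigma case_prod_unfold)
qed

text \<open>The large sieve is tested with coefficients whose exponential sum at \<open>n\<close> is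
  the sum of \<open>F q * sieve_wave Omega q n\<close>. At each sifted \<open>n\<close> this equals
  \<open>L\<close>, while the right-hand side becomes \<open>N * L\<close>; cancelling
  \<open>L\<close> gives the claim. The choice of \<open>F q\<close> proportional to
  \<open>1 / (N + 2 q M)\<close> is the one that Cauchy's inequality singles out.\<close>

lemma weighted_sieve_bound:
  assumes Om: "\<And>p. prime p \<Longrightarrow> Omega p \<subseteq> {0..<p}" "\<And>p. prime p \<Longrightarrow> card (Omega p) < p"
    and N: "N \<ge> 1" and M: "M \<ge> 1" and S: "S \<subseteq> {1..N}"
    and sift: "\<And>n p. n \<in> S \<Longrightarrow> prime p \<Longrightarrow> p \<le> M \<Longrightarrow> n mod p \<notin> Omega p"
  shows "real (card S) * (\<Sum>q | q \<in> {1..M} \<and> squarefree q.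
      sieve_density Omega q * (real N / (real N + 2 * real q * real M))) \<le> real N"
proof -
  define Q where "Q = {q. q \<in> {1..M} \<and> squarefree q}"
  define F where "F = (\<lambda>q. real N / (real N + 2 * real q * real M))"
  define L where "L = (\<Sum>q\<in>Q. sieve_density Omega q * F q)"
  have dens: "0 \<le> sieve_density Omega q" for q
    unfolding sieve_density_def local_density_def
  proof (rule prod_nonneg)
    fix p assume "p \<in> prime_factors q"
    then have "card (Omega p) < p" by (intro Om(2)) auto
    then show "0 \<le> real (card (Omega p)) / (real p - real (card (Omega p)))" by simp
  qed
  have Fpos: "0 < F q" for q using N by (simp add: F_def add_pos_nonneg)
  define d where "d = (\<lambda>q. dft q (\<lambda>n. of_real (sieve_wave Omega q n)))"
  define b where "b = (\<lambda>(a, q). if squarefree q then of_real (F q / real q) * d q a else 0)"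
  \<comment> \<open>Coefficients at non-reduced \<open>a\<close> vanish, so the reduced numerators
    can be replaced by a complete residue system, to which inversion and Parseval apply. The
    condition on \<open>H\<close> says that a vanishing coefficient contributes nothing.\<close>
  have restrict: "(\<Sum>a | a < q \<and> coprime a q. H (d q a) a) = (\<Sum>a<q. H (d q a) a)"
    if "q \<in> Q" "\<And>a. H 0 a = 0" for q and H :: "complex \<Rightarrow> nat \<Rightarrow> 'a::comm_monoid_add"
    using that dft_sieve_wave_eq_0[of Omega q] Om
    by (intro sum.mono_neutral_left) (auto simp: d_def Q_def)
  have expand: "(\<Sum>r\<in>farey M. b r * ee (real n * frac_of r)) = of_real (\<Sum>q\<in>Q. F q * sieve_wave Omega q n)" for n
  proof -
    have "(\<Sum>r\<in>farey M. b r * ee (real n * frac_of r))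
      = (\<Sum>q\<in>Q. \<Sum>a | a < q \<and> coprime a q. of_real (F q / real q) * (d q a * ee (real n * real a / real q)))"
      unfolding sum_farey
      by (rule sum.mono_neutral_cong_right) (auto simp: Q_def b_def frac_of_def mult_ac)
    also have "\<dots> = (\<Sum>q\<in>Q. of_real (F q * sieve_wave Omega q n))"
    proof (rule sum.cong[OF refl])
      fix q assume q: "q \<in> Q"
      then have q0: "q > 0" by (auto simp: Q_def)
      have "ee (real n * real a / real q) = ee (real (n mod q) * real a / real q)" for a
      proof -
        have "real n = real (n mod q) + real q * real (n div q)"
          by (metis mod_mult_div_eq of_nat_add of_nat_mult)
        then have "real n * real a / real q = real (n mod q) * real a / real q + real (n div q * a)"
          using q0 by (simp add: field_simps)
        then show ?thesis by (simp only: ee_add ee_int mult_1_right)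
      qed
      then have "(\<Sum>a | a < q \<and> coprime a q. of_real (F q / real q) * (d q a * ee (real n * real a / real q)))
        = (\<Sum>a<q. of_real (F q / real q) * (d q a * ee (real (n mod q) * real a / real q)))"
        using restrict[OF q, of "\<lambda>z a. of_real (F q / real q) * (z * ee (real (n mod q) * real a / real q))"] by simp
      also have "\<dots> = of_real (F q / real q) * (of_nat q * of_real (sieve_wave Omega q (n mod q)))"
        unfolding sum_distrib_left[symmetric] d_def using q0 by (subst dft_inversion) auto
      also have "\<dots> = of_real (F q * sieve_wave Omega q n)"
        using q0 by (simp add: sieve_wave_mod)
      finally show "(\<Sum>a | a < q \<and> coprime a q. of_real (F q / real q) * (d q a * ee (real n * real a / real q)))
        = complex_of_real (F q * sieve_wave Omega q n)" .
    qed
    finally show ?thesis by simp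
  qed
  have "real (card S) * L\<^sup>2 = (\<Sum>n\<in>S. (\<Sum>q\<in>Q. F q * sieve_wave Omega q n)\<^sup>2)"
  proof -
    have "(\<Sum>q\<in>Q. F q * sieve_wave Omega q n) = L" if "n \<in> S" for n
    proof -
      have "sieve_wave Omega q n = sieve_density Omega q" if "q \<in> Q" for q
        unfolding sieve_wave_def sieve_density_def
      proof (rule prod.cong[OF refl])
        fix p assume p: "p \<in> prime_factors q"
        then have "p \<le> q" using that by (intro dvd_imp_le) (auto simp: Q_def)
        then have "n mod p \<notin> Omega p" using p that sift[OF \<open>n \<in> S\<close>, of p] by (auto simp: Q_def)
        then show "local_wave Omega p n = local_density Omega p" by (simp add: local_wave_def)
      qed
      then show ?thesis by (simp add: L_def mult.commute)
    qed
    then show ?thesis by simp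
  qed
  also have "\<dots> \<le> (\<Sum>n=1..N. (\<Sum>q\<in>Q. F q * sieve_wave Omega q n)\<^sup>2)"
    using S by (intro sum_mono2) auto
  also have "\<dots> = (\<Sum>n=1..N. (norm (\<Sum>r\<in>farey M. b r * ee (real n * frac_of r)))\<^sup>2)"
    by (simp only: expand norm_of_real power2_abs)
  also have "\<dots> \<le> (\<Sum>r\<in>farey M. (norm (b r))\<^sup>2 * (real N + 2 * real (snd r) * real M))"
    by (rule weighted_large_sieve[OF N M])
  also have "\<dots> = (\<Sum>q\<in>Q. \<Sum>a | a < q \<and> coprime a q. (F q / real q)\<^sup>2 * (norm (d q a))\<^sup>2 * (real N + 2 * real q * real M))"
    unfolding sum_farey
    by (rule sum.mono_neutral_cong_right)
      (auto simp: Q_def b_def norm_mult norm_divide power_mult_distrib power_divide)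
  also have "\<dots> = (\<Sum>q\<in>Q. real N * (sieve_density Omega q * F q))"
  proof (rule sum.cong[OF refl])
    fix q assume q: "q \<in> Q"
    then have q0: "q > 0" "squarefree q" by (auto simp: Q_def)
    have "(\<Sum>a | a < q \<and> coprime a q. (F q / real q)\<^sup>2 * (norm (d q a))\<^sup>2 * (real N + 2 * real q * real M))
      = (\<Sum>a<q. (F q / real q)\<^sup>2 * (norm (d q a))\<^sup>2 * (real N + 2 * real q * real M))"
      using restrict[OF q, of "\<lambda>z a. (F q / real q)\<^sup>2 * (norm z)\<^sup>2 * (real N + 2 * real q * real M)"] by simp
    also have "\<dots> = (F q / real q)\<^sup>2 * (\<Sum>a<q. (norm (d q a))\<^sup>2) * (real N + 2 * real q * real M)"
      by (simp add: sum_distrib_left sum_distrib_right)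
    also have "(\<Sum>a<q. (norm (d q a))\<^sup>2) = real q * (\<Sum>n<q. (sieve_wave Omega q n)\<^sup>2)"
      unfolding d_def dft_Parseval by simp
    also have "\<dots> = real q * (real q * sieve_density Omega q)"
      using sum_sieve_wave_squared[of Omega q] Om q0 by simp
    also have "(F q / real q)\<^sup>2 * (real q * (real q * sieve_density Omega q)) * (real N + 2 * real q * real M)
       = F q * (F q * (real N + 2 * real q * real M)) * sieve_density Omega q"
      using q0 by (simp add: power2_eq_square)
    also have "F q * (real N + 2 * real q * real M) = real N"
    proof -
      have "real N + 2 * real q * real M > 0" using N by (simp add: add_pos_nonneg)
      then show ?thesis by (simp add: F_def)
    qed
    finally show "(\<Sum>a | a < q \<and> coprime a q. (F q / real q)\<^sup>2 * (norm (d q a))\<^sup>2 * (real N + 2 * real q * real M))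
       = real N * (sieve_density Omega q * F q)" by (simp add: mult_ac)
  qed
  also have "\<dots> = real N * L" by (simp add: L_def sum_distrib_left)
  finally have main: "real (card S) * L\<^sup>2 \<le> real N * L" .
  have "L > 0"
  proof -
    have "0 < sieve_density Omega 1 * F 1" using Fpos by (simp add: sieve_density_def)
    also have "\<dots> \<le> L" unfolding L_def
      by (rule member_le_sum) (use M dens Fpos in \<open>auto simp: Q_def less_imp_le\<close>)
    finally show ?thesis .
  qed
  then show ?thesis using main unfolding L_def[symmetric, unfolded F_def Q_def]
    by (simp add: power2_eq_square flip: mult.assoc)
qed

section \<open>Bernoulli variables against geometric ones\<close>

text \<open>The expectation of \<open>f\<close> at \<open>y\<close> minus the sum of
  \<open>X_p * ln p\<close>, for independent 0-1 variables \<open>X_p\<close> of mean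
  \<open>b p\<close>. A recursion over the list takes the place of a product measure.\<close>

fun bernoulli_mean :: "nat list \<Rightarrow> (nat \<Rightarrow> real) \<Rightarrow> (real \<Rightarrow> real) \<Rightarrow> real \<Rightarrow> real" where
  "bernoulli_mean [] b f y = f y"
| "bernoulli_mean (p # ps) b f y = (1 - b p) * bernoulli_mean ps b f y + b p * bernoulli_mean ps b f (y - ln (real p))"

text \<open>The geometric variables without their normalising factors \<open>1 - 1 / p\<close>, so
  that expanding gives terms \<open>f (y - ln m) / m\<close>. The cut-off at \<open>K\<close> keeps
  the sums finite and loses no product \<open>m <= K\<close>.\<close>

fun geometric_sums :: "nat \<Rightarrow> nat list \<Rightarrow> (real \<Rightarrow> real) \<Rightarrow> real \<Rightarrow> real" where
  "geometric_sums K [] f y = f y"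
| "geometric_sums K (p # ps) f y = (\<Sum>k\<le>K. (1 / real p) ^ k * geometric_sums K ps f (y - real k * ln (real p)))"

lemma bernoulli_mean_le:
  assumes "\<And>p. p \<in> set ps \<Longrightarrow> 1 \<le> p \<and> 0 \<le> b p \<and> b p \<le> 1"
    and "\<And>x. x \<le> y \<Longrightarrow> f x \<le> g x"
  shows "bernoulli_mean ps b f y \<le> bernoulli_mean ps b g y"
  using assms
proof (induction ps arbitrary: y)
  case (Cons p ps)
  have p: "1 \<le> p" "0 \<le> b p" "b p \<le> 1" using Cons.prems(1) by auto
  have l: "ln (real p) \<ge> 0" using p by simp
  have 1: "bernoulli_mean ps b f y \<le> bernoulli_mean ps b g y" using Cons by auto
  have 2: "bernoulli_mean ps b f (y - ln (real p)) \<le> bernoulli_mean ps b g (y - ln (real p))"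
    by (rule Cons.IH) (use Cons.prems(1) l in \<open>auto intro!: Cons.prems(2) intro: order_trans\<close>)
  show ?case using p 1 2 by (auto intro!: add_mono mult_left_mono)
qed auto

lemma bernoulli_mean_nonneg:
  assumes "\<And>p. p \<in> set ps \<Longrightarrow> 0 \<le> b p \<and> b p \<le> 1" and "\<And>x. 0 \<le> f x"
  shows "0 \<le> bernoulli_mean ps b f y"
  using assms by (induction ps arbitrary: y) auto

lemma bernoulli_mean_mono:
  assumes "\<And>p. p \<in> set ps \<Longrightarrow> 0 \<le> b p \<and> b p \<le> 1" and "mono f"
  shows "mono (bernoulli_mean ps b f)"
  using assms
proof (induction ps)
  case (Cons p ps)
  have IH: "mono (bernoulli_mean ps b f)" using Cons by auto
  have p: "0 \<le> b p" "b p \<le> 1" using Cons.prems(1) by auto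
  show ?case
  proof (rule monoI)
    fix x y :: real assume "x \<le> y"
    then have "bernoulli_mean ps b f x \<le> bernoulli_mean ps b f y"
      "bernoulli_mean ps b f (x - ln (real p)) \<le> bernoulli_mean ps b f (y - ln (real p))"
      using IH by (auto simp: mono_def)
    then show "bernoulli_mean (p # ps) b f x \<le> bernoulli_mean (p # ps) b f y"
      using p by (auto intro!: add_mono mult_left_mono)
  qed
qed (auto simp: mono_def)

lemma geometric_sums_nonneg: "(\<And>x. 0 \<le> f x) \<Longrightarrow> 0 \<le> geometric_sums K ps f y"
  by (induction ps arbitrary: y) (auto intro!: sum_nonneg)

lemma geometric_sums_mono:
  assumes "mono f"
  shows "mono (geometric_sums K ps f)"
proof (induction ps)
  case Nil then show ?case using assms by (auto simp: mono_def)
next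
  case (Cons p ps)
  then show ?case
    by (auto simp: mono_def intro!: sum_mono mult_left_mono)
qed

lemma bernoulli_mean_sum_shift:
  "bernoulli_mean ps b (\<lambda>x. \<Sum>k\<in>I. c k * f (x - a k)) y = (\<Sum>k\<in>I. c k * bernoulli_mean ps b f (y - a k))"
proof (induction ps arbitrary: y)
  case (Cons p ps)
  have "bernoulli_mean (p # ps) b (\<lambda>x. \<Sum>k\<in>I. c k * f (x - a k)) y =
    (1 - b p) * (\<Sum>k\<in>I. c k * bernoulli_mean ps b f (y - a k)) +
    b p * (\<Sum>k\<in>I. c k * bernoulli_mean ps b f (y - ln (real p) - a k))"
    by (simp add: Cons.IH)
  also have "\<dots> = (\<Sum>k\<in>I. c k * bernoulli_mean (p # ps) b f (y - a k))"
    by (simp add: sum_distrib_left sum.distrib[symmetric] algebra_simps diff_right_commute)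
  finally show ?case .
qed auto

text \<open>A Bernoulli variable is stochastically dominated by the sum of a smaller Bernoulli
  variable and an independent geometric one, as soon as the latter sum charges 0 less.\<close>

lemma bernoulli_mean_layer:
  assumes "\<And>p. p \<in> set ps \<Longrightarrow> 2 \<le> p \<and> 0 \<le> b p \<and> b p \<le> 1 \<and> 0 \<le> b' p \<and> b' p \<le> 1
      \<and> (1 - b' p) * (1 - 1 / real p) \<le> 1 - b p"
    and f: "mono f" "\<And>x. 0 \<le> f x"
  shows "(\<Prod>p\<leftarrow>ps. 1 - 1 / real p) * bernoulli_mean ps b' (geometric_sums K ps f) y \<le> bernoulli_mean ps b f y"
  using assms(1)
proof (induction ps arbitrary: y)
  case (Cons p ps)
  define th where "th = 1 - 1 / real p"
  define W where "W = (\<Prod>p\<leftarrow>ps. 1 - 1 / real p)"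
  define g where "g = (\<lambda>x. W * bernoulli_mean ps b' (geometric_sums K ps f) x)"
  have p: "2 \<le> p" "0 \<le> b p" "b p \<le> 1" "0 \<le> b' p" "b' p \<le> 1" "(1 - b' p) * th \<le> 1 - b p"
    using Cons.prems[of p] by (auto simp: th_def)
  have th: "0 \<le> th" "th \<le> 1" "1 - th = 1 / real p" using p by (auto simp: th_def)
  have W: "0 \<le> W" unfolding W_def using Cons.prems
    by (intro prod_list_nonneg) (fastforce simp: field_simps)
  have gm: "mono g" unfolding g_def
    using bernoulli_mean_mono[of ps b' "geometric_sums K ps f"] geometric_sums_mono[OF f(1)] Cons.prems W
    by (auto simp: mono_def intro!: mult_left_mono)
  have gn: "0 \<le> g x" for x
    unfolding g_def using W Cons.prems f(2)
    by (intro mult_nonneg_nonneg bernoulli_mean_nonneg geometric_sums_nonneg) auto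
  have IH: "g x \<le> bernoulli_mean ps b f x" for x
    unfolding g_def W_def using Cons.IH Cons.prems by auto
  define l where "l = ln (real p)"
  have l: "0 \<le> l" using p by (auto simp: l_def)
  define G where "G = (\<lambda>x. \<Sum>k\<le>K. (1 / real p) ^ k * g (x - real k * l))"
  \<comment> \<open>As \<open>g\<close> is increasing, all exponents \<open>k >= 1\<close> may be
    replaced by 1; their normalised total mass is at most \<open>1 - th\<close>.\<close>
  have G: "th * G x \<le> th * g x + (1 - th) * g (x - l)" for x
  proof -
    have "G x = g x + (\<Sum>k=1..K. (1 / real p) ^ k * g (x - real k * l))"
      unfolding G_def by (simp add: atMost_atLeast0 sum.atLeast_Suc_atMost)
    also have "(\<Sum>k=1..K. (1 / real p) ^ k * g (x - real k * l))
      \<le> (\<Sum>k=1..K. (1 / real p) ^ k * g (x - l))"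
    proof (intro sum_mono mult_left_mono)
      fix k assume "k \<in> {1..K}"
      then have "1 * l \<le> real k * l" using l by (intro mult_right_mono) auto
      then show "g (x - real k * l) \<le> g (x - l)" using gm by (auto simp: mono_def)
    qed auto
    also have "\<dots> = (\<Sum>k=1..K. (1 / real p) ^ k) * g (x - l)"
      by (simp add: sum_distrib_right)
    finally have "th * G x \<le> th * g x + (th * (\<Sum>k=1..K. (1 / real p) ^ k)) * g (x - l)"
      using mult_left_mono[OF _ th(1)] by (fastforce simp: distrib_left mult.assoc)
    moreover have "th * (\<Sum>k=1..K. (1 / real p) ^ k) \<le> 1 - th"
    proof -
      have "(1 - r) * (\<Sum>k=1..K. r ^ k) = r - r ^ Suc K" for r :: real
        using sum_gp_multiplied[of 1 K r] by (cases "K = 0") auto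
      then show ?thesis using p by (simp add: th_def)
    qed
    ultimately show ?thesis
      using gn[of "x - l"] by (smt (verit) mult_right_mono)
  qed
  have "(\<Prod>p\<leftarrow>p # ps. 1 - 1 / real p) * bernoulli_mean (p # ps) b' (geometric_sums K (p # ps) f) y
     = th * ((1 - b' p) * G y + b' p * G (y - l))"
  proof -
    have *: "W * bernoulli_mean ps b' (geometric_sums K (p # ps) f) x = G x" for x
    proof -
      have "(geometric_sums K (p # ps) f) = (\<lambda>x. \<Sum>k\<in>{..K}. (1 / real p) ^ k * geometric_sums K ps f (x - real k * l))"
        by (auto simp: l_def)
      then have "bernoulli_mean ps b' (geometric_sums K (p # ps) f) x = (\<Sum>k\<le>K. (1 / real p) ^ k * bernoulli_mean ps b' (geometric_sums K ps f) (x - real k * l))"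
        by (simp only: bernoulli_mean_sum_shift[where a="\<lambda>k. real k * l"])
      then show ?thesis
        unfolding G_def g_def by (simp only: sum_distrib_left mult.left_commute)
    qed
    show ?thesis
      by (simp add: th_def[symmetric] W_def[symmetric] l_def[symmetric] *[symmetric] algebra_simps)
  qed
  \<comment> \<open>\<open>(1 - b' p) * th\<close> is the mass at which both variables vanish;
    everything else has dropped the argument by at least \<open>l\<close>.\<close>
  also have "\<dots> \<le> (1 - b' p) * th * g y + (1 - (1 - b' p) * th) * g (y - l)"
  proof -
    have 1: "th * G y \<le> th * g y + (1 - th) * g (y - l)" by (rule G)
    have 2: "th * G (y - l) \<le> g (y - l)"
    proof -
      have "g (y - l - l) \<le> g (y - l)" using gm l by (auto simp: mono_def)
      then have "(1 - th) * g (y - l - l) \<le> (1 - th) * g (y - l)"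
        using th by (intro mult_left_mono) auto
      with G[of "y - l"] show ?thesis by (simp add: algebra_simps)
    qed
    have "(1 - b' p) * (th * G y) + b' p * (th * G (y - l))
      \<le> (1 - b' p) * (th * g y + (1 - th) * g (y - l)) + b' p * g (y - l)"
      using 1 2 p by (intro add_mono mult_left_mono) auto
    then show ?thesis by (simp add: algebra_simps)
  qed
  \<comment> \<open>Moving mass from \<open>y - l\<close> to \<open>y\<close> raises the mean; this
    is where the hypothesis linking \<open>b\<close> and \<open>b'\<close> enters.\<close>
  also have "\<dots> \<le> (1 - b p) * g y + b p * g (y - l)"
  proof -
    have "0 \<le> (1 - b p - (1 - b' p) * th) * (g y - g (y - l))"
      using p(6) gm l by (intro mult_nonneg_nonneg) (auto simp: mono_def)
    then show ?thesis by (simp add: algebra_simps)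
  qed
  also have "\<dots> \<le> bernoulli_mean (p # ps) b f y"
    using IH p by (auto simp: l_def intro!: add_mono mult_left_mono)
  finally show ?case .
qed auto

text \<open>By unique factorisation each \<open>m\<close> on the left occurs once among the products
  on the right, and the remaining products add nonnegative terms. Exponents up to \<open>M\<close>
  suffice, since \<open>k < 2^k <= p^k <= m\<close>.\<close>

lemma geometric_sums_ge_sum:
  assumes "distinct ps" "\<And>p. p \<in> set ps \<Longrightarrow> prime p" "\<And>x. 0 \<le> f x"
  shows "(\<Sum>m | m \<in> {1..M} \<and> prime_factors m \<subseteq> set ps. f (y - ln (real m)) / real m) \<le> geometric_sums M ps f y"
  using assms(1,2)
proof (induction ps arbitrary: y)
  case Nil
  have "{m. m \<in> {1..M} \<and> prime_factors m \<subseteq> set []} \<subseteq> {1}"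
    by (auto simp: prime_factorization_empty_iff)
  then have "(\<Sum>m | m \<in> {1..M} \<and> prime_factors m \<subseteq> set []. f (y - ln (real m)) / real m)
     \<le> (\<Sum>m\<in>{1}. f (y - ln (real m)) / real m)"
    using assms(3) by (intro sum_mono2) auto
  then show ?case by simp
next
  case (Cons p ps)
  have p: "prime p" "p \<notin> set ps" using Cons.prems by auto
  have p0: "real p > 0" using p by (simp add: prime_gt_0_nat)
  define A where "A = (\<lambda>ps. {m. m \<in> {1..M} \<and> prime_factors m \<subseteq> set ps})"
  have fin: "finite (A ps)" for ps unfolding A_def by auto
  define \<phi> where "\<phi> = (\<lambda>m. (multiplicity p m, m div p ^ multiplicity p m))"
  have inj: "inj_on \<phi> (A (p # ps))"
  proof (rule inj_onI)
    fix m n assume "\<phi> m = \<phi> n"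
    then show "m = n"
      by (metis \<phi>_def dvd_mult_div_cancel multiplicity_dvd prod.inject)
  qed
  have img: "\<phi> ` A (p # ps) \<subseteq> {..M} \<times> A ps"
  proof (rule image_subsetI)
    fix m assume "m \<in> A (p # ps)"
    moreover define k n where "k = multiplicity p m" and "n = m div p ^ k"
    ultimately have m: "m \<in> A (p # ps)" "k = multiplicity p m" "n = m div p ^ k" by auto
    have m0: "m > 0" "m \<le> M" using m by (auto simp: A_def)
    have dv: "p ^ k dvd m" using m by (simp add: multiplicity_dvd)
    have "k < 2 ^ k" by simp
    also have "\<dots> \<le> p ^ k" using p by (intro power_mono) (auto simp: prime_ge_2_nat)
    also have "\<dots> \<le> m" using dv m0 by (intro dvd_imp_le) auto
    finally have kM: "k \<le> M" using m0 by simp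
    have n0: "n > 0" using m dv m0
      by (metis dvd_div_eq_0_iff gr0I)
    have nm: "n dvd m" using m(3) dv by (metis dvd_div_mult_self dvd_triv_left)
    have pn: "\<not> p dvd n"
      using multiplicity_decompose[of m p] m m0 p not_prime_unit by fastforce
    have "prime_factors n \<subseteq> prime_factors m" using nm m0
      by (intro dvd_prime_factors) auto
    then have "prime_factors n \<subseteq> set ps"
      using m pn by (auto simp: A_def in_prime_factors_iff)
    moreover have "n \<le> M" using nm m0 dvd_imp_le[of n m] by linarith
    ultimately show "\<phi> m \<in> {..M} \<times> A ps" using n0 kM m(2,3) by (auto simp: A_def \<phi>_def)
  qed
  define t where "t = (\<lambda>(k, n). (1 / real p) ^ k * (f (y - real k * ln (real p) - ln (real n)) / real n))"
  have eq: "f (y - ln (real m)) / real m = t (\<phi> m)" if "m \<in> A (p # ps)" for m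
  proof -
    have m0: "m > 0" using that by (auto simp: A_def)
    define k n where "k = multiplicity p m" and "n = m div p ^ multiplicity p m"
    have mk: "m = p ^ k * n" unfolding k_def n_def by (simp add: multiplicity_dvd)
    then have n0: "n > 0" using m0 by (cases n) auto
    have "ln (real m) = real k * ln (real p) + ln (real n)"
      using mk n0 p0 by (simp add: ln_mult ln_realpow)
    then show ?thesis unfolding \<phi>_def t_def k_def[symmetric] n_def[symmetric]
      using mk by (simp add: k_def[symmetric] n_def[symmetric] power_divide algebra_simps)
  qed
  have "(\<Sum>m\<in>A (p # ps). f (y - ln (real m)) / real m) = (\<Sum>x\<in>\<phi> ` A (p # ps). t x)"
    using eq inj by (simp add: sum.reindex)
  also have "\<dots> \<le> (\<Sum>x\<in>{..M} \<times> A ps. t x)"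
    using img assms(3) fin by (intro sum_mono2) (auto simp: t_def)
  also have "\<dots> = (\<Sum>k\<le>M. (1 / real p) ^ k * (\<Sum>n\<in>A ps. f (y - real k * ln (real p) - ln (real n)) / real n))"
    by (simp add: t_def sum.cartesian_product[symmetric] sum_distrib_left)
  also have "\<dots> \<le> (\<Sum>k\<le>M. (1 / real p) ^ k * geometric_sums M ps f (y - real k * ln (real p)))"
    using Cons.IH Cons.prems by (intro sum_mono mult_left_mono) (auto simp: A_def)
  finally show ?case by (simp add: A_def)
qed

text \<open>An iterated integral, starting at \<open>ln 2\<close>. The shift by \<open>ln 2\<close>
  is lost once, in \<open>sum_soft_step_ge\<close>, and merely carried along by the later
  layers.\<close>

definition ramp :: "nat \<Rightarrow> real \<Rightarrow> real" where
  "ramp k y = max 0 (y - ln 2) ^ k / fact k"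

text \<open>At \<open>y = ln (M / q)\<close> this is \<open>1 / (1 + q / M)\<close>, cut off beyond
  \<open>q = M\<close>: a lower bound for the sieve weight of \<open>q\<close> as soon as
  \<open>2 * M^2 <= N\<close>.\<close>

definition soft_step :: "real \<Rightarrow> real" where
  "soft_step y = (if y \<ge> 0 then 1 / (1 + exp (- y)) else 0)"

lemma mono_soft_step: "mono soft_step"
  by (auto simp: mono_def soft_step_def intro!: divide_left_mono add_pos_pos mult_pos_pos)

lemma soft_step_nonneg: "0 \<le> soft_step y"
  by (auto simp: soft_step_def intro!: divide_nonneg_pos add_pos_pos)

lemma mono_ramp: "mono (ramp k)"
  by (auto simp: mono_def ramp_def intro!: divide_right_mono power_mono)

lemma ramp_nonneg: "0 \<le> ramp k y"
  by (auto simp: ramp_def)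

section \<open>Harmonic sums as discrete integration\<close>

lemma power_diff_le:
  fixes a b :: real
  assumes "0 \<le> b" "b \<le> a"
  shows "a ^ Suc k - b ^ Suc k \<le> real (Suc k) * (a - b) * a ^ k"
proof -
  have "a ^ Suc k - b ^ Suc k = (a - b) * (\<Sum>p<Suc k. a ^ p * b ^ (k - p))"
    by (rule diff_power_eq_sum)
  also have "\<dots> \<le> (a - b) * (\<Sum>p<Suc k. a ^ k)"
  proof (intro mult_left_mono sum_mono)
    fix p assume "p \<in> {..<Suc k}"
    then have "a ^ k = a ^ p * a ^ (k - p)" by (simp flip: power_add)
    then show "a ^ p * b ^ (k - p) \<le> a ^ k"
      using assms by (simp add: mult_left_mono power_mono)
  qed (use assms in auto)
  finally show ?thesis by (simp add: mult_ac)
qed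

text \<open>Beyond \<open>ln 2\<close>, \<open>ramp k\<close> is the derivative of
  \<open>ramp (Suc k)\<close>, and \<open>1 / m\<close> is at least the step
  \<open>ln (m + 1) - ln m\<close>. So the sum dominates a telescoping one, whose final term
  vanishes because \<open>y <= ln M\<close>.\<close>

lemma sum_ramp_ge:
  assumes y: "y \<le> ln (real M)"
  shows "ramp (Suc k) y \<le> (\<Sum>m=1..M. ramp k (y - ln (real m)) / real m)"
proof -
  have step: "ramp (Suc k) (y - ln (real m)) - ramp (Suc k) (y - ln (real (Suc m)))
     \<le> ramp k (y - ln (real m)) / real m" if "m \<ge> 1" for m
  proof -
    define a where "a = max 0 (y - ln (real m) - ln 2)"
    define b where "b = max 0 (y - ln (real (Suc m)) - ln 2)"
    have ll: "ln (real (Suc m)) - ln (real m) \<le> 1 / real m"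
    proof -
      have "ln (real (Suc m)) - ln (real m) = ln (1 + 1 / real m)"
        using that by (subst ln_divide_pos[symmetric]) (auto simp: field_simps)
      also have "\<dots> \<le> 1 / real m" by (rule ln_add_one_self_le_self) auto
      finally show ?thesis .
    qed
    have "ln (real m) \<le> ln (real (Suc m))" using that by simp
    then have ab: "0 \<le> b" "b \<le> a" "a - b \<le> 1 / real m" using ll by (auto simp: a_def b_def)
    have a0: "0 \<le> a" using ab by simp
    have "a ^ Suc k - b ^ Suc k \<le> real (Suc k) * (a - b) * a ^ k"
      by (rule power_diff_le) (use ab in auto)
    also have "\<dots> \<le> real (Suc k) * (1 / real m) * a ^ k"
      using ab a0 by (intro mult_right_mono mult_left_mono) auto
    finally have "(a ^ Suc k - b ^ Suc k) / fact (Suc k) \<le> real (Suc k) * (1 / real m) * a ^ k / fact (Suc k)"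
      by (intro divide_right_mono) auto
    also have "\<dots> = a ^ k / fact k / real m"
      by (simp add: fact_Suc divide_simps del: of_nat_Suc)
    finally show ?thesis by (simp add: ramp_def a_def b_def diff_divide_distrib)
  qed
  have "(\<Sum>m=1..M. ramp (Suc k) (y - ln (real m)) - ramp (Suc k) (y - ln (real (Suc m))))
     \<le> (\<Sum>m=1..M. ramp k (y - ln (real m)) / real m)"
    by (intro sum_mono step) auto
  moreover have "(\<Sum>m=1..M. ramp (Suc k) (y - ln (real m)) - ramp (Suc k) (y - ln (real (Suc m))))
     = ramp (Suc k) (y - ln (real 1)) - ramp (Suc k) (y - ln (real (Suc M)))"
    by (induction M) auto
  moreover have "ramp (Suc k) (y - ln (real (Suc M))) = 0"
  proof -
    have "y \<le> ln (real (Suc M))"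
      using y by (cases "M = 0") (auto intro: order_trans)
    moreover have "(0::real) < ln 2" by simp
    ultimately have "max 0 (y - ln (real (Suc M)) - ln 2) = 0" by linarith
    then show ?thesis by (simp add: ramp_def)
  qed
  ultimately show ?thesis by simp
qed

lemma sum_soft_step_ge:
  assumes M: "M \<ge> 1" and y: "y \<le> ln (real M)"
  shows "ramp 1 y \<le> (\<Sum>m=1..M. soft_step (y - ln (real m)) / real m)"
proof (cases "y \<ge> 0")
  case False
  then have "y < ln 2" using ln_gt_zero[of "2::real"] by linarith
  then have "ramp 1 y = 0" by (simp add: ramp_def max_def)
  then show ?thesis by (simp add: sum_nonneg soft_step_nonneg)
next
  case True
  define x where "x = exp y"
  have x: "x \<ge> 1" "x \<le> real M"
    using True y M by (auto simp: x_def ln_ge_iff)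
  define n where "n = nat \<lfloor>x\<rfloor>"
  have n: "real n \<le> x" "x < real n + 1" "n \<ge> 1" "n \<le> M"
    using x by (auto simp: n_def le_nat_floor floor_less_iff nat_le_iff le_floor_iff floor_le_iff)
  \<comment> \<open>An antiderivative of the summand \<open>x / (t * (x + t))\<close>, normalised
    such that \<open>\<psi> x = ln (x / 2)\<close> and \<open>\<psi> 1 <= 0\<close>. The former is
    the origin of the shift \<open>ln 2\<close>.\<close>
  define \<psi> where "\<psi> = (\<lambda>t::real. ln (t * x / (x + t)))"
  have step: "\<psi> (real (Suc m)) - \<psi> (real m) \<le> soft_step (y - ln (real m)) / real m" if "m \<in> {1..n}" for m
  proof -
    have m: "1 \<le> real m" "real m \<le> x" using that n by auto
    have "ln (real m) \<le> y" using m x_def by (metis ln_exp ln_le_cancel_iff exp_gt_zero less_le_trans zero_less_one)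
    moreover have "exp (ln (real m) - y) = real m / x" using m by (simp add: x_def exp_diff)
    ultimately have ss: "soft_step (y - ln (real m)) = 1 / (1 + real m / x)"
      by (simp add: soft_step_def)
    have "\<psi> (real (Suc m)) - \<psi> (real m) =
       ln ((real (Suc m) * x / (x + real (Suc m))) / (real m * x / (x + real m)))"
      unfolding \<psi>_def using m x by (subst ln_div) auto
    also have "\<dots> = ln (1 + x / (real m * (x + real m + 1)))"
      using m x by (intro arg_cong[of _ _ ln]) (auto simp: divide_simps, auto simp: algebra_simps)
    also have "\<dots> \<le> x / (real m * (x + real m + 1))"
      using m x by (intro ln_add_one_self_le_self) auto
    also have "\<dots> \<le> x / (real m * (x + real m))"
      using m x by (intro divide_left_mono mult_left_mono mult_pos_pos) auto
    also have "\<dots> = soft_step (y - ln (real m)) / real m"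
      unfolding ss using m x by (simp add: field_simps)
    finally show ?thesis .
  qed
  have "(\<Sum>m=1..n. \<psi> (real (Suc m)) - \<psi> (real m)) \<le> (\<Sum>m=1..n. soft_step (y - ln (real m)) / real m)"
    by (intro sum_mono step) auto
  also have "\<dots> \<le> (\<Sum>m=1..M. soft_step (y - ln (real m)) / real m)"
    using n by (intro sum_mono2) (auto simp: soft_step_nonneg)
  also have "(\<Sum>m=1..n. \<psi> (real (Suc m)) - \<psi> (real m)) = \<psi> (real (Suc n)) - \<psi> (real 1)"
    using n(3) by (induction n rule: dec_induct) auto
  finally have 1: "\<psi> (real (Suc n)) - \<psi> 1 \<le> (\<Sum>m=1..M. soft_step (y - ln (real m)) / real m)" by simp
  \<comment> \<open>Since \<open>n + 1 > x\<close> and \<open>\<psi>\<close> increases, rounding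
    \<open>x\<close> down to \<open>n\<close> costs nothing.\<close>
  have "\<psi> x \<le> \<psi> (real (Suc n))"
  proof -
    have "x * x / (x + x) \<le> real (Suc n) * x / (x + real (Suc n))"
    proof -
      have "x * x \<le> x * (1 + real n)" using x n by (intro mult_left_mono) auto
      then show ?thesis using x n by (simp add: divide_simps)
    qed
    then show ?thesis unfolding \<psi>_def using x n
      by (subst ln_le_cancel_iff) (auto intro!: divide_pos_pos mult_pos_pos add_pos_pos)
  qed
  moreover have "\<psi> x = y - ln 2"
    unfolding \<psi>_def using x by (simp add: x_def ln_div)
  moreover have "\<psi> 1 \<le> 0" unfolding \<psi>_def using x by (subst ln_le_zero_iff) auto
  ultimately have "y - ln 2 \<le> (\<Sum>m=1..M. soft_step (y - ln (real m)) / real m)" using 1 by simp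
  moreover have "0 \<le> (\<Sum>m=1..M. soft_step (y - ln (real m)) / real m)"
    by (simp add: sum_nonneg soft_step_nonneg)
  ultimately show ?thesis by (simp add: ramp_def)
qed

section \<open>Convexity and the splitting into layers\<close>

lemma convex_power_nonneg: "convex_on {0::real..} (\<lambda>x. x ^ k)"
  by (cases "even k") (auto intro: convex_power_odd convex_on_subset[OF convex_power_even])

lemma convex_ramp:
  assumes "k \<ge> 1"
  shows "convex_on UNIV (ramp k)"
proof (rule convex_onI)
  fix t x y :: real assume t: "0 < t" "t < 1"
  define a b where "a = max 0 (x - ln 2)" and "b = max 0 (y - ln 2)"
  have "(1 - t) * (x - ln 2) + t * (y - ln 2) \<le> (1 - t) * a + t * b"
    using t by (intro add_mono mult_left_mono) (auto simp: a_def b_def)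
  moreover have "0 \<le> (1 - t) * a + t * b" using t by (auto simp: a_def b_def)
  ultimately have "max 0 ((1 - t) * x + t * y - ln 2) \<le> (1 - t) * a + t * b"
    by (simp add: algebra_simps)
  then have "max 0 ((1 - t) * x + t * y - ln 2) ^ k \<le> ((1 - t) * a + t * b) ^ k"
    by (intro power_mono) auto
  also have "\<dots> \<le> (1 - t) * a ^ k + t * b ^ k"
    using convex_onD[OF convex_power_nonneg, of t a b k] t by (simp add: a_def b_def)
  finally have "max 0 ((1 - t) * x + t * y - ln 2) ^ k / fact k \<le> ((1 - t) * a ^ k + t * b ^ k) / fact k"
    by (intro divide_right_mono) auto
  then show "ramp k ((1 - t) *\<^sub>R x + t *\<^sub>R y) \<le> (1 - t) * ramp k x + t * ramp k y"
    by (simp add: ramp_def a_def b_def add_divide_distrib)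
qed simp

text \<open>Jensen's inequality one variable at a time, so that only convexity between two points is
  used.\<close>

lemma bernoulli_mean_ramp_Jensen:
  assumes "\<And>p. p \<in> set ps \<Longrightarrow> 0 \<le> b p \<and> b p \<le> 1" and k: "k \<ge> 1"
  shows "ramp k (y - (\<Sum>p\<leftarrow>ps. b p * ln (real p))) \<le> bernoulli_mean ps b (ramp k) y"
  using assms(1)
proof (induction ps arbitrary: y)
  case (Cons p ps)
  have cv: "convex_on UNIV (ramp k)" by (rule convex_ramp[OF k])
  define s where "s = (\<Sum>p\<leftarrow>ps. b p * ln (real p))"
  have p: "0 \<le> b p" "b p \<le> 1" using Cons.prems by auto
  have "ramp k (y - (\<Sum>p\<leftarrow>p # ps. b p * ln (real p))) =
      ramp k ((1 - b p) * (y - s) + b p * (y - ln (real p) - s))"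
    by (simp add: s_def algebra_simps)
  also have "\<dots> \<le> (1 - b p) * ramp k (y - s) + b p * ramp k (y - ln (real p) - s)"
    using convex_onD[OF cv, of "b p" "y - s" "y - ln (real p) - s"] p by simp
  also have "\<dots> \<le> bernoulli_mean (p # ps) b (ramp k) y"
    using Cons p unfolding s_def by (auto intro!: add_mono mult_left_mono)
  finally show ?case .
qed auto

text \<open>The mean of the Bernoulli variable that remains when \<open>j\<close> geometric variables of ratio
  \<open>1 / p\<close> are split off from a Bernoulli variable of mean \<open>b\<close>.\<close>

definition excess :: "real \<Rightarrow> nat \<Rightarrow> nat \<Rightarrow> real" where
  "excess b p j = 1 - min 1 ((1 - b) / (1 - 1 / real p) ^ j)"

text \<open>Induction on the number \<open>j\<close> of layers split off. Each layer costs a factor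
  \<open>W\<close>, replaces \<open>e j\<close> by \<open>e (Suc j)\<close> and sums against
  \<open>1 / m\<close>, which turns \<open>ramp j\<close> into \<open>ramp (Suc j)\<close>; the
  first turns \<open>soft_step\<close> into \<open>ramp 1\<close>. Jensen's inequality handles the
  variables left after \<open>k\<close> layers.\<close>

lemma bernoulli_mean_soft_step_ge:
  assumes ps: "distinct ps" "\<And>p. p \<in> set ps \<Longrightarrow> prime p"
    and full: "\<And>p::nat. prime p \<Longrightarrow> p \<le> M \<Longrightarrow> p \<in> set ps"
    and b: "\<And>p. p \<in> set ps \<Longrightarrow> 0 \<le> b p \<and> b p \<le> 1"
    and M: "M \<ge> 1" and k: "k \<ge> 1"
  shows "(\<Prod>p\<leftarrow>ps. 1 - 1 / real p) ^ k
      * ramp k (ln (real M) - (\<Sum>p\<leftarrow>ps. excess (b p) p k * ln (real p)))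
    \<le> bernoulli_mean ps b soft_step (ln (real M))"
proof -
  define W where "W = (\<Prod>p\<leftarrow>ps. 1 - 1 / real p)"
  define y where "y = ln (real M)"
  define e where "e = (\<lambda>j p. excess (b p) p j)"
  have p2: "2 \<le> p" if "p \<in> set ps" for p using ps that by (simp add: prime_ge_2_nat)
  have th: "0 < 1 - 1 / real p" if "p \<in> set ps" for p using p2[OF that] by (simp add: field_simps)
  have W0: "0 \<le> W" unfolding W_def
    by (intro prod_list_nonneg) (use th in \<open>auto intro: less_imp_le\<close>)
  have e01: "0 \<le> e j p" "e j p \<le> 1" if "p \<in> set ps" for j p
    using b[OF that] th[OF that] by (auto simp: e_def excess_def min_def)
  have layer: "W * bernoulli_mean ps (e (Suc j)) (geometric_sums M ps f) y \<le> bernoulli_mean ps (e j) f y"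
    if "mono f" "\<And>x. 0 \<le> f x" for j f
    unfolding W_def
  proof (rule bernoulli_mean_layer)
    fix p assume p: "p \<in> set ps"
    define t where "t = 1 - 1 / real p"
    have t: "0 < t" "t \<le> 1" using th[OF p] by (auto simp: t_def)
    \<comment> \<open>The condition of \<open>bernoulli_mean_layer\<close> on the masses at 0,
      between levels \<open>j\<close> and \<open>j + 1\<close>. The cap at 1 keeps the means
      nonnegative and is compatible because \<open>t <= 1\<close>.\<close>
    have "min 1 ((1 - b p) / t ^ Suc j) * t \<le> min 1 ((1 - b p) / t ^ j)"
    proof (rule min.boundedI)
      have "0 \<le> min 1 ((1 - b p) / t ^ Suc j)" using b[OF p] t by simp
      then show "min 1 ((1 - b p) / t ^ Suc j) * t \<le> 1" using t by (simp add: mult_le_one)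
      have "min 1 ((1 - b p) / t ^ Suc j) * t \<le> (1 - b p) / t ^ Suc j * t"
        using t by (intro mult_right_mono) auto
      then show "min 1 ((1 - b p) / t ^ Suc j) * t \<le> (1 - b p) / t ^ j" using t by simp
    qed
    then have "(1 - e (Suc j) p) * (1 - 1 / real p) \<le> 1 - e j p"
      by (simp add: e_def excess_def t_def)
    then show "2 \<le> p \<and> 0 \<le> e j p \<and> e j p \<le> 1 \<and> 0 \<le> e (Suc j) p \<and> e (Suc j) p \<le> 1
      \<and> (1 - e (Suc j) p) * (1 - 1 / real p) \<le> 1 - e j p"
      using e01[OF p] p2[OF p] by auto
  qed (use that in auto)
  have sums: "(\<Sum>m=1..M. f (x - ln (real m)) / real m) \<le> geometric_sums M ps f x" if "\<And>x. 0 \<le> f x" for f :: "real \<Rightarrow> real" and x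
  proof -
    have "{m. m \<in> {1..M} \<and> prime_factors m \<subseteq> set ps} = {1..M}"
    proof (intro set_eqI iffI)
      fix m assume m: "m \<in> {1..M}"
      have "p \<in> set ps" if "p \<in> prime_factors m" for p
      proof (rule full)
        show "prime p" using that by auto
        have "p dvd m" using that by auto
        then have "p \<le> m" using m by (intro dvd_imp_le) auto
        then show "p \<le> M" using m by simp
      qed
      then show "m \<in> {m. m \<in> {1..M} \<and> prime_factors m \<subseteq> set ps}" using m by auto
    qed auto
    then show ?thesis using geometric_sums_ge_sum[of ps f x M] ps that by simp
  qed
  \<comment> \<open>The random shifts only lower the argument, so a comparison up to
    \<open>y = ln M\<close> is enough; this is the range in which the harmonic sums over
    \<open>m <= M\<close> are long enough.\<close>
  have mon: "bernoulli_mean ps (e j) f y \<le> bernoulli_mean ps (e j) g y" if "\<And>x. x \<le> y \<Longrightarrow> f x \<le> g x" for f g j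
  proof (rule bernoulli_mean_le)
    fix p assume "p \<in> set ps"
    then show "1 \<le> p \<and> 0 \<le> e j p \<and> e j p \<le> 1" using e01[of p j] p2[of p] by auto
  qed (rule that)
  have "W ^ j * bernoulli_mean ps (e j) (ramp j) y \<le> bernoulli_mean ps (e 0) soft_step y" if "j \<ge> 1" for j
    using that
  proof (induction j rule: dec_induct)
    case base
    have "bernoulli_mean ps (e 1) (ramp 1) y \<le> bernoulli_mean ps (e 1) (geometric_sums M ps soft_step) y"
    proof (rule mon)
      fix x assume "x \<le> y"
      then show "ramp 1 x \<le> geometric_sums M ps soft_step x"
        using sum_soft_step_ge[OF M, of x] sums[of soft_step x] soft_step_nonneg by (simp add: y_def)
    qed
    then have "W * bernoulli_mean ps (e 1) (ramp 1) y \<le> W * bernoulli_mean ps (e 1) (geometric_sums M ps soft_step) y"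
      using W0 by (rule mult_left_mono)
    also have "\<dots> \<le> bernoulli_mean ps (e 0) soft_step y"
      using layer[of soft_step 0] by (simp add: mono_soft_step soft_step_nonneg)
    finally show ?case by simp
  next
    case (step j)
    have "bernoulli_mean ps (e (Suc j)) (ramp (Suc j)) y \<le> bernoulli_mean ps (e (Suc j)) (geometric_sums M ps (ramp j)) y"
    proof (rule mon)
      fix x assume "x \<le> y"
      then show "ramp (Suc j) x \<le> geometric_sums M ps (ramp j) x"
        using sum_ramp_ge[of x M j] sums[of "ramp j" x] ramp_nonneg by (simp add: y_def)
    qed
    then have "W * bernoulli_mean ps (e (Suc j)) (ramp (Suc j)) y \<le> W * bernoulli_mean ps (e (Suc j)) (geometric_sums M ps (ramp j)) y"
      using W0 by (rule mult_left_mono)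
    also have "\<dots> \<le> bernoulli_mean ps (e j) (ramp j) y"
      by (rule layer) (auto simp: mono_ramp ramp_nonneg)
    finally have "W ^ j * (W * bernoulli_mean ps (e (Suc j)) (ramp (Suc j)) y) \<le> W ^ j * bernoulli_mean ps (e j) (ramp j) y"
      using W0 by (intro mult_left_mono) auto
    then show ?case using step by (simp add: mult_ac)
  qed
  from this[OF k] have 1: "W ^ k * bernoulli_mean ps (e k) (ramp k) y \<le> bernoulli_mean ps (e 0) soft_step y" .
  have "bernoulli_mean ps (e 0) soft_step y = bernoulli_mean ps b soft_step y"
  proof -
    have "bernoulli_mean ps' (e 0) soft_step x = bernoulli_mean ps' b soft_step x" if "set ps' \<subseteq> set ps" for ps' x
      using that
    proof (induction ps' arbitrary: x)
      case (Cons p ps')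
      have "0 \<le> b p" using b Cons.prems by auto
      then have "e 0 p = b p" by (simp add: e_def excess_def)
      then show ?case using Cons by simp
    qed auto
    then show ?thesis by simp
  qed
  moreover have "W ^ k * ramp k (y - (\<Sum>p\<leftarrow>ps. e k p * ln (real p))) \<le> W ^ k * bernoulli_mean ps (e k) (ramp k) y"
    using e01 k W0 by (intro mult_left_mono bernoulli_mean_ramp_Jensen) auto
  ultimately show ?thesis using 1 by (simp add: W_def y_def e_def)
qed

lemma bernoulli_mean_eq_sum_Pow:
  assumes "distinct ps" "\<And>p. p \<in> set ps \<Longrightarrow> p > 0"
  shows "bernoulli_mean ps b f y = (\<Sum>S\<in>Pow (set ps). (\<Prod>p\<in>S. b p) * (\<Prod>p\<in>set ps - S. 1 - b p)
      * f (y - ln (real (\<Prod>S))))"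
  using assms
proof (induction ps arbitrary: y)
  case (Cons p ps)
  define X where "X = set ps"
  have X: "finite X" "p \<notin> X" "p > 0" "\<And>q. q \<in> X \<Longrightarrow> q > 0" using Cons.prems by (auto simp: X_def)
  define t where "t = (\<lambda>X S y. (\<Prod>p\<in>S. b p) * (\<Prod>p\<in>X - S. 1 - b p) * f (y - ln (real (\<Prod>S))))"
  have IH: "bernoulli_mean ps b f y = (\<Sum>S\<in>Pow X. t X S y)" for y
    unfolding X_def t_def by (rule Cons.IH) (use Cons.prems in auto)
  have "(\<Sum>S\<in>Pow (insert p X). t (insert p X) S y) =
     (\<Sum>S\<in>Pow X. t (insert p X) S y) + (\<Sum>S\<in>Pow X. t (insert p X) (insert p S) y)"
  proof -
    have "inj_on (insert p) (Pow X)"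
    proof (rule inj_onI)
      fix S T assume "S \<in> Pow X" "T \<in> Pow X" "insert p S = insert p T"
      moreover have "p \<notin> S" "p \<notin> T" using X(2) calculation by auto
      ultimately show "S = T" by (simp add: insert_ident)
    qed
    moreover have "Pow X \<inter> insert p ` Pow X = {}" using X by auto
    ultimately show ?thesis using X
      by (simp add: Pow_insert sum.union_disjoint sum.reindex)
  qed
  also have "(\<Sum>S\<in>Pow X. t (insert p X) S y) = (\<Sum>S\<in>Pow X. (1 - b p) * t X S y)"
  proof (rule sum.cong[OF refl])
    fix S assume "S \<in> Pow X"
    then have "insert p X - S = insert p (X - S)" using X by auto
    then show "t (insert p X) S y = (1 - b p) * t X S y" using X by (simp add: t_def)
  qed
  also have "(\<Sum>S\<in>Pow X. t (insert p X) (insert p S) y) = (\<Sum>S\<in>Pow X. b p * t X S (y - ln (real p)))"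
  proof (rule sum.cong[OF refl])
    fix S assume S: "S \<in> Pow X"
    then have fS: "finite S" "p \<notin> S" using X finite_subset by auto
    have "insert p X - insert p S = X - S" using X by auto
    moreover have "real (\<Prod>S) > 0" using X S by (simp add: prod_pos subset_iff)
    then have "ln (real p * real (\<Prod>S)) = ln (real p) + ln (real (\<Prod>S))"
      using X(3) by (simp add: ln_mult_pos)
    then have "ln (real (\<Prod>(insert p S))) = ln (real p) + ln (real (\<Prod>S))"
      using fS by simp
    ultimately show "t (insert p X) (insert p S) y = b p * t X S (y - ln (real p))"
      using fS by (simp add: t_def diff_diff_eq)
  qed
  finally show ?case by (simp add: IH t_def X_def sum_distrib_left)
qed auto

section \<open>The Euler product\<close>

definition primes_upto :: "nat \<Rightarrow> nat set" where
  "primes_upto n = {p. prime p \<and> p \<le> n}"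

lemma finite_primes_upto [simp]: "finite (primes_upto n)"
  by (rule finite_subset[of _ "{..n}"]) (auto simp: primes_upto_def)

lemma prime_factors_Prod_primes:
  fixes S :: "nat set"
  assumes "finite S" "\<And>p. p \<in> S \<Longrightarrow> prime p"
  shows "prime_factorization (\<Prod>S) = mset_set S"
proof -
  have "prime_factorization (prod_mset (mset_set S)) = mset_set S"
    by (rule prime_factorization_prod_mset_primes) (use assms in auto)
  then show ?thesis by (simp add: prod_unfold_prod_mset)
qed

text \<open>Sets of primes with product at most \<open>M\<close> correspond to squarefree
  \<open>q\<close>, and \<open>soft_step\<close> discards all other sets. The identity
  \<open>b p = (1 - b p) * local_density Omega p\<close> extracts the product over all primes up to
  \<open>n\<close>. Admitting every \<open>n >= M\<close> prepares the limit.\<close>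

lemma sieve_sum_lower_bound:
  assumes Om: "\<And>p. prime p \<Longrightarrow> card (Omega p) < p"
    and N: "2 * M\<^sup>2 \<le> N" "M \<ge> 1" and n: "M \<le> n" and k: "k \<ge> 1"
  shows "(\<Prod>p\<in>primes_upto n. 1 - 1 / real p) ^ k
      * ramp k (ln (real M) - (\<Sum>p\<in>primes_upto n. excess (real (card (Omega p)) / real p) p k * ln (real p)))
    \<le> (\<Prod>p\<in>primes_upto n. 1 - real (card (Omega p)) / real p)
      * (\<Sum>q | q \<in> {1..M} \<and> squarefree q.
          sieve_density Omega q * (real N / (real N + 2 * real q * real M)))"
proof -
  define P where "P = primes_upto n"
  define ps where "ps = sorted_list_of_set P"
  define b where "b = (\<lambda>p. real (card (Omega p)) / real p)"
  have finP: "finite P" by (simp add: P_def)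
  have ps: "set ps = P" "distinct ps" using finP by (auto simp: ps_def)
  have prime: "prime p" if "p \<in> P" for p using that by (simp add: P_def primes_upto_def)
  have b: "0 \<le> b p" "b p < 1" if "p \<in> P" for p
    using Om[OF prime[OF that]] by (auto simp: b_def)
  have list: "(\<Prod>p\<leftarrow>ps. f p) = (\<Prod>p\<in>P. f p)" "(\<Sum>p\<leftarrow>ps. f p) = (\<Sum>p\<in>P. f p)" for f :: "nat \<Rightarrow> real"
    using prod.distinct_set_conv_list[OF ps(2), of f] sum_list_distinct_conv_sum_set[OF ps(2), of f] ps(1)
    by simp_all
  define F where "F = (\<lambda>q. real N / (real N + 2 * real q * real M))"
  have N0: "real N > 0" "2 * (real M)\<^sup>2 \<le> real N"
  proof -
    have "real (2 * M\<^sup>2) \<le> real N" using N(1) by (simp only: of_nat_le_iff)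
    then show "2 * (real M)\<^sup>2 \<le> real N" by simp
    have "0 < M\<^sup>2" using N(2) by simp
    then show "real N > 0" using N(1) by linarith
  qed
  have dens0: "0 \<le> (\<Prod>p\<in>S. local_density Omega p)" if "\<And>p. p \<in> S \<Longrightarrow> prime p" for S
  proof (rule prod_nonneg)
    fix p assume "p \<in> S"
    then have "card (Omega p) < p" using that Om by auto
    then show "0 \<le> local_density Omega p" by (simp add: local_density_def)
  qed
  have "(\<Prod>p\<in>P. 1 - 1 / real p) ^ k * ramp k (ln (real M) - (\<Sum>p\<in>P. excess (b p) p k * ln (real p)))
     \<le> bernoulli_mean ps b soft_step (ln (real M))"
  proof -
    have "(\<Prod>p\<leftarrow>ps. 1 - 1 / real p) ^ k
        * ramp k (ln (real M) - (\<Sum>p\<leftarrow>ps. excess (b p) p k * ln (real p)))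
      \<le> bernoulli_mean ps b soft_step (ln (real M))"
    proof (rule bernoulli_mean_soft_step_ge)
      fix p :: nat assume "prime p" "p \<le> M"
      then show "p \<in> set ps" using n unfolding ps(1) by (simp add: P_def primes_upto_def)
    next
      fix p assume "p \<in> set ps"
      then show "0 \<le> b p \<and> b p \<le> 1" using b[of p] unfolding ps(1) by (simp add: less_imp_le)
    qed (use ps prime k N(2) in auto)
    then show ?thesis unfolding list .
  qed
  also have "\<dots> = (\<Sum>S\<in>Pow P. (\<Prod>p\<in>S. b p) * (\<Prod>p\<in>P - S. 1 - b p) * soft_step (ln (real M) - ln (real (\<Prod>S))))"
    using bernoulli_mean_eq_sum_Pow[of ps b soft_step "ln (real M)"] ps prime by (simp add: prime_gt_0_nat)
  also have "\<dots> = (\<Prod>p\<in>P. 1 - b p) * (\<Sum>S\<in>Pow P. (\<Prod>p\<in>S. local_density Omega p) * soft_step (ln (real M) - ln (real (\<Prod>S))))"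
    unfolding sum_distrib_left
  proof (rule sum.cong[OF refl])
    fix S assume S: "S \<in> Pow P"
    have "b p = (1 - b p) * local_density Omega p" if "p \<in> S" for p
    proof -
      have "card (Omega p) < p" using Om prime S that by blast
      then show ?thesis by (simp add: b_def local_density_def field_simps)
    qed
    then have "(\<Prod>p\<in>S. b p) = (\<Prod>p\<in>S. 1 - b p) * (\<Prod>p\<in>S. local_density Omega p)"
      by (simp add: prod.distrib[symmetric] cong: prod.cong)
    moreover have "(\<Prod>p\<in>P. 1 - b p) = (\<Prod>p\<in>P - S. 1 - b p) * (\<Prod>p\<in>S. 1 - b p)"
      using S finP by (intro prod.subset_diff) auto
    ultimately show "(\<Prod>p\<in>S. b p) * (\<Prod>p\<in>P - S. 1 - b p) * soft_step (ln (real M) - ln (real (\<Prod>S)))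
      = (\<Prod>p\<in>P. 1 - b p) * ((\<Prod>p\<in>S. local_density Omega p) * soft_step (ln (real M) - ln (real (\<Prod>S))))"
      by (simp add: mult_ac)
  qed
  also have "\<dots> \<le> (\<Prod>p\<in>P. 1 - b p) * (\<Sum>q | q \<in> {1..M} \<and> squarefree q. sieve_density Omega q * F q)"
  proof (rule mult_left_mono)
    show "0 \<le> (\<Prod>p\<in>P. 1 - b p)" using b by (intro prod_nonneg) (auto simp: less_imp_le)
    define U where "U = {S \<in> Pow P. \<Prod>S \<le> M}"
    have U: "finite S" "\<And>p. p \<in> S \<Longrightarrow> prime p" "\<Prod>S > 0" "\<Prod>S \<le> M" if "S \<in> U" for S
    proof -
      show "finite S" using that finP finite_subset by (auto simp: U_def)
      show pr: "prime p" if "p \<in> S" for p using that \<open>S \<in> U\<close> prime by (auto simp: U_def)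
      show "\<Prod>S > 0" using pr by (intro prod_pos) (auto simp: prime_gt_0_nat)
      show "\<Prod>S \<le> M" using that by (simp add: U_def)
    qed
    have pf: "prime_factorization (\<Prod>S) = mset_set S" if "S \<in> U" for S
      using U[OF that] by (intro prime_factors_Prod_primes) auto
    have "(\<Sum>S\<in>Pow P. (\<Prod>p\<in>S. local_density Omega p) * soft_step (ln (real M) - ln (real (\<Prod>S))))
       = (\<Sum>S\<in>U. (\<Prod>p\<in>S. local_density Omega p) * soft_step (ln (real M) - ln (real (\<Prod>S))))"
    proof (rule sum.mono_neutral_right)
      show "\<forall>S\<in>Pow P - U. (\<Prod>p\<in>S. local_density Omega p) * soft_step (ln (real M) - ln (real (\<Prod>S))) = 0"
      proof
        fix S assume "S \<in> Pow P - U"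
        then have "real M < real (\<Prod>S)" by (simp only: U_def of_nat_less_iff) auto
        then have "ln (real M) < ln (real (\<Prod>S))" using N(2) by simp
        then show "(\<Prod>p\<in>S. local_density Omega p) * soft_step (ln (real M) - ln (real (\<Prod>S))) = 0"
          by (simp add: soft_step_def)
      qed
    qed (use finP in \<open>auto simp: U_def\<close>)
    also have "\<dots> \<le> (\<Sum>S\<in>U. sieve_density Omega (\<Prod>S) * F (\<Prod>S))"
    proof (rule sum_mono)
      fix S assume S: "S \<in> U"
      define q where "q = \<Prod>S"
      have q: "q > 0" "q \<le> M" using U[OF S] by (auto simp: q_def)
      have "soft_step (ln (real M) - ln (real q)) = 1 / (1 + real q / real M)"
      proof -
        have "exp (ln (real q) - ln (real M)) = real q / real M" using q by (simp add: exp_diff)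
        then show ?thesis using q by (simp add: soft_step_def)
      qed
      \<comment> \<open>Here \<open>2 * M^2 <= N\<close> enters, in the form
        \<open>2 q M / N <= q / M\<close>.\<close>
      also have "\<dots> \<le> 1 / (1 + 2 * real q * real M / real N)"
      proof (rule divide_left_mono)
        have "2 * real q * real M * real M \<le> real q * real N"
          using mult_left_mono[OF N0(2), of "real q"] by (simp add: power2_eq_square mult_ac)
        then show "1 + 2 * real q * real M / real N \<le> 1 + real q / real M"
          using N0 q by (simp add: field_simps)
      qed (use N0 q in \<open>auto intro!: mult_pos_pos add_pos_nonneg\<close>)
      also have "\<dots> = F q" using N0 by (simp add: F_def field_simps)
      finally have "soft_step (ln (real M) - ln (real q)) \<le> F q" .
      moreover have "sieve_density Omega q = (\<Prod>p\<in>S. local_density Omega p)"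
        using U(1)[OF S] by (simp add: sieve_density_def q_def pf[OF S])
      ultimately show "(\<Prod>p\<in>S. local_density Omega p) * soft_step (ln (real M) - ln (real (\<Prod>S)))
         \<le> sieve_density Omega (\<Prod>S) * F (\<Prod>S)"
        using dens0[of S] U(2)[OF S] by (auto simp: q_def[symmetric] intro!: mult_left_mono)
    qed
    also have "\<dots> = (\<Sum>q\<in>Prod ` U. sieve_density Omega q * F q)"
    proof (subst sum.reindex)
      show "inj_on Prod U"
      proof (rule inj_onI)
        fix S T assume "S \<in> U" "T \<in> U" "\<Prod>S = \<Prod>T"
        then show "S = T" using pf[of S] pf[of T] U(1) by (metis finite_set_mset_mset_set)
      qed
    qed simp
    also have "\<dots> \<le> (\<Sum>q | q \<in> {1..M} \<and> squarefree q. sieve_density Omega q * F q)"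
    proof (rule sum_mono2)
      show "Prod ` U \<subseteq> {q. q \<in> {1..M} \<and> squarefree q}"
      proof (rule image_subsetI)
        fix S assume S: "S \<in> U"
        have "squarefree (\<Prod>S)"
        proof -
          have "multiplicity p (\<Prod>S) \<le> 1" if "prime p" for p
          proof -
            have "multiplicity p (\<Prod>S) = count (mset_set S) p"
              using that by (simp add: pf[OF S, symmetric] count_prime_factorization)
            then show ?thesis by (simp add: count_mset_set')
          qed
          then show ?thesis using U(3)[OF S] by (simp add: squarefree_factorial_semiring'')
        qed
        then show "\<Prod>S \<in> {q. q \<in> {1..M} \<and> squarefree q}" using U(3,4)[OF S] by (simp add: Suc_le_eq)
      qed
      fix q
      show "0 \<le> sieve_density Omega q * F q"
        unfolding sieve_density_def F_def using N0 by (intro mult_nonneg_nonneg dens0) auto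
    qed simp
    finally show "(\<Sum>S\<in>Pow P. (\<Prod>p\<in>S. local_density Omega p) * soft_step (ln (real M) - ln (real (\<Prod>S))))
       \<le> (\<Sum>q | q \<in> {1..M} \<and> squarefree q. sieve_density Omega q * F q)" .
  qed
  finally show ?thesis by (simp add: P_def b_def F_def)
qed

section \<open>Local factors and the size of the excess\<close>

lemma one_plus_le_inverse_power:
  fixes p :: nat
  assumes "p \<ge> 2"
  shows "1 + real k / real p \<le> inverse ((1 - 1 / real p) ^ k)"
proof -
  have p: "0 < 1 - 1 / real p" using assms by simp
  have "1 + real k * (1 / real p) \<le> (1 + 1 / real p) ^ k"
    by (rule Bernoulli_inequality) (use assms in \<open>auto intro: order_trans[of _ 0]\<close>)
  also have "\<dots> \<le> (inverse (1 - 1 / real p)) ^ k"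
  proof (rule power_mono)
    have "(1 + 1 / real p) * (1 - 1 / real p) \<le> 1" by (simp add: algebra_simps)
    then show "1 + 1 / real p \<le> inverse (1 - 1 / real p)"
      using p by (simp add: field_simps)
  qed simp
  finally show ?thesis by (simp add: power_inverse)
qed

text \<open>\<open>1 - k^2 / p^2\<close> factors as \<open>(1 - k / p) * (1 + k / p)\<close>, and
  the second factor is at most \<open>(1 - 1 / p)^(-k)\<close>. Admitting any \<open>w <= k\<close>
  makes the bound on the excess uniform over exceptional primes; with \<open>w = k\<close> the two
  bounds give convergence of the Euler product.\<close>

lemma local_factor_bounds:
  assumes p: "p \<ge> 2" and w: "w \<le> real k" "real k < real p"
  shows "1 - (real k)\<^sup>2 / (real p)\<^sup>2 \<le> (1 - w / real p) / (1 - 1 / real p) ^ k"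
    and "(1 - real k / real p) / (1 - 1 / real p) ^ k \<le> 1"
proof -
  have th: "0 < (1 - 1 / real p) ^ k" using p by simp
  have "1 - (real k)\<^sup>2 / (real p)\<^sup>2 = (1 - real k / real p) * (1 + real k / real p)"
    by (simp add: power2_eq_square algebra_simps)
  also have "\<dots> \<le> (1 - real k / real p) * inverse ((1 - 1 / real p) ^ k)"
    using one_plus_le_inverse_power[OF p, of k] w p by (intro mult_left_mono) auto
  also have "\<dots> \<le> (1 - w / real p) * inverse ((1 - 1 / real p) ^ k)"
    using w p th by (intro mult_right_mono) (auto simp: divide_right_mono)
  finally show "1 - (real k)\<^sup>2 / (real p)\<^sup>2 \<le> (1 - w / real p) / (1 - 1 / real p) ^ k"
    by (simp add: divide_inverse)
  have "1 + real k * (- 1 / real p) \<le> (1 + (- 1 / real p)) ^ k"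
    by (rule Bernoulli_inequality) (use p in auto)
  then show "(1 - real k / real p) / (1 - 1 / real p) ^ k \<le> 1"
    using th by simp
qed

lemma excess_le_1: "0 \<le> b \<Longrightarrow> b \<le> 1 \<Longrightarrow> p \<ge> 2 \<Longrightarrow> excess b p k \<le> 1"
  by (simp add: excess_def)

lemma excess_le:
  assumes "c \<le> (1 - b) / (1 - 1 / real p) ^ k" "c \<le> 1"
  shows "excess b p k \<le> 1 - c"
  using assms by (simp add: excess_def)

text \<open>The right-hand side is the integral of \<open>ln t / t^2\<close> over
  \<open>[m - s, m]\<close>. The last hypothesis absorbs the error of
  \<open>ln m - ln (m - s) <= s / (m - s)\<close>. Step length 1 serves all integers, step length 2
  the odd ones.\<close>

lemma ln_over_square_le_telescope:
  fixes m s :: real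
  assumes "0 < s" "s < m" "m / (m - s) \<le> ln m"
  shows "s * ln m / m\<^sup>2 \<le> (ln (m - s) + 1) / (m - s) - (ln m + 1) / m"
proof -
  have m: "0 < m" "0 < m - s" using assms by auto
  have "ln m - ln (m - s) \<le> s / (m - s)"
  proof -
    have "ln m - ln (m - s) = ln (1 + s / (m - s))"
      using m by (subst ln_divide_pos[symmetric]) (auto simp: field_simps)
    also have "\<dots> \<le> s / (m - s)" using m assms by (intro ln_add_one_self_le_self) auto
    finally show ?thesis .
  qed
  then have "s * ln m - s * (s / (m - s)) \<le> s * ln m + s - m * (ln m - ln (m - s))"
  proof -
    assume "ln m - ln (m - s) \<le> s / (m - s)"
    then have "m * (ln m - ln (m - s)) \<le> m * (s / (m - s))" using m by (intro mult_left_mono) auto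
    also have "\<dots> = s + s * (s / (m - s))" using m by (simp add: field_simps)
    finally show ?thesis by simp
  qed
  also have "\<dots> = ((ln (m - s) + 1) / (m - s) - (ln m + 1) / m) * (m * (m - s))"
    using m by (simp add: field_simps)
  finally have 1: "(s * ln m - s * (s / (m - s))) / (m * (m - s)) \<le> (ln (m - s) + 1) / (m - s) - (ln m + 1) / m"
    using m by (simp add: pos_divide_le_eq)
  have "s * (m / (m - s)) \<le> s * ln m" using assms by (intro mult_left_mono) auto
  then have "(s * ln m) * (m - s) \<le> m * (s * ln m - s * (s / (m - s)))"
  proof -
    assume *: "s * (m / (m - s)) \<le> s * ln m"
    have "s * (s * (m / (m - s))) \<le> s * (s * ln m)" using * assms by (intro mult_left_mono) auto
    then show ?thesis by (simp add: algebra_simps)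
  qed
  then have "s * ln m / m\<^sup>2 \<le> (s * ln m - s * (s / (m - s))) / (m * (m - s))"
    using m by (simp add: divide_simps power2_eq_square mult_ac split: if_splits)
  then show ?thesis using 1 by linarith
qed

lemma quotient_le_ln: "m / (m - 1) \<le> ln m" if "m \<ge> (4::real)"
proof -
  have "m / (m - 1) \<le> 4 / 3" using that by (simp add: field_simps)
  also have "4 / 3 \<le> 2 * ln (2::real)"
    using ln_approx_bounds[of 2 1] by (simp add: eval_nat_numeral)
  also have "\<dots> = ln (4::real)" using ln_realpow[of 2 2] by simp
  also have "\<dots> \<le> ln m" using that by simp
  finally show ?thesis .
qed

lemma ln_ge_1: "k \<ge> 3 \<Longrightarrow> 1 \<le> ln (real k)"
  using e_less_272 by (subst ln_ge_iff) auto

text \<open>Up to \<open>k\<close> the excess is at most 1, and charging \<open>ln k\<close> to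
  every integer costs \<open>k * ln k\<close>. Beyond \<open>k\<close> it is at most
  \<open>k^2 / p^2\<close>, and telescoping over all integers costs at most
  \<open>k * ln k + k\<close>. As \<open>ln k >= 1\<close>, the total is at most
  \<open>3 * k * ln k\<close>.\<close>

lemma sum_excess_le:
  assumes k: "k \<ge> 3" and Om: "\<And>p. prime p \<Longrightarrow> card (Omega p) < p" "\<And>p. prime p \<Longrightarrow> card (Omega p) \<le> k"
  shows "(\<Sum>p\<in>primes_upto n. excess (real (card (Omega p)) / real p) p k * ln (real p)) \<le> 3 * real k * ln (real k)"
proof -
  define G where "G = (\<lambda>t::real. (ln t + 1) / t)"
  define e where "e = (\<lambda>p. excess (real (card (Omega p)) / real p) p k)"
  define u where "u = (\<lambda>m. if m \<le> k then ln (real k) else (real k)\<^sup>2 * (G (real m - 1) - G (real m)))"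
  have k0: "0 < real k" using k by simp
  have Gm: "ln m / m\<^sup>2 \<le> G (m - 1) - G m" if "m \<ge> 4" for m
    using ln_over_square_le_telescope[of 1 m] quotient_le_ln[OF that] that by (simp add: G_def)
  have u0: "0 \<le> u m" for m
  proof (cases "m \<le> k")
    case False
    then have "real m \<ge> 4" using k by simp
    then have "0 \<le> G (real m - 1) - G (real m)"
      using Gm[of "real m"] by (smt (verit) divide_nonneg_nonneg ln_ge_zero zero_le_power2)
    then show ?thesis using False by (simp add: u_def)
  qed (use k in \<open>simp add: u_def\<close>)
  have "(\<Sum>p\<in>primes_upto n. e p * ln (real p)) \<le> (\<Sum>p\<in>primes_upto n. u p)"
  proof (rule sum_mono)
    fix p assume "p \<in> primes_upto n"
    then have pp: "prime p" by (simp add: primes_upto_def)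
    then have p2: "p \<ge> 2" by (rule prime_ge_2_nat)
    then have l: "0 \<le> ln (real p)" by simp
    show "e p * ln (real p) \<le> u p"
    proof (cases "p \<le> k")
      case True
      have "e p \<le> 1" unfolding e_def using Om(1)[OF pp] p2 by (intro excess_le_1) auto
      then have "e p * ln (real p) \<le> 1 * ln (real k)"
        using True p2 l by (intro mult_mono) auto
      then show ?thesis using True by (simp add: u_def)
    next
      case False
      have "e p \<le> 1 - (1 - (real k)\<^sup>2 / (real p)\<^sup>2)"
        unfolding e_def using local_factor_bounds(1)[OF p2, of "real (card (Omega p))" k] Om(2)[OF pp] False
        by (intro excess_le) auto
      then have "e p * ln (real p) \<le> (real k)\<^sup>2 / (real p)\<^sup>2 * ln (real p)"
        using l by (intro mult_right_mono) auto
      also have "\<dots> = (real k)\<^sup>2 * (ln (real p) / (real p)\<^sup>2)" by simp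
      also have "\<dots> \<le> (real k)\<^sup>2 * (G (real p - 1) - G (real p))"
        using Gm[of "real p"] False k by (intro mult_left_mono) auto
      finally show ?thesis using False by (simp add: u_def)
    qed
  qed
  also have "\<dots> \<le> (\<Sum>m=1..k + n. u m)"
    by (rule sum_mono2) (auto simp: u0 primes_upto_def Suc_le_eq prime_gt_0_nat)
  also have "\<dots> = (\<Sum>m=1..k. u m) + (\<Sum>m=k+1..k + n. u m)"
    by (subst sum.ub_add_nat) auto
  also have "(\<Sum>m=1..k. u m) = real k * ln (real k)" by (simp add: u_def)
  also have "(\<Sum>m=k+1..k + n. u m) = (real k)\<^sup>2 * (G (real k) - G (real (k + n)))"
    by (induction n) (auto simp: u_def algebra_simps)
  also have "\<dots> \<le> (real k)\<^sup>2 * G (real k)"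
    using k by (intro mult_left_mono) (auto simp: G_def)
  also have "(real k)\<^sup>2 * G (real k) = real k * ln (real k) + real k * 1"
    using k by (simp add: G_def power2_eq_square field_simps)
  also have "\<dots> \<le> real k * ln (real k) + real k * ln (real k)"
    using ln_ge_1[OF k] by (intro add_left_mono mult_left_mono) auto
  finally show ?thesis by (simp add: e_def)
qed

section \<open>Convergence of the Euler product\<close>

lemma sieve_prod_LIMSEQ:
  assumes P0: "finite P0" and C1: "\<And>p. prime p \<Longrightarrow> p \<notin> P0 \<Longrightarrow> card (Omega p) = k"
    and C2: "\<And>p. prime p \<Longrightarrow> card (Omega p) < p"
  shows "(\<lambda>n. (\<Prod>p\<in>primes_upto n. 1 - real (card (Omega p)) / real p)
      / (\<Prod>p\<in>primes_upto n. 1 - 1 / real p) ^ k) \<longlonglongrightarrow> sieve_prod Omega k"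
proof -
  define f where "f = (\<lambda>p. if prime p
            then (1 - real (card (Omega p)) / real p) * (1 - 1 / real p) powi (- int k) else 1)"
  have f_prime: "f p = (1 - real (card (Omega p)) / real p) / (1 - 1 / real p) ^ k" if "prime p" for p
    using that by (simp add: f_def power_int_minus divide_inverse)
  have fpos: "f p > 0" for p
  proof (cases "prime p")
    case True
    then have "p \<ge> 2" by (rule prime_ge_2_nat)
    then show ?thesis using C2[OF True] by (simp add: f_prime[OF True])
  qed (simp add: f_def)
  \<comment> \<open>Outside the finite set \<open>P0\<close> the factors are
    \<open>1 + O(k^2 / p^2)\<close>. Together with the absence of zero factors this gives
    convergence, which ties \<open>prodinf\<close> to the partial products.\<close>
  have "summable (\<lambda>p. \<bar>f p - 1\<bar>)"
  proof (rule summable_comparison_test_ev)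
    show "summable (\<lambda>p. (real k)\<^sup>2 * inverse ((real p)\<^sup>2))"
      by (intro summable_mult inverse_power_summable) auto
    obtain B where B: "\<And>p. p \<in> P0 \<Longrightarrow> p \<le> B" using P0 by (meson finite_nat_set_iff_bounded_le)
    show "\<forall>\<^sub>F p in sequentially. norm \<bar>f p - 1\<bar> \<le> (real k)\<^sup>2 * inverse ((real p)\<^sup>2)"
    proof (rule eventually_sequentiallyI[of "B + 1"])
      fix p assume "B + 1 \<le> p"
      then have p: "p \<notin> P0" using B by fastforce
      show "norm \<bar>f p - 1\<bar> \<le> (real k)\<^sup>2 * inverse ((real p)\<^sup>2)"
      proof (cases "prime p")
        case True
        then have "p \<ge> 2" by (rule prime_ge_2_nat)
        then show ?thesis
          using local_factor_bounds[of p "real k" k] C1[OF True p] C2[OF True]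
          by (simp add: f_prime[OF True] divide_inverse)
      qed (simp add: f_def)
    qed
  qed
  moreover have "f p - 1 \<noteq> - 1" for p using fpos[of p] by simp
  ultimately have "convergent_prod (\<lambda>p. 1 + (f p - 1))"
    by (rule summable_imp_convergent_prod_real)
  then have "(\<lambda>n. \<Prod>p\<le>n. f p) \<longlonglongrightarrow> prodinf f"
    by (intro convergent_prod_LIMSEQ) simp
  moreover have "prodinf f = sieve_prod Omega k"
    by (simp add: sieve_prod_def f_def)
  moreover have "(\<Prod>p\<le>n. f p) = (\<Prod>p\<in>primes_upto n. 1 - real (card (Omega p)) / real p)
      / (\<Prod>p\<in>primes_upto n. 1 - 1 / real p) ^ k" for n
  proof -
    have "(\<Prod>p\<le>n. f p) = (\<Prod>p\<in>primes_upto n. (1 - real (card (Omega p)) / real p) / (1 - 1 / real p) ^ k)"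
      by (rule prod.mono_neutral_cong_right) (auto simp: primes_upto_def f_prime, meson f_def)
    then show ?thesis by (simp add: prod_dividef prod_power_distrib)
  qed
  ultimately show ?thesis by simp
qed

text \<open>\<open>L\<close> does not depend on \<open>n\<close>, so
  \<open>l^k / k! <= V n * L\<close> passes to the limit and yields the infinite product, including
  its positivity. Combined with \<open>card S * L <= N\<close> this eliminates
  \<open>L\<close>.\<close>

lemma sifting_fun_bound:
  assumes A: "A \<subseteq> {1..N}" and Om: "\<And>p. prime p \<Longrightarrow> Omega p \<subseteq> {0..<p}"
    and k: "k \<ge> 1" and P0: "finite P0" and C1: "\<And>p. prime p \<Longrightarrow> p \<notin> P0 \<Longrightarrow> card (Omega p) = k"
    and C2: "\<And>p. prime p \<Longrightarrow> card (Omega p) < p"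
    and M: "2 * M\<^sup>2 \<le> N" "M \<ge> 1"
    and c: "\<And>n. (\<Sum>p\<in>primes_upto n. excess (real (card (Omega p)) / real p) p k * ln (real p)) \<le> c"
    and l: "ln (real M) - ln 2 - c > 0"
  shows "sieve_prod Omega k > 0"
    and "real (sifting_fun A Omega (sqrt (2 / 3 * real N))) * (ln (real M) - ln 2 - c) ^ k
      \<le> fact k * sieve_prod Omega k * real N"
proof -
  define V where "V = (\<lambda>n. (\<Prod>p\<in>primes_upto n. 1 - real (card (Omega p)) / real p)
      / (\<Prod>p\<in>primes_upto n. 1 - 1 / real p) ^ k)"
  define L where "L = (\<Sum>q | q \<in> {1..M} \<and> squarefree q.
          sieve_density Omega q * (real N / (real N + 2 * real q * real M)))"
  define l where "l = ln (real M) - ln 2 - c"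
  have l0: "l > 0" using assms(10) by (simp add: l_def)
  have low: "l ^ k / fact k \<le> V n * L" if "n \<ge> M" for n
  proof -
    define W where "W = (\<Prod>p\<in>primes_upto n. 1 - 1 / real p) ^ k"
    have "(\<Prod>p\<in>primes_upto n. 1 - 1 / real p) > 0"
    proof (rule prod_pos)
      fix p assume "p \<in> primes_upto n"
      then have "p \<ge> 2" by (auto simp: primes_upto_def prime_ge_2_nat)
      then show "0 < 1 - 1 / real p" by simp
    qed
    then have W: "W > 0" by (simp add: W_def)
    have "l ^ k / fact k \<le> ramp k (ln (real M) - (\<Sum>p\<in>primes_upto n. excess (real (card (Omega p)) / real p) p k * ln (real p)))"
      unfolding ramp_def using c[of n] l0 by (intro divide_right_mono power_mono) (auto simp: l_def)
    then have "W * (l ^ k / fact k) \<le> W * ramp k (ln (real M) - (\<Sum>p\<in>primes_upto n. excess (real (card (Omega p)) / real p) p k * ln (real p)))"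
      using W by (intro mult_left_mono) auto
    also have "\<dots> \<le> (\<Prod>p\<in>primes_upto n. 1 - real (card (Omega p)) / real p) * L"
      unfolding W_def L_def by (rule sieve_sum_lower_bound) (use C2 M that k in auto)
    finally show ?thesis using W by (simp add: V_def W_def[symmetric] field_simps)
  qed
  have "(\<lambda>n. V n * L) \<longlonglongrightarrow> sieve_prod Omega k * L"
    unfolding V_def by (intro tendsto_mult tendsto_const sieve_prod_LIMSEQ[OF P0]) (use C1 C2 in auto)
  then have VL: "l ^ k / fact k \<le> sieve_prod Omega k * L"
    by (rule LIMSEQ_le_const) (use low in blast)
  have L0: "0 \<le> L"
    unfolding L_def sieve_density_def local_density_def
  proof (intro sum_nonneg mult_nonneg_nonneg prod_nonneg)
    fix q p :: nat assume "p \<in> prime_factors q"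
    then have "card (Omega p) < p" by (intro C2) auto
    then show "0 \<le> real (card (Omega p)) / (real p - real (card (Omega p)))" by simp
  qed auto
  have "0 < sieve_prod Omega k * L" using VL l0 by (smt (verit) divide_pos_pos fact_gt_zero zero_less_power)
  then show V0: "sieve_prod Omega k > 0" using L0 by (simp add: zero_less_mult_iff)
  define S where "S = {a \<in> A. \<forall>p. prime p \<and> real p \<le> sqrt (2 / 3 * real N) \<longrightarrow> a mod p \<notin> Omega p}"
  have NM: "2 * (real M)\<^sup>2 \<le> real N"
  proof -
    have "real (2 * M\<^sup>2) \<le> real N" using M(1) by (simp only: of_nat_le_iff)
    then show ?thesis by simp
  qed
  \<comment> \<open>Sifting by all primes up to \<open>sqrt (2 N / 3)\<close> includes those up to
    \<open>M\<close>, since \<open>M^2 <= N / 2\<close>.\<close>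
  have "real M \<le> sqrt (2 / 3 * real N)" using NM by (intro real_le_rsqrt) simp
  moreover have "N \<ge> 1" using M by (metis One_nat_def Suc_leI le_zero_eq mult_is_0 neq0_conv not_one_le_zero numeral_2_eq_2 old.nat.distinct(1) power_eq_0_iff)
  ultimately have "real (card S) * L \<le> real N"
    unfolding L_def using Om C2 M A
    by (intro weighted_sieve_bound) (auto simp: S_def)
  then have "real (card S) * l ^ k \<le> fact k * sieve_prod Omega k * real N"
  proof -
    assume SL: "real (card S) * L \<le> real N"
    have "real (card S) * l ^ k = fact k * (real (card S) * (l ^ k / fact k))" by simp
    also have "\<dots> \<le> fact k * (real (card S) * (sieve_prod Omega k * L))"
      using VL by (intro mult_left_mono) auto
    also have "\<dots> = fact k * sieve_prod Omega k * (real (card S) * L)" by (simp add: mult_ac)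
    also have "\<dots> \<le> fact k * sieve_prod Omega k * real N"
      using SL V0 by (intro mult_left_mono) auto
    finally show ?thesis .
  qed
  then show "real (sifting_fun A Omega (sqrt (2 / 3 * real N))) * (ln (real M) - ln 2 - c) ^ k
      \<le> fact k * sieve_prod Omega k * real N"
    by (simp add: sifting_fun_def S_def l_def)
qed

section \<open>Numerical estimates\<close>

text \<open>Certifies a rational bound for a binary logarithm by comparing two integers, so that
  \<open>ln 2\<close> is the only transcendental number left to estimate.\<close>

lemma ln_le_ratio_ln_2:
  fixes p a b :: nat
  assumes "p > 0" "b > 0" "p ^ b \<le> 2 ^ a"
  shows "ln (real p) \<le> real a / real b * ln 2"
proof -
  have "real (p ^ b) \<le> real (2 ^ a)" using assms(3) by (simp only: of_nat_le_iff)
  then have "ln (real p ^ b) \<le> ln (2 ^ a)" using assms(1) by simp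
  then have "real b * ln (real p) \<le> real a * ln 2"
    using assms(1) by (simp add: ln_realpow)
  then show ?thesis using assms(2) by (simp add: field_simps)
qed

lemma ln_ge_ratio_ln_2:
  fixes p a b :: nat
  assumes "p > 0" "b > 0" "2 ^ a \<le> p ^ b"
  shows "real a / real b * ln 2 \<le> ln (real p)"
proof -
  have "real (2 ^ a) \<le> real (p ^ b)" using assms(3) by (simp only: of_nat_le_iff)
  then have "ln (2 ^ a) \<le> ln (real p ^ b)" using assms(1) by simp
  then have "real a * ln 2 \<le> real b * ln (real p)"
    using assms(1) by (simp add: ln_realpow)
  then show ?thesis using assms(2) by (simp add: field_simps)
qed

lemma ln_2_bounds: "693 / 1000 < ln (2::real)" "ln (2::real) < 6932 / 10000"
  using ln_approx_bounds[of 2 3] by (auto simp: eval_nat_numeral)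

section \<open>The shift for kappa = 3\<close>

definition small_primes :: "nat list" where
  "small_primes = [5, 7, 11, 13, 17, 19, 23, 29, 31, 37, 41, 43, 47, 53, 59, 61, 67, 71, 73, 79, 83, 89, 97]"

lemma prime_less_101_cases:
  assumes "prime p" "p \<ge> 5" "p < 101"
  shows "p \<in> set small_primes"
proof -
  \<comment> \<open>A composite number below 121 has a prime divisor among 2, 3, 5 and 7; the finite
    list is checked by evaluation.\<close>
  have *: "\<forall>p\<in>set [5..<101]. p \<in> set small_primes \<or> (\<exists>d\<in>set [2,3,5,7]. d dvd p \<and> d \<noteq> p)"
    by code_simp
  have "\<not> (d dvd p \<and> d \<noteq> p)" if "d \<in> set [2,3,5,7]" for d
    using assms(1) that by (auto simp: prime_nat_iff)
  moreover have "p \<in> set small_primes \<or> (\<exists>d\<in>set [2,3,5,7]. d dvd p \<and> d \<noteq> p)"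
  proof (rule bspec[OF *])
    show "p \<in> set [5..<101]" using assms by (simp only: set_upt atLeastLessThan_iff)
  qed
  ultimately show ?thesis by blast
qed

text \<open>The closed form of \<open>1 - (1 - 3 / p) / (1 - 1 / p)^3\<close>, the largest possible
  excess at a prime \<open>p >= 5\<close> when \<open>kappa = 3\<close>.\<close>

definition excess3 :: "nat \<Rightarrow> real" where
  "excess3 p = (3 * real p - 1) / (real p - 1) ^ 3"

lemma sum_small_primes: "(\<Sum>p\<in>set small_primes. excess3 p * ln (real p)) \<le> 0.8295"
proof -
  note ln_le = ln_le_ratio_ln_2
  \<comment> \<open>The fractions approximate binary logarithms from above, more finely for the
    smallest primes, whose terms dominate.\<close>
  have "ln 5 \<le> 72 / 31 * ln (2::real)" "ln 7 \<le> 73 / 26 * ln (2::real)" "ln 11 \<le> 128 / 37 * ln (2::real)" "ln 13 \<le> 137 / 37 * ln (2::real)" "ln 17 \<le> 45 / 11 * ln (2::real)" "ln 19 \<le> 17 / 4 * ln (2::real)" "ln 23 \<le> 50 / 11 * ln (2::real)" "ln 29 \<le> 39 / 8 * ln (2::real)" "ln 31 \<le> 5 * ln (2::real)" "ln 37 \<le> 47 / 9 * ln (2::real)" "ln 41 \<le> 59 / 11 * ln (2::real)" "ln 43 \<le> 38 / 7 * ln (2::real)" "ln 47 \<le> 50 / 9 * ln (2::real)" "ln 53 \<le> 23 / 4 * ln (2::real)" "ln 59 \<le> 53 / 9 * ln (2::real)" "ln 61 \<le> 6 * ln (2::real)" "ln 67 \<le> 73 / 12 * ln (2::real)" "ln 71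 \<le> 37 / 6 * ln (2::real)" "ln 73 \<le> 31 / 5 * ln (2::real)" "ln 79 \<le> 19 / 3 * ln (2::real)" "ln 83 \<le> 32 / 5 * ln (2::real)" "ln 89 \<le> 13 / 2 * ln (2::real)" "ln 97 \<le> 33 / 5 * ln (2::real)"
    using ln_le[of 5 31 72]
      ln_le[of 7 26 73]
      ln_le[of 11 37 128]
      ln_le[of 13 37 137]
      ln_le[of 17 11 45]
      ln_le[of 19 4 17]
      ln_le[of 23 11 50]
      ln_le[of 29 8 39]
      ln_le[of 31 1 5]
      ln_le[of 37 9 47]
      ln_le[of 41 11 59]
      ln_le[of 43 7 38]
      ln_le[of 47 9 50]
      ln_le[of 53 4 23]
      ln_le[of 59 9 53]
      ln_le[of 61 1 6]
      ln_le[of 67 12 73]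
      ln_le[of 71 6 37]
      ln_le[of 73 5 31]
      ln_le[of 79 3 19]
      ln_le[of 83 5 32]
      ln_le[of 89 2 13]
      ln_le[of 97 5 33]
    by simp_all
  then have "(\<Sum>p\<in>set small_primes. excess3 p * ln (real p)) \<le> (14 / 64 * (72 / 31) + 20 / 216 * (73 / 26) + 32 / 1000 * (128 / 37) + 38 / 1728 * (137 / 37) + 50 / 4096 * (45 / 11) + 56 / 5832 * (17 / 4) + 68 / 10648 * (50 / 11) + 86 / 21952 * (39 / 8) + 92 / 27000 * (5 / 1) + 110 / 46656 * (47 / 9) + 122 / 64000 * (59 / 11) + 128 / 74088 * (38 / 7) + 140 / 97336 * (50 / 9) + 158 / 140608 * (23 / 4) + 176 / 195112 * (53 / 9) + 182 / 216000 * (6 / 1) + 200 / 287496 * (73 / 12) + 212 / 343000 * (37 / 6) + 218 / 373248 * (31 / 5) + 236 / 474552 * (19 / 3) + 248 / 551368 * (32 / 5) + 266 / 681472 * (13 / 2) + 290 / 884736 * (33 / 5)) * ln 2"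
    unfolding small_primes_def excess3_def by simp
  also have "\<dots> \<le> 0.8295" using ln_2_bounds by simp
  finally show ?thesis .
qed

text \<open>\<open>1.55\<close> is half of \<open>3.1\<close>, and \<open>3.1 / m^2\<close> leaves
  room over the leading term \<open>3 / m^2\<close> for the lower order terms from 101 on. Step
  length 2 fits a sum over odd numbers, which halves the tail.\<close>

lemma excess3_mult_ln_le:
  fixes m :: nat
  assumes m: "m \<ge> 101"
  shows "excess3 m * ln (real m) \<le> 1.55 * ((ln (real m - 2) + 1) / (real m - 2) - (ln (real m) + 1) / real m)"
proof -
  have "excess3 m \<le> 3.1 / (real m)\<^sup>2"
  proof -
    \<comment> \<open>Expanded at the left end 101, the difference of the two cubics has only
      nonnegative coefficients.\<close>
    define u where "u = real m - 101"
    have u: "0 \<le> u" "real m = 101 + u" using m by (auto simp: u_def)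
    have "3.1 * (100 + u) ^ 3 = (3 * (101 + u) - 1) * (101 + u)\<^sup>2 + (19298 + 1393 * u + 22 * u\<^sup>2 + 0.1 * u ^ 3)"
      by (simp add: power2_eq_square power3_eq_cube algebra_simps)
    then have "(3 * (101 + u) - 1) * (101 + u)\<^sup>2 \<le> 3.1 * (100 + u) ^ 3"
      using u(1) by simp
    then have "(3 * real m - 1) * (real m)\<^sup>2 \<le> 3.1 * (real m - 1) ^ 3" by (simp add: u(2))
    moreover have "0 < (real m - 1) ^ 3" "0 < (real m)\<^sup>2" using m by auto
    ultimately show ?thesis by (simp add: excess3_def divide_simps)
  qed
  then have "excess3 m * ln (real m) \<le> 3.1 / (real m)\<^sup>2 * ln (real m)"
    using m by (intro mult_right_mono) auto
  also have "\<dots> = 1.55 * (2 * ln (real m) / (real m)\<^sup>2)" by simp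
  also have "\<dots> \<le> 1.55 * ((ln (real m - 2) + 1) / (real m - 2) - (ln (real m) + 1) / real m)"
  proof (intro mult_left_mono ln_over_square_le_telescope)
    have "real m / (real m - 2) \<le> 2 * (693 / 1000)" using m by (simp add: divide_simps)
    also have "\<dots> \<le> 2 * ln 2" using ln_2_bounds by simp
    also have "\<dots> = ln (4::real)" using ln_realpow[of 2 2] by simp
    also have "\<dots> \<le> ln (real m)" using m by simp
    finally show "real m / (real m - 2) \<le> ln (real m)" .
  qed (use m in auto)
  finally show ?thesis .
qed

text \<open>The primes 2 and 3 have no excess, as \<open>1 - omega / p >= 1 / p\<close> exceeds
  \<open>(1 - 1 / p)^3\<close> there. Primes from 5 to 97 are listed; larger ones are replaced by
  the odd numbers from 101 on. The two parts give \<open>0.8295 + 0.088 < 0.92\<close>.\<close>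

lemma sum_excess_3_le:
  assumes Om: "\<And>p. prime p \<Longrightarrow> card (Omega p) < p" "\<And>p. prime p \<Longrightarrow> card (Omega p) \<le> 3"
  shows "(\<Sum>p\<in>primes_upto n. excess (real (card (Omega p)) / real p) p 3 * ln (real p)) \<le> 0.92"
proof -
  define e where "e = (\<lambda>p. excess (real (card (Omega p)) / real p) p 3 * ln (real p))"
  define v where "v = (\<lambda>m. excess3 m * ln (real m))"
  define G where "G = (\<lambda>t::real. (ln t + 1) / t)"
  have v0: "0 \<le> v m" if "m \<ge> 1" for m
    using that unfolding v_def excess3_def by (intro mult_nonneg_nonneg divide_nonneg_nonneg) auto
  have e2: "e 2 = 0" using Om(1)[of 2]
    by (simp add: e_def excess_def min_def power3_eq_cube)
  have e3: "e 3 = 0"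
  proof -
    have "real (card (Omega 3)) \<le> 2" using Om(1)[of 3] by simp
    then show ?thesis by (simp add: e_def excess_def min_def power3_eq_cube)
  qed
  have e5: "e p \<le> v p" if "prime p" "p \<ge> 5" for p
  proof -
    have "excess (real (card (Omega p)) / real p) p 3 \<le> 1 - (1 - 3 / real p) / (1 - 1 / real p) ^ 3"
    proof (rule excess_le)
      have "0 < (1 - 1 / real p) ^ 3" using that by simp
      moreover have "real (card (Omega p)) \<le> 3" using Om(2)[OF that(1)] by simp
      ultimately show "(1 - 3 / real p) / (1 - 1 / real p) ^ 3 \<le> (1 - real (card (Omega p)) / real p) / (1 - 1 / real p) ^ 3"
        by (intro divide_right_mono diff_left_mono) auto
      show "(1 - 3 / real p) / (1 - 1 / real p) ^ 3 \<le> 1"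
        using local_factor_bounds(2)[of p 3 3] that by simp
    qed
    also have "\<dots> = excess3 p"
    proof -
      have "(1 - 1 / real p) = (real p - 1) / real p" "(1 - 3 / real p) = (real p - 3) / real p"
        using that by (auto simp: field_simps)
      then have "(1 - 3 / real p) / (1 - 1 / real p) ^ 3 = (real p - 3) * (real p)\<^sup>2 / (real p - 1) ^ 3"
        using that by (simp add: power_divide power3_eq_cube power2_eq_square)
      moreover have "1 = (real p - 1) ^ 3 / (real p - 1) ^ 3" using that by simp
      ultimately have "1 - (1 - 3 / real p) / (1 - 1 / real p) ^ 3
          = ((real p - 1) ^ 3 - (real p - 3) * (real p)\<^sup>2) / (real p - 1) ^ 3"
        by (metis diff_divide_distrib)
      also have "(real p - 1) ^ 3 - (real p - 3) * (real p)\<^sup>2 = 3 * real p - 1"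
        by (simp add: power3_eq_cube power2_eq_square algebra_simps)
      finally show ?thesis by (simp add: excess3_def)
    qed
    finally show ?thesis unfolding e_def v_def using that by (intro mult_right_mono) auto
  qed
  define T where "T = (\<lambda>j. 2 * j + 101) ` {..n}"
  have "(\<Sum>p\<in>primes_upto n. e p) = (\<Sum>p\<in>primes_upto n - {2, 3}. e p)"
    using e2 e3 by (intro sum.mono_neutral_right) auto
  also have "\<dots> \<le> (\<Sum>p\<in>primes_upto n - {2, 3}. v p)"
  proof (rule sum_mono)
    fix p assume p: "p \<in> primes_upto n - {2, 3}"
    then have "p \<ge> 2" "p \<noteq> 4" by (auto simp: primes_upto_def prime_ge_2_nat)
    then have "p \<ge> 5" using p by auto
    then show "e p \<le> v p" using p by (intro e5) (auto simp: primes_upto_def)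
  qed
  also have "\<dots> \<le> (\<Sum>p\<in>set small_primes \<union> T. v p)"
  proof (rule sum_mono2)
    show "primes_upto n - {2, 3} \<subseteq> set small_primes \<union> T"
    proof
      fix p assume p: "p \<in> primes_upto n - {2, 3}"
      then have pr: "prime p" "p \<le> n" "p \<ge> 2" "p \<noteq> 4" "p \<noteq> 2" "p \<noteq> 3"
        by (auto simp: primes_upto_def prime_ge_2_nat)
      show "p \<in> set small_primes \<union> T"
      proof (cases "p < 101")
        case True
        then show ?thesis using prime_less_101_cases[of p] pr by auto
      next
        case False
        then have "odd p" using pr prime_odd_nat[of p] by auto
        then obtain j where j: "p = 2 * j + 1" by (elim oddE)
        then have "p = 2 * (j - 50) + 101" "j - 50 \<le> n" using False pr by auto
        then show ?thesis unfolding T_def by blast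
      qed
    qed
    show "0 \<le> v p" if "p \<in> set small_primes \<union> T - (primes_upto n - {2, 3})" for p
      using that by (intro v0) (auto simp: T_def small_primes_def)
  qed (simp add: T_def)
  also have "\<dots> \<le> (\<Sum>p\<in>set small_primes. v p) + (\<Sum>p\<in>T. v p)"
  proof -
    have "0 \<le> (\<Sum>p\<in>set small_primes \<inter> T. v p)"
      by (intro sum_nonneg v0) (auto simp: T_def)
    then show ?thesis by (subst sum.union_inter[symmetric]) (auto simp: T_def sum_Un)
  qed
  also have "(\<Sum>p\<in>set small_primes. v p) \<le> 0.8295"
    unfolding v_def by (rule sum_small_primes)
  also have "(\<Sum>p\<in>T. v p) = (\<Sum>j\<le>n. v (2 * j + 101))"
    unfolding T_def by (subst sum.reindex) (auto simp: inj_on_def)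
  also have "\<dots> \<le> (\<Sum>j\<le>n. 1.55 * (G (2 * real j + 99) - G (2 * real j + 101)))"
  proof (rule sum_mono)
    fix j assume "j \<in> {..n}"
    then show "v (2 * j + 101) \<le> 1.55 * (G (2 * real j + 99) - G (2 * real j + 101))"
      using excess3_mult_ln_le[of "2 * j + 101"] by (simp add: v_def G_def algebra_simps)
  qed
  also have "\<dots> = 1.55 * (\<Sum>j\<le>n. G (2 * real j + 99) - G (2 * real j + 101))"
    by (rule sum_distrib_left[symmetric])
  also have "(\<Sum>j\<le>n. G (2 * real j + 99) - G (2 * real j + 101)) = G 99 - G (101 + 2 * real n)"
    by (induction n) (auto simp: algebra_simps)
  also have "\<dots> \<le> G 99"
  proof -
    have "0 \<le> G (101 + 2 * real n)" by (simp add: G_def)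
    then show ?thesis by simp
  qed
  also have "1.55 * G 99 \<le> 0.088"
  proof -
    have "ln (99::real) \<le> 73 / 11 * ln 2" using ln_le_ratio_ln_2[of 99 11 73] by simp
    then have "ln (99::real) \<le> 4.61" using ln_2_bounds by simp
    then show ?thesis by (simp add: G_def)
  qed
  finally show ?thesis by (simp add: e_def)
qed

section \<open>The size of M and the cubic polynomial\<close>

lemma ln_floor_sqrt_ge:
  assumes "2 \<le> N"
  defines "M \<equiv> floor_sqrt (N div 2)"
  shows "M \<ge> 1" "2 * M\<^sup>2 \<le> N" "(ln (real N) - ln 2) / 2 - 1 / real M \<le> ln (real M)"
proof -
  show M1: "M \<ge> 1" using assms(1) by (simp add: M_def Suc_le_eq)
  have "M\<^sup>2 \<le> N div 2" by (simp add: M_def)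
  then show "2 * M\<^sup>2 \<le> N" by linarith
  have "N div 2 < (Suc M)\<^sup>2" unfolding M_def by (rule Suc_floor_sqrt_power2_gt)
  then have "N \<le> 2 * (Suc M)\<^sup>2" by linarith
  then have "real N \<le> real (2 * (Suc M)\<^sup>2)" by (simp only: of_nat_le_iff)
  then have "ln (real N) \<le> ln (2 * (real (Suc M))\<^sup>2)" using assms(1) by simp
  also have "\<dots> = ln 2 + 2 * ln (real (Suc M))" by (simp add: ln_mult ln_realpow)
  \<comment> \<open>Rounding \<open>sqrt (N / 2)\<close> down costs at most \<open>1 / M\<close> in
    the logarithm.\<close>
  also have "ln (real (Suc M)) \<le> ln (real M) + 1 / real M"
  proof -
    have "ln (real (Suc M)) - ln (real M) = ln (1 + 1 / real M)"
      using M1 by (subst ln_divide_pos[symmetric]) (auto simp: field_simps)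
    also have "\<dots> \<le> 1 / real M" by (rule ln_add_one_self_le_self) auto
    finally show ?thesis by simp
  qed
  finally have "ln (real N) \<le> ln 2 + 2 * (ln (real M) + 1 / real M)" by simp
  then show "(ln (real N) - ln 2) / 2 - 1 / real M \<le> ln (real M)" by argo
qed

lemma ln_437400_ge: "12.97 \<le> ln (437400::real)"
proof -
  \<comment> \<open>The threshold factors into powers of 2, 3 and 5; rational lower bounds for the
    binary logarithms of 3 and 5 reduce its logarithm to \<open>ln 2\<close>.\<close>
  have "ln (437400::real) = ln (2 ^ 3 * (3 ^ 7 * 5 ^ 2))" by simp
  also have "\<dots> = 3 * ln 2 + 7 * ln 3 + 2 * ln 5"
    by (simp add: ln_mult ln_realpow del: mult_numeral_left_semiring_numeral power_numeral)
  also have "84 / 53 * ln 2 \<le> ln (3::real)" using ln_ge_ratio_ln_2[of 3 53 84] by simp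
  then have "3 * ln 2 + 7 * (84 / 53 * ln 2) + 2 * (65 / 28 * ln 2) \<le> 3 * ln 2 + 7 * ln 3 + 2 * ln (5::real)"
    using ln_ge_ratio_ln_2[of 5 28 65] by simp
  finally show ?thesis using ln_2_bounds by simp
qed

text \<open>3.924 is \<open>2 * 0.92 + 2.084\<close>, where 2.084 bounds
  \<open>3 * ln 2 + 2 / M\<close> for \<open>M >= 467\<close>. Both claims are expanded at 12.97, a
  lower bound for the logarithm of the threshold; the second is needed to divide by the
  polynomial.\<close>

lemma cubic_bound:
  fixes t :: real
  assumes "12.97 \<le> t"
  shows "t ^ 3 - 34.549 * t ^ 2 + 379.423 * t - 553.222 < (t - 3.924) ^ 3"
    and "0 < t ^ 3 - 34.549 * t ^ 2 + 379.423 * t - 553.222"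
proof -
  define u where "u = t - 12.97"
  have u: "0 \<le> u" "t = u + 12.97" using assms by (auto simp: u_def)
  have "(t - 3.924) ^ 3 - (t ^ 3 - 34.549 * t ^ 2 + 379.423 * t - 553.222)
      = 22777 / 1000 * u\<^sup>2 + 64401427 / 250000 * u + 594930109 / 250000000"
    unfolding u(2) by (simp add: power2_eq_square power3_eq_cube field_simps)
  also have "\<dots> > 0" using u(1) by (simp add: add_nonneg_pos)
  finally show "t ^ 3 - 34.549 * t ^ 2 + 379.423 * t - 553.222 < (t - 3.924) ^ 3" by simp
  \<comment> \<open>In powers of \<open>u\<close> the linear coefficient is negative; the square
    around 1.4 absorbs it.\<close>
  have "t ^ 3 - 34.549 * t ^ 2 + 379.423 * t - 553.222
      = u ^ 3 + 4361 / 1000 * (u - 1.4)\<^sup>2 + 1193 / 12500 * u + 7293079489 / 10000000"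
    unfolding u(2) by (simp add: power2_eq_square power3_eq_cube field_simps)
  also have "\<dots> > 0" using u(1) by (simp add: add_nonneg_pos)
  finally show "0 < t ^ 3 - 34.549 * t ^ 2 + 379.423 * t - 553.222" .
qed

theorem theorem2:
  fixes N :: nat and A :: "nat set" and Omega :: "nat \<Rightarrow> nat set"
    and kappa :: nat and P0 :: "nat set"
  assumes N_pos: "N > 0"
    and A_sub: "A \<subseteq> {1..N}"
    and Omega_sub: "\<And>p. prime p \<Longrightarrow> Omega p \<subseteq> {0..<p}"
    and kappa_ge: "kappa \<ge> 3"
    and P0_fin: "finite P0" and P0_primes: "\<forall>p\<in>P0. prime p"
    and C1a: "\<And>p. p \<in> P0 \<Longrightarrow> card (Omega p) < kappa"
    and C1b: "\<And>p. prime p \<Longrightarrow> p \<notin> P0 \<Longrightarrow> card (Omega p) = kappa"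
    and C2: "\<And>p. prime p \<Longrightarrow> card (Omega p) < p"
  shows
    "(kappa = 3 \<and> N \<ge> 437400 \<longrightarrow>
        real (sifting_fun A Omega (sqrt (2 / 3 * real N)))
          < 48 * sieve_prod Omega kappa * real N /
            ((ln (real N)) ^ 3 - 34.549 * (ln (real N)) ^ 2 + 379.423 * ln (real N) - 553.222))
     \<and>
     (let r = 5.961 * 10 ^ 14 * real kappa ^ 2 * ln (real kappa) in
        real N > exp r \<longrightarrow>
        real (sifting_fun A Omega (sqrt (2 / 3 * real N)))
          < 2 ^ kappa * fact kappa * sieve_prod Omega kappa * real N / (ln (real N)) ^ kappa
            / (1 - r / ln (real N)))"
proof -
  define T where "T = ln (real N)"
  define V where "V = sieve_prod Omega kappa"
  define S where "S = real (sifting_fun A Omega (sqrt (2 / 3 * real N)))"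
  have w_le: "card (Omega p) \<le> kappa" if "prime p" for p
    using C1a[of p] C1b[OF that] by (cases "p \<in> P0") auto
  define M where "M = floor_sqrt (N div 2)"
  have sieve: "V > 0" "S * (ln (real M) - ln 2 - c) ^ kappa \<le> fact kappa * V * real N"
    if "2 \<le> N" "ln (real M) - ln 2 - c > 0"
      "\<And>n. (\<Sum>p\<in>primes_upto n. excess (real (card (Omega p)) / real p) p kappa * ln (real p)) \<le> c" for c
    unfolding V_def S_def
    using sifting_fun_bound[OF A_sub Omega_sub _ P0_fin C1b C2, where M = M and c = c] kappa_ge that
      ln_floor_sqrt_ge[OF that(1)] by (simp_all add: M_def)
  \<comment> \<open>\<open>2 * l\<close> is close to \<open>log N\<close>, which explains the factor
    \<open>2^kappa\<close>. The gap between \<open>D\<close> and \<open>(2 * l)^kappa\<close> makes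
    the final inequality strict.\<close>
  have bound: "S < 2 ^ kappa * fact kappa * V * real N / D"
    if V: "V > 0" and N: "2 \<le> N" and D: "0 < D" "D < (2 * l) ^ kappa" and l: "0 < l"
      and le: "S * l ^ kappa \<le> fact kappa * V * real N" for l D
  proof -
    have "S * (2 * l) ^ kappa \<le> 2 ^ kappa * fact kappa * V * real N"
      using mult_left_mono[OF le, of "2 ^ kappa"] by (simp add: power_mult_distrib mult_ac)
    then have "S \<le> 2 ^ kappa * fact kappa * V * real N / (2 * l) ^ kappa"
      using l by (simp add: pos_le_divide_eq)
    also have "\<dots> < 2 ^ kappa * fact kappa * V * real N / D"
      using V N D by (intro divide_strict_left_mono mult_pos_pos) auto
    finally show ?thesis .
  qed
  have "S < 48 * V * real N / (T ^ 3 - 34.549 * T ^ 2 + 379.423 * T - 553.222)"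
    if "kappa = 3" and N: "437400 \<le> N"
  proof -
    have N2: "2 \<le> N" using N by simp
    have T: "12.97 \<le> T"
    proof -
      have "ln 437400 \<le> T" unfolding T_def using N by (subst ln_le_cancel_iff) auto
      then show ?thesis using ln_437400_ge by linarith
    qed
    define l where "l = ln (real M) - ln 2 - 0.92"
    \<comment> \<open>467 is the integer part of \<open>sqrt (437400 / 2)\<close>.\<close>
    have "467 \<le> M" unfolding M_def using N by (intro le_floor_sqrtI) simp
    then have "1 / real M \<le> 1 / 467" by (intro divide_left_mono) auto
    moreover define x where "x = 1 / real M"
    ultimately have "3 * ln 2 + 2 * x \<le> 2.084" using ln_2_bounds by simp
    moreover have "T - ln 2 - 2 * x \<le> 2 * ln (real M)"
      using ln_floor_sqrt_ge(3)[OF N2] unfolding M_def[symmetric] T_def[symmetric] x_def by argo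
    ultimately have tl: "T - 3.924 \<le> 2 * l" unfolding l_def by simp
    have l0: "0 < l" using tl T by simp
    have c: "(\<Sum>p\<in>primes_upto n. excess (real (card (Omega p)) / real p) p kappa * ln (real p)) \<le> 0.92" for n
      using sum_excess_3_le[of Omega n] C2 w_le \<open>kappa = 3\<close> by simp
    have "T ^ 3 - 34.549 * T ^ 2 + 379.423 * T - 553.222 < (T - 3.924) ^ 3"
      by (rule cubic_bound(1)[OF T])
    also have "\<dots> \<le> (2 * l) ^ 3" using tl T by (intro power_mono) auto
    finally have "S < 2 ^ kappa * fact kappa * V * real N / (T ^ 3 - 34.549 * T ^ 2 + 379.423 * T - 553.222)"
      using sieve[OF N2 _ c] l0 cubic_bound(2)[OF T] N2 \<open>kappa = 3\<close>
      by (intro bound[of _ l]) (auto simp: l_def)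
    then show ?thesis using \<open>kappa = 3\<close> by (simp add: fact_numeral)
  qed
  moreover have "S < 2 ^ kappa * fact kappa * V * real N / T ^ kappa / (1 - r / T)"
    if r: "r = 5.961 * 10 ^ 14 * real kappa ^ 2 * ln (real kappa)" and N: "exp r < real N" for r
  proof -
    define c where "c = 3 * real kappa * ln (real kappa)"
    have k: "3 \<le> real kappa" "1 \<le> ln (real kappa)" using kappa_ge ln_ge_1[OF kappa_ge] by auto
    have kk: "real kappa * 1 \<le> (real kappa)\<^sup>2 * ln (real kappa)"
    proof -
      have "real kappa * 1 \<le> real kappa * (real kappa * ln (real kappa))"
        using k mult_mono[of 1 "real kappa" 1 "ln (real kappa)"] by (intro mult_left_mono) auto
      then show ?thesis by (simp add: power2_eq_square mult.assoc)
    qed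
    \<comment> \<open>\<open>2 * c\<close> accounts for the shift, and 6 generously bounds
      \<open>3 * ln 2 + 2 / M\<close> for \<open>M >= 1\<close>.\<close>
    define d where "d = 2 * c + 6"
    have dr: "real kappa * d < r"
    proof -
      have "real kappa * d = 6 * ((real kappa)\<^sup>2 * ln (real kappa)) + 6 * real kappa"
        by (simp add: d_def c_def power2_eq_square algebra_simps)
      also have "\<dots> \<le> 12 * ((real kappa)\<^sup>2 * ln (real kappa))" using kk by argo
      also have "\<dots> < 5.961 * 10 ^ 14 * ((real kappa)\<^sup>2 * ln (real kappa))"
        using kk k by (intro mult_strict_right_mono) auto
      finally show ?thesis unfolding r by (simp add: mult.assoc)
    qed
    have c0: "0 < c" unfolding c_def using k by simp
    have d0: "0 < d" using c0 by (simp add: d_def)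
    have "d \<le> real kappa * d" using k d0 by (simp add: mult_le_cancel_right1)
    then have rd: "d < r" using dr by linarith
    have "exp r > 2" using exp_ge_add_one_self[of r] rd c0 unfolding d_def by linarith
    then have N2: "2 \<le> N" using N by linarith
    have T: "r < T" unfolding T_def using N N2 by (metis exp_less_cancel_iff exp_ln of_nat_0_less_iff less_le_trans zero_less_numeral)
    define l where "l = ln (real M) - ln 2 - c"
    have "M \<ge> 1" using ln_floor_sqrt_ge(1)[OF N2] by (simp add: M_def)
    then have "1 / real M \<le> 1" by simp
    moreover define x where "x = 1 / real M"
    ultimately have "3 * ln 2 + 2 * x \<le> 6" using ln_2_bounds by simp
    moreover have "T - ln 2 - 2 * x \<le> 2 * ln (real M)"
      using ln_floor_sqrt_ge(3)[OF N2] unfolding M_def[symmetric] T_def[symmetric] x_def by argo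
    ultimately have tl: "T - d \<le> 2 * l" unfolding l_def d_def by simp
    have T0: "0 < T" using T rd d0 by linarith
    have l0: "0 < l" using tl T rd by simp
    have c: "(\<Sum>p\<in>primes_upto n. excess (real (card (Omega p)) / real p) p kappa * ln (real p)) \<le> c" for n
      unfolding c_def using sum_excess_le[of kappa Omega n] C2 w_le kappa_ge by simp
    \<comment> \<open>Bernoulli's inequality linearises \<open>(1 - d / T)^kappa\<close>, and
      \<open>kappa * d < r\<close> provides the strictness.\<close>
    have "1 - r / T < 1 + real kappa * (- d / T)"
      using dr T0 by (simp add: divide_strict_right_mono)
    also have "\<dots> \<le> (1 + (- d / T)) ^ kappa"
      using T rd T0 by (intro Bernoulli_inequality) (simp add: field_simps)
    finally have "T ^ kappa * (1 - r / T) < T ^ kappa * (1 + (- d / T)) ^ kappa"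
      using T0 by (intro mult_strict_left_mono) auto
    also have "\<dots> = (T - d) ^ kappa"
      using T0 by (simp add: power_mult_distrib[symmetric] right_diff_distrib)
    also have "\<dots> \<le> (2 * l) ^ kappa" using tl T rd by (intro power_mono) auto
    finally have "S < 2 ^ kappa * fact kappa * V * real N / (T ^ kappa * (1 - r / T))"
      using sieve[OF N2 _ c] l0 N2 T T0
      by (intro bound[of _ l]) (auto simp: l_def intro!: mult_pos_pos)
    then show ?thesis by simp
  qed
  ultimately show ?thesis
    unfolding Let_def S_def V_def T_def by blast
qed

end
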